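(* Let $\mathcal{N}$ be a pure non-characteristically nilpotent Lie algebra. Then any non-maximal solvable extension of $\mathcal{N}$ admits an outer derivation (i.e. a derivation that is not inner).
   Context: All Lie algebras are finite-dimensional over $\mathbb{C}$. A nilpotent Lie algebra is characteristically nilpotent if all its derivations are nilpotent; it is split if it is a direct sum of two nonzero ideals. A nilpotent Lie algebra is pure non-characteristically nilpotent if either it is non-split and not characteristically nilpotent, or it is split and has no characteristically nilpotent direct factor. A solvable extension of a nilpotent Lie algebra $\mathcal{N}$ is a solvable Lie algebra whose nilradical is $\mathcal{N}$; it is maximal if its dimension is the largest possible among solvable Lie algebras with nilradical $\mathcal{N}$, equivalently if the codimension of $\mathcal{N}$ in it equals the dimension of a maximal torus of $\mathcal{N}$ (a maximal abelian subalgebra of $Der(\mathcal{N})$ consisting of diagonalizable derivations); otherwise it is non-maximal. *)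

theory Defs
  imports Complex_Main "HOL-Library.Function_Algebras"
begin

section \<open>Finite-dimensional complex Lie algebras\<close>

text \<open>
  A Lie algebra is carried by a linear subspace of an ambient complex vector space, so that
  subalgebras and ideals are again objects of the same kind: a subset \<open>I\<close> of the carrier
  of \<open>L\<close> with the inherited operations is \<open>L\<lparr>lcarrier := I\<rparr>\<close>. The bracket is only
  constrained on the carrier.
\<close>

record 'a lie =
  lscale :: "complex \<Rightarrow> 'a \<Rightarrow> 'a"
  lcarrier :: "'a set"
  lbracket :: "'a \<Rightarrow> 'a \<Rightarrow> 'a"

locale lie_algebra = vector_space "lscale L" for L :: "'a::ab_group_add lie" +
  assumes carrier_subspace: "subspace (lcarrier L)"
    and carrier_fin_dim: "\<exists>B. finite B \<and> lcarrier L = span B"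
    and bracket_closed: "x \<in> lcarrier L \<Longrightarrow> y \<in> lcarrier L \<Longrightarrow> lbracket L x y \<in> lcarrier L"
    and bracket_add_left: "x \<in> lcarrier L \<Longrightarrow> y \<in> lcarrier L \<Longrightarrow> z \<in> lcarrier L \<Longrightarrow>
      lbracket L (x + y) z = lbracket L x z + lbracket L y z"
    and bracket_add_right: "x \<in> lcarrier L \<Longrightarrow> y \<in> lcarrier L \<Longrightarrow> z \<in> lcarrier L \<Longrightarrow>
      lbracket L x (y + z) = lbracket L x y + lbracket L x z"
    and bracket_scale_left: "x \<in> lcarrier L \<Longrightarrow> y \<in> lcarrier L \<Longrightarrow>
      lbracket L (lscale L c x) y = lscale L c (lbracket L x y)"
    and bracket_scale_right: "x \<in> lcarrier L \<Longrightarrow> y \<in> lcarrier L \<Longrightarrow>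
      lbracket L x (lscale L c y) = lscale L c (lbracket L x y)"
    and bracket_self: "x \<in> lcarrier L \<Longrightarrow> lbracket L x x = 0"
    and jacobi: "x \<in> lcarrier L \<Longrightarrow> y \<in> lcarrier L \<Longrightarrow> z \<in> lcarrier L \<Longrightarrow>
      lbracket L x (lbracket L y z) + lbracket L y (lbracket L z x)
        + lbracket L z (lbracket L x y) = 0"

definition lie_dim :: "'a::ab_group_add lie \<Rightarrow> nat" where
  "lie_dim L = vector_space.dim (lscale L) (lcarrier L)"

definition lie_isomorphic :: "'a::ab_group_add lie \<Rightarrow> 'b::ab_group_add lie \<Rightarrow> bool" where
  "lie_isomorphic L M \<longleftrightarrow> (\<exists>f. bij_betw f (lcarrier L) (lcarrier M) \<and>
     (\<forall>x\<in>lcarrier L. \<forall>y\<in>lcarrier L. f (x + y) = f x + f y) \<and>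
     (\<forall>c. \<forall>x\<in>lcarrier L. f (lscale L c x) = lscale M c (f x)) \<and>
     (\<forall>x\<in>lcarrier L. \<forall>y\<in>lcarrier L. f (lbracket L x y) = lbracket M (f x) (f y)))"


section \<open>Ideals, nilpotency, solvability, nilradical\<close>

definition lie_ideal :: "'a::ab_group_add lie \<Rightarrow> 'a set \<Rightarrow> bool" where
  "lie_ideal L I \<longleftrightarrow> I \<subseteq> lcarrier L \<and> module.subspace (lscale L) I \<and>
     (\<forall>x\<in>lcarrier L. \<forall>y\<in>I. lbracket L x y \<in> I)"

definition bracket_span :: "'a::ab_group_add lie \<Rightarrow> 'a set \<Rightarrow> 'a set \<Rightarrow> 'a set" where
  "bracket_span L A B = module.span (lscale L) {lbracket L x y | x y. x \<in> A \<and> y \<in> B}"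

primrec lower_central :: "'a::ab_group_add lie \<Rightarrow> nat \<Rightarrow> 'a set" where
  "lower_central L 0 = lcarrier L"
| "lower_central L (Suc n) = bracket_span L (lcarrier L) (lower_central L n)"

primrec derived_series :: "'a::ab_group_add lie \<Rightarrow> nat \<Rightarrow> 'a set" where
  "derived_series L 0 = lcarrier L"
| "derived_series L (Suc n) = bracket_span L (derived_series L n) (derived_series L n)"

definition lie_nilpotent :: "'a::ab_group_add lie \<Rightarrow> bool" where
  "lie_nilpotent L \<longleftrightarrow> (\<exists>n. lower_central L n = {0})"

definition lie_solvable :: "'a::ab_group_add lie \<Rightarrow> bool" where
  "lie_solvable L \<longleftrightarrow> (\<exists>n. derived_series L n = {0})"

definition is_nilradical :: "'a::ab_group_add lie \<Rightarrow> 'a set \<Rightarrow> bool" where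
  "is_nilradical L I \<longleftrightarrow> lie_ideal L I \<and> lie_nilpotent (L\<lparr>lcarrier := I\<rparr>) \<and>
     (\<forall>J. lie_ideal L J \<and> lie_nilpotent (L\<lparr>lcarrier := J\<rparr>) \<longrightarrow> J \<subseteq> I)"


section \<open>Derivations\<close>

text \<open>Only the restriction of \<open>D\<close> to the carrier is relevant in the next three notions.\<close>

definition lie_derivation :: "'a::ab_group_add lie \<Rightarrow> ('a \<Rightarrow> 'a) \<Rightarrow> bool" where
  "lie_derivation L D \<longleftrightarrow> (\<forall>x\<in>lcarrier L. D x \<in> lcarrier L) \<and>
     (\<forall>x\<in>lcarrier L. \<forall>y\<in>lcarrier L. D (x + y) = D x + D y) \<and>
     (\<forall>c. \<forall>x\<in>lcarrier L. D (lscale L c x) = lscale L c (D x)) \<and>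
     (\<forall>x\<in>lcarrier L. \<forall>y\<in>lcarrier L.
        D (lbracket L x y) = lbracket L (D x) y + lbracket L x (D y))"

definition nilpotent_map :: "'a::ab_group_add lie \<Rightarrow> ('a \<Rightarrow> 'a) \<Rightarrow> bool" where
  "nilpotent_map L D \<longleftrightarrow> (\<exists>k. \<forall>x\<in>lcarrier L. (D ^^ k) x = 0)"

definition inner_derivation :: "'a::ab_group_add lie \<Rightarrow> ('a \<Rightarrow> 'a) \<Rightarrow> bool" where
  "inner_derivation L D \<longleftrightarrow> (\<exists>a\<in>lcarrier L. \<forall>x\<in>lcarrier L. D x = lbracket L a x)"

definition outer_derivation :: "'a::ab_group_add lie \<Rightarrow> ('a \<Rightarrow> 'a) \<Rightarrow> bool" where
  "outer_derivation L D \<longleftrightarrow> lie_derivation L D \<and> \<not> inner_derivation L D"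


section \<open>Pure non-characteristically nilpotent Lie algebras\<close>

definition characteristically_nilpotent :: "'a::ab_group_add lie \<Rightarrow> bool" where
  "characteristically_nilpotent L \<longleftrightarrow>
     lie_nilpotent L \<and> (\<forall>D. lie_derivation L D \<longrightarrow> nilpotent_map L D)"

definition lie_splitting :: "'a::ab_group_add lie \<Rightarrow> 'a set \<Rightarrow> 'a set \<Rightarrow> bool" where
  "lie_splitting L I J \<longleftrightarrow> lie_ideal L I \<and> lie_ideal L J \<and> I \<noteq> {0} \<and> J \<noteq> {0} \<and>
     I \<inter> J = {0} \<and> lcarrier L = {x + y | x y. x \<in> I \<and> y \<in> J}"

definition lie_split :: "'a::ab_group_add lie \<Rightarrow> bool" where
  "lie_split L \<longleftrightarrow> (\<exists>I J. lie_splitting L I J)"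

text \<open>
  Direct factors are the nonzero proper ones; the zero algebra counts as characteristically
  nilpotent and would otherwise be a factor of everything.
\<close>

definition pure_non_characteristically_nilpotent :: "'a::ab_group_add lie \<Rightarrow> bool" where
  "pure_non_characteristically_nilpotent L \<longleftrightarrow> lie_nilpotent L \<and>
     ((\<not> lie_split L \<and> \<not> characteristically_nilpotent L) \<or>
      (lie_split L \<and>
        \<not> (\<exists>I J. lie_splitting L I J \<and> characteristically_nilpotent (L\<lparr>lcarrier := I\<rparr>))))"


section \<open>Solvable extensions\<close>

definition solvable_extension :: "'n::ab_group_add lie \<Rightarrow> 'r::ab_group_add lie \<Rightarrow> bool" where
  "solvable_extension N R \<longleftrightarrow> lie_algebra R \<and> lie_solvable R \<and>
     (\<exists>I. is_nilradical R I \<and> lie_isomorphic N (R\<lparr>lcarrier := I\<rparr>))"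

text \<open>
  Maximality compares \<open>R\<close> with all solvable extensions of \<open>N\<close>. As one cannot quantify over
  types, these range over the Lie algebras carried by subspaces of \<open>nat \<Rightarrow> complex\<close>. This is no
  restriction, by the lemma \<open>maximal_solvable_extension_dim_le\<close> below.
\<close>

definition maximal_solvable_extension :: "'n::ab_group_add lie \<Rightarrow> 'r::ab_group_add lie \<Rightarrow> bool" where
  "maximal_solvable_extension N R \<longleftrightarrow> solvable_extension N R \<and>
     (\<forall>M :: (nat \<Rightarrow> complex) lie. solvable_extension N M \<longrightarrow> lie_dim M \<le> lie_dim R)"

definition non_maximal_solvable_extension :: "'n::ab_group_add lie \<Rightarrow> 'r::ab_group_add lie \<Rightarrow> bool" where
  "non_maximal_solvable_extension N R \<longleftrightarrow>
     solvable_extension N R \<and> \<not> maximal_solvable_extension N R"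


subsection \<open>Independence of the type in the definition of maximality\<close>

context lie_algebra
begin

lemma lie_algebra_embed_nat:
  obtains f :: "'a \<Rightarrow> nat \<Rightarrow> complex"
  where "Vector_Spaces.linear (lscale L) (\<lambda>c v i. c * v i) f" "inj_on f (lcarrier L)"
proof -
  obtain C where C: "finite C" "lcarrier L = span C"
    using carrier_fin_dim by blast
  obtain B where B: "B \<subseteq> lcarrier L" "independent B" "lcarrier L \<subseteq> span B"
    by (rule basis_exists)
  have "finite B"
    using independent_span_bound[OF C(1) B(2)] B(1) C(2) by simp
  then obtain h and n :: nat where h: "bij_betw h {..<n} B"
    using ex_bij_betw_nat_finite[of B] atLeast0LessThan by metis
  define E where "E = extend_basis B"
  have E: "independent E" "span E = UNIV" "B \<subseteq> E"
    using independent_extend_basis span_extend_basis extend_basis_superset B(2)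
    by (auto simp: E_def)
  define f where "f x = (\<lambda>i. if i < n then representation E x (h i) else 0)" for x
  have vs: "vector_space (\<lambda>(c::complex) v (i::nat). c * v i)"
    by unfold_locales (auto simp: fun_eq_iff algebra_simps)
  have 1: "Vector_Spaces.linear (lscale L) (\<lambda>c v i. c * v i) f"
    unfolding Vector_Spaces.linear_iff using vs vector_space_axioms E
    by (auto simp: f_def fun_eq_iff representation_add representation_scale)
  have 2: "inj_on f (lcarrier L)"
  proof (rule inj_onI)
    fix x y assume xy: "x \<in> lcarrier L" "y \<in> lcarrier L" "f x = f y"
    have sp: "x \<in> span B" "y \<in> span B" using xy B by auto
    have "representation E x b = representation E y b" for b
    proof (cases "b \<in> B")
      case True
      then obtain i where "i < n" "h i = b" using h by (auto simp: bij_betw_def)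
      then show ?thesis using fun_cong[OF xy(3), of i] by (simp add: f_def)
    next
      case False
      then show ?thesis
        using representation_extend[OF E(1) sp(1) E(3)] representation_extend[OF E(1) sp(2) E(3)]
          representation_ne_zero[of B x b] representation_ne_zero[of B y b] by metis
    qed
    then have "representation E x = representation E y" by blast
    then show "x = y"
      by (metis sum_nonzero_representation_eq[OF E(1)] E(2) UNIV_I)
  qed
  show thesis using that[OF 1 2] .
qed

end

definition lie_image :: "(complex \<Rightarrow> 'b \<Rightarrow> 'b) \<Rightarrow> ('a \<Rightarrow> 'b) \<Rightarrow> 'a lie \<Rightarrow> 'b lie" where
  "lie_image s f L = \<lparr>lscale = s, lcarrier = f ` lcarrier L,
     lbracket = (\<lambda>u v. f (lbracket L (inv_into (lcarrier L) f u) (inv_into (lcarrier L) f v)))\<rparr>"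

locale lie_embedding = lie_algebra L + f: Vector_Spaces.linear "lscale L" s f
  for L :: "'a::ab_group_add lie" and s :: "complex \<Rightarrow> 'b::ab_group_add \<Rightarrow> 'b" and f +
  assumes inj: "inj_on f (lcarrier L)"
begin

abbreviation "M \<equiv> lie_image s f L"

lemma image_simps [simp]:
  "lscale M = s" "lcarrier M = f ` lcarrier L"
  "x \<in> lcarrier L \<Longrightarrow> y \<in> lcarrier L \<Longrightarrow> lbracket M (f x) (f y) = f (lbracket L x y)"
  using inj by (auto simp: lie_image_def)

lemma closed [simp]:
  "0 \<in> lcarrier L"
  "x \<in> lcarrier L \<Longrightarrow> y \<in> lcarrier L \<Longrightarrow> x + y \<in> lcarrier L"
  "x \<in> lcarrier L \<Longrightarrow> lscale L c x \<in> lcarrier L"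
  "x \<in> lcarrier L \<Longrightarrow> y \<in> lcarrier L \<Longrightarrow> lbracket L x y \<in> lcarrier L"
  using carrier_subspace bracket_closed by (auto simp: subspace_0 subspace_add subspace_scale)

lemma lie_algebra_image: "lie_algebra M"
proof -
  have "vector_space s" by (rule f.vs2.vector_space_axioms)
  moreover have "f.vs2.subspace (f ` lcarrier L)"
    by (rule f.subspace_image[OF carrier_subspace])
  moreover have "\<exists>B. finite B \<and> f ` lcarrier L = f.vs2.span B"
    using carrier_fin_dim f.span_image by (metis finite_imageI)
  moreover have "lbracket M u v \<in> f ` lcarrier L"
    if "u \<in> f ` lcarrier L" "v \<in> f ` lcarrier L" for u v
    using that by auto
  moreover have "lbracket M (u + v) w = lbracket M u w + lbracket M v w"
    "lbracket M w (u + v) = lbracket M w u + lbracket M w v"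
    "lbracket M (s c u) v = s c (lbracket M u v)"
    "lbracket M u (s c v) = s c (lbracket M u v)"
    "lbracket M u u = 0"
    "lbracket M u (lbracket M v w) + lbracket M v (lbracket M w u) + lbracket M w (lbracket M u v) = 0"
    if uvw: "u \<in> f ` lcarrier L" "v \<in> f ` lcarrier L" "w \<in> f ` lcarrier L" for u v w c
  proof -
    obtain x y z where [simp]: "u = f x" "v = f y" "w = f z"
      and xyz [simp]: "x \<in> lcarrier L" "y \<in> lcarrier L" "z \<in> lcarrier L"
      using uvw by blast
    show "lbracket M (u + v) w = lbracket M u w + lbracket M v w"
      "lbracket M w (u + v) = lbracket M w u + lbracket M w v"
      "lbracket M (s c u) v = s c (lbracket M u v)"
      "lbracket M u (s c v) = s c (lbracket M u v)"
      by (simp_all flip: f.add f.scale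
          add: bracket_add_left bracket_add_right bracket_scale_left bracket_scale_right)
    show "lbracket M u u = 0" by (simp add: bracket_self)
    show "lbracket M u (lbracket M v w) + lbracket M v (lbracket M w u) + lbracket M w (lbracket M u v) = 0"
      by (simp flip: f.add add: jacobi)
  qed
  ultimately show ?thesis
    unfolding lie_algebra_def lie_algebra_axioms_def by simp
qed

lemma bracket_span_subset:
  "A \<subseteq> I \<Longrightarrow> B \<subseteq> I \<Longrightarrow> subspace I \<Longrightarrow> (\<And>x y. x \<in> I \<Longrightarrow> y \<in> I \<Longrightarrow> lbracket L x y \<in> I)
    \<Longrightarrow> bracket_span L A B \<subseteq> I"
  unfolding bracket_span_def by (intro span_minimal) auto

lemma bracket_span_image:
  assumes "A \<subseteq> lcarrier L" "B \<subseteq> lcarrier L"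
  shows "bracket_span M (f ` A) (f ` B) = f ` bracket_span L A B"
proof -
  have "{lbracket M x y | x y. x \<in> f ` A \<and> y \<in> f ` B}
      = f ` {lbracket L x y | x y. x \<in> A \<and> y \<in> B}" (is "?l = ?r")
  proof
    show "?l \<subseteq> ?r" using assms by force
    show "?r \<subseteq> ?l"
    proof
      fix u assume "u \<in> ?r"
      then obtain x y where *: "x \<in> A" "y \<in> B" "u = f (lbracket L x y)" by blast
      then have "u = lbracket M (f x) (f y)" using assms by (simp add: subset_iff)
      then show "u \<in> ?l" using * by blast
    qed
  qed
  then show ?thesis unfolding bracket_span_def using f.span_image by simp
qed

lemma bracket_span_sub [simp]:
  "bracket_span (K\<lparr>lcarrier := I\<rparr>) A B = bracket_span K A B"
  by (simp add: bracket_span_def)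

lemma ideal_subalgebra:
  "lie_ideal L I \<Longrightarrow> x \<in> I \<Longrightarrow> y \<in> I \<Longrightarrow> lbracket L x y \<in> I"
  unfolding lie_ideal_def by blast

lemma image_eq_0_iff: "X \<subseteq> lcarrier L \<Longrightarrow> f ` X = {0} \<longleftrightarrow> X = {0}"
  using inj_on_image_eq_iff[OF inj, of X "{0}"] by simp

lemma lower_central_image:
  assumes "lie_ideal L I"
  shows "lower_central (M\<lparr>lcarrier := f ` I\<rparr>) n = f ` lower_central (L\<lparr>lcarrier := I\<rparr>) n
    \<and> lower_central (L\<lparr>lcarrier := I\<rparr>) n \<subseteq> I"
proof (induction n)
  case (Suc n)
  have I: "I \<subseteq> lcarrier L" "subspace I" using assms by (auto simp: lie_ideal_def)
  let ?X = "lower_central (L\<lparr>lcarrier := I\<rparr>) n"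
  have "bracket_span M (f ` I) (f ` ?X) = f ` bracket_span L I ?X"
    using Suc I(1) by (intro bracket_span_image) blast+
  moreover have "bracket_span L I ?X \<subseteq> I"
    using Suc I ideal_subalgebra[OF assms] by (intro bracket_span_subset) blast+
  ultimately show ?case using Suc by simp
qed simp

lemma nilpotent_image:
  assumes "lie_ideal L I"
  shows "lie_nilpotent (M\<lparr>lcarrier := f ` I\<rparr>) \<longleftrightarrow> lie_nilpotent (L\<lparr>lcarrier := I\<rparr>)"
proof -
  have "I \<subseteq> lcarrier L" using assms by (auto simp: lie_ideal_def)
  then have "lower_central (L\<lparr>lcarrier := I\<rparr>) n \<subseteq> lcarrier L" for n
    using lower_central_image[OF assms] by blast
  then show ?thesis
    unfolding lie_nilpotent_def using lower_central_image[OF assms] image_eq_0_iff by metis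
qed

lemma derived_image:
  "derived_series M n = f ` derived_series L n \<and> derived_series L n \<subseteq> lcarrier L"
proof (induction n)
  case (Suc n)
  let ?X = "derived_series L n"
  have "bracket_span M (f ` ?X) (f ` ?X) = f ` bracket_span L ?X ?X"
    using Suc by (intro bracket_span_image) blast+
  moreover have "bracket_span L ?X ?X \<subseteq> lcarrier L"
    using Suc carrier_subspace bracket_closed by (intro bracket_span_subset) blast+
  ultimately show ?case using Suc by simp
qed simp

lemma solvable_image: "lie_solvable M \<longleftrightarrow> lie_solvable L"
  unfolding lie_solvable_def using derived_image image_eq_0_iff by metis

lemma ideal_image: "lie_ideal L I \<Longrightarrow> lie_ideal M (f ` I)"
  unfolding lie_ideal_def using f.subspace_image by (auto simp: subset_iff)

lemma ideal_preimage:
  assumes "lie_ideal M J"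
  obtains I where "lie_ideal L I" "J = f ` I"
proof
  define I where "I = lcarrier L \<inter> f -` J"
  have J: "J \<subseteq> f ` lcarrier L" "f.vs2.subspace J"
    "\<And>x y. x \<in> f ` lcarrier L \<Longrightarrow> y \<in> J \<Longrightarrow> lbracket M x y \<in> J"
    using assms by (auto simp: lie_ideal_def)
  show "J = f ` I" using J(1) by (auto simp: I_def)
  have "subspace I" unfolding I_def
    by (intro subspace_inter carrier_subspace f.subspace_vimage J)
  moreover have "lbracket L x y \<in> I" if "x \<in> lcarrier L" "y \<in> I" for x y
    using J(3)[of "f x" "f y"] that by (auto simp: I_def)
  ultimately show "lie_ideal L I" by (auto simp: lie_ideal_def I_def)
qed

lemma nilradical_image:
  assumes "is_nilradical L I"
  shows "is_nilradical M (f ` I)"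
  using assms ideal_image nilpotent_image ideal_preimage
  unfolding is_nilradical_def by (metis image_mono)

lemma dim_image: "lie_dim M = lie_dim L"
proof -
  obtain B where B: "B \<subseteq> lcarrier L" "independent B" "lcarrier L \<subseteq> span B" "card B = dim (lcarrier L)"
    by (rule basis_exists)
  have sp: "span B = lcarrier L"
    using B carrier_subspace span_minimal by blast
  have "f.vs2.independent (f ` B)"
    by (rule f.independent_injective_image[OF B(2)]) (simp add: sp inj)
  then have "f.vs2.dim (f.vs2.span (f ` B)) = card (f ` B)"
    by (rule f.vs2.dim_span_eq_card_independent)
  moreover have "card (f ` B) = card B"
    using inj B(1) by (meson card_image inj_on_subset)
  ultimately show ?thesis
    by (simp add: lie_dim_def sp B(4) f.span_image)
qed

lemma lie_isomorphic_image:
  assumes "lie_isomorphic N (L\<lparr>lcarrier := I\<rparr>)" "lie_ideal L I"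
  shows "lie_isomorphic N (M\<lparr>lcarrier := f ` I\<rparr>)"
proof -
  have I: "I \<subseteq> lcarrier L" using assms(2) by (simp add: lie_ideal_def)
  obtain g where g: "bij_betw g (lcarrier N) I"
    "\<And>x y. x \<in> lcarrier N \<Longrightarrow> y \<in> lcarrier N \<Longrightarrow> g (x + y) = g x + g y"
    "\<And>c x. x \<in> lcarrier N \<Longrightarrow> g (lscale N c x) = lscale L c (g x)"
    "\<And>x y. x \<in> lcarrier N \<Longrightarrow> y \<in> lcarrier N \<Longrightarrow> g (lbracket N x y) = lbracket L (g x) (g y)"
    using assms(1) by (auto simp: lie_isomorphic_def)
  have mem: "g x \<in> lcarrier L" if "x \<in> lcarrier N" for x
    using g(1) I that by (auto simp: bij_betw_def)
  have "bij_betw (f \<circ> g) (lcarrier N) (f ` I)"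
    using g(1) inj_on_imp_bij_betw[OF inj_on_subset[OF inj I]] by (rule bij_betw_trans)
  then show ?thesis
    unfolding lie_isomorphic_def
    by (intro exI[of _ "f \<circ> g"]) (simp add: g mem f.add f.scale)
qed

end

lemma maximal_solvable_extension_dim_le:
  fixes M :: "'m::ab_group_add lie"
  assumes "maximal_solvable_extension N R" "solvable_extension N M"
  shows "lie_dim M \<le> lie_dim R"
proof -
  have M: "lie_algebra M" "lie_solvable M" using assms(2) by (auto simp: solvable_extension_def)
  obtain I where I: "is_nilradical M I" "lie_isomorphic N (M\<lparr>lcarrier := I\<rparr>)"
    using assms(2) by (auto simp: solvable_extension_def)
  interpret M: lie_algebra M by fact
  obtain f :: "'m \<Rightarrow> nat \<Rightarrow> complex"
    where f: "Vector_Spaces.linear (lscale M) (\<lambda>c v i. c * v i) f" "inj_on f (lcarrier M)"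
    using M.lie_algebra_embed_nat by blast
  interpret lie_embedding M "\<lambda>c v i. c * v i" f
    using f M(1) by (simp add: lie_embedding_def lie_embedding_axioms_def)
  have "lie_ideal M I" using I(1) by (simp add: is_nilradical_def)
  then have "solvable_extension N (lie_image (\<lambda>c v i. c * v i) f M)"
    unfolding solvable_extension_def
    using lie_algebra_image solvable_image M(2) nilradical_image[OF I(1)]
      lie_isomorphic_image[OF I(2)] by blast
  then show ?thesis
    using assms(1) dim_image by (metis maximal_solvable_extension_def)
qed

end

theory Submission
  imports Defs "Jordan_Normal_Form.Determinant" "HOL-Computational_Algebra.Fundamental_Theorem_Algebra"
begin

text \<open>Suppose that all derivations of \<open>R\<close> are inner and let \<open>I\<close> be its nilradical, of dimension \<open>n\<close> in
  \<open>m\<close>. For a generic \<open>x\<close> the algebra \<open>R\<close> is graded by the weights of \<open>ad x\<close>, so the diagonal operators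
  given by the weights are derivations, hence inner: \<open>R\<close> is the sum of \<open>I\<close> and an abelian
  subalgebra acting diagonally. Let \<open>t\<close> be the restriction to \<open>I\<close> of the diagonal part of \<open>ad x\<close>. A
  derivation of \<open>I\<close> commuting with \<open>t\<close> extends to \<open>R\<close> by zero on that subalgebra, so it is inner as
  well. As \<open>t\<close> is diagonal, \<open>Der I = [t, Der I] + ad R\<close>. Hence \<open>[X, Der I] + ad I\<close> has codimension
  at most \<open>m - n\<close> in \<open>Der I\<close> for \<open>X = t\<close>, and then also for almost all \<open>X\<close> on a line through \<open>t\<close>.

  The functionals \<open>tr (X\<^sup>k -)\<close> on \<open>Der I\<close> vanish on \<open>[X, Der I] + ad I\<close>. If another solvable algebra
  \<open>M\<close> has the nilradical \<open>I\<close>, then by Lie's theorem and a Vandermonde argument these functionals separate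
  the elements of \<open>M / I\<close> for \<open>X\<close> the action of a generic element of \<open>M\<close>, and again for almost all
  \<open>X\<close> on any line through it. Comparing both on the line through \<open>t\<close> and this element gives
  \<open>dim M / I \<le> m - n\<close>.\<close>

section \<open>Matrices depending polynomially on a parameter\<close>

text \<open>The toral parts of \<open>R\<close> and of the other extension \<open>M\<close> act on
  the same ideal as two families of derivations with no evident relation. Instead of conjugating
  maximal tori, the proof does linear algebra on the line joining one derivation of each family.
  Both conditions on \<open>X\<close> say that a matrix whose entries are polynomials in the line
  parameter has full column rank, so each holds at all but finitely many points once it holds at
  one. Each is known only at its own end of the line, yet both hold at a common point. The traces
  kill \<open>[X, Der I]\<close> by cyclicity. They kill \<open>ad I\<close> because every
  derivation preserves the lower central series of \<open>I\<close>, while \<open>ad a\<close> with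
  \<open>a\<close> in \<open>I\<close> moves each term into the next. Genericity of \<open>x\<close>
  makes every equality and every additive relation between weights that holds at \<open>x\<close>
  hold identically. This is why all diagonal operators, and not only the one of \<open>x\<close>,
  are derivations, and why commuting with \<open>t\<close> already means commuting with the whole
  torus. Quotient spaces are never formed: eigenvectors and linear dependences are taken modulo a
  subspace.\<close>

definition nonsingular :: "nat \<Rightarrow> (nat \<Rightarrow> nat \<Rightarrow> complex) \<Rightarrow> bool" where
  "nonsingular n A \<longleftrightarrow> (\<forall>b. (\<forall>i<n. (\<Sum>j<n. A i j * b j) = 0) \<longrightarrow> (\<forall>j<n. b j = 0))"

lemma mat_mult_vec_nth:
  fixes A :: "nat \<Rightarrow> nat \<Rightarrow> 'a::comm_ring_1"
  assumes "i < n"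
  shows "(mat n n (\<lambda>(i, j). A i j) *\<^sub>v vec n b) $ i = (\<Sum>j<n. A i j * b j)"
  using assms by (simp add: scalar_prod_def atLeast0LessThan)

lemma nonsingular_iff_det:
  "nonsingular n A \<longleftrightarrow> det (mat n n (\<lambda>(i, j). A i j)) \<noteq> 0"
proof -
  let ?A = "mat n n (\<lambda>(i, j). A i j)"
  have A: "?A \<in> carrier_mat n n" by simp
  have prod0: "?A *\<^sub>v vec n b = 0\<^sub>v n \<longleftrightarrow> (\<forall>i<n. (\<Sum>j<n. A i j * b j) = 0)" for b
    using mat_mult_vec_nth[of _ n A b] by (auto simp: vec_eq_iff)
  have vec0: "vec n b = 0\<^sub>v n \<longleftrightarrow> (\<forall>j<n. b j = 0)" for b :: "nat \<Rightarrow> complex"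
    by (auto simp: vec_eq_iff)
  have ex: "(\<exists>v\<in>carrier_vec n. P v) \<longleftrightarrow> (\<exists>b. P (vec n b))" for P :: "complex vec \<Rightarrow> bool"
  proof
    assume "\<exists>v\<in>carrier_vec n. P v"
    then obtain v where "v \<in> carrier_vec n" "P v" by blast
    moreover from this have "vec n (\<lambda>i. v $ i) = v" by auto
    ultimately show "\<exists>b. P (vec n b)" by metis
  qed auto
  show ?thesis
    unfolding det_0_iff_vec_prod_zero[OF A] nonsingular_def
    using ex[of "\<lambda>v. v \<noteq> 0\<^sub>v n \<and> ?A *\<^sub>v v = 0\<^sub>v n"] unfolding prod0 vec0 by blast
qed

lemma nonsingular_solve:
  assumes "nonsingular n A"
  shows "\<exists>c. \<forall>i<n. (\<Sum>j<n. A i j * c j) = b i"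
proof -
  let ?A = "mat n n (\<lambda>(i, j). A i j)"
  have A: "?A \<in> carrier_mat n n" by simp
  have "?A \<in> Units (ring_mat TYPE(complex) n ())"
    by (rule det_non_zero_imp_unit[OF A assms[unfolded nonsingular_iff_det]])
  then obtain B where B: "B \<in> carrier_mat n n" "?A * B = 1\<^sub>m n"
    unfolding Units_def ring_mat_def mem_Collect_eq monoid.simps partial_object.simps by blast
  define v where "v = B *\<^sub>v vec n b"
  have v: "vec n (\<lambda>i. v $ i) = v"
    unfolding v_def using B(1) by (intro eq_vecI) auto
  have "?A *\<^sub>v v = (?A * B) *\<^sub>v vec n b"
    unfolding v_def by (rule assoc_mult_mat_vec[OF A B(1) vec_carrier, symmetric])
  also have "\<dots> = vec n b" unfolding B(2) by simp
  finally have eq: "?A *\<^sub>v v = vec n b" .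
  show ?thesis
  proof (intro exI allI impI)
    fix i assume "i < n"
    then have "(\<Sum>j<n. A i j * v $ j) = (?A *\<^sub>v v) $ i"
      using mat_mult_vec_nth[of i n A "\<lambda>i. v $ i"] unfolding v by (simp only:)
    then show "(\<Sum>j<n. A i j * v $ j) = b i" unfolding eq using \<open>i < n\<close> by simp
  qed
qed

text \<open>Zero rows make the system square. A nonsingular square system could be solved for the
  right-hand side constantly 1, but row \<open>r\<close> of the padded system is zero.\<close>

lemma underdetermined_system:
  assumes "r < q"
  shows "\<exists>b::nat \<Rightarrow> complex. (\<exists>j<q. b j \<noteq> 0) \<and> (\<forall>i<r. (\<Sum>j<q. A i j * b j) = 0)"
proof -
  define A' where "A' i j = (if i < r then A i j else 0)" for i j
  have "\<not> nonsingular q A'"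
  proof
    assume "nonsingular q A'"
    from nonsingular_solve[OF this, where b = "\<lambda>_. 1"] obtain c where
      "\<forall>i<q. (\<Sum>j<q. A' i j * c j) = 1" by blast
    then have "(\<Sum>j<q. A' r j * c j) = 1" using assms by simp
    then show False by (simp add: A'_def)
  qed
  then obtain b where b: "\<forall>i<q. (\<Sum>j<q. A' i j * b j) = 0" "\<exists>j<q. b j \<noteq> 0"
    unfolding nonsingular_def by blast
  have "(\<Sum>j<q. A i j * b j) = 0" if "i < r" for i
    using b(1)[rule_format, of i] that assms by (simp add: A'_def)
  with b(2) show ?thesis by blast
qed

text \<open>The determinant is a polynomial in the parameter that does not vanish at
  \<open>e0\<close>, so the exceptions are the finitely many roots of a nonzero polynomial.\<close>

lemma nonsingular_poly_cofinite:
  fixes A :: "nat \<Rightarrow> nat \<Rightarrow> complex poly"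
  assumes "nonsingular n (\<lambda>i j. poly (A i j) e0)"
  shows "finite {e. \<not> nonsingular n (\<lambda>i j. poly (A i j) e)}"
proof -
  define p where "p = det (mat n n (\<lambda>(i, j). A i j))"
  have p: "det (mat n n (\<lambda>(i, j). poly (A i j) e)) = poly p e" for e
  proof -
    interpret h: comm_ring_hom "\<lambda>q. poly q e" by unfold_locales simp_all
    have "map_mat (\<lambda>q. poly q e) (mat n n (\<lambda>(i, j). A i j)) = mat n n (\<lambda>(i, j). poly (A i j) e)"
      by auto
    then show ?thesis using h.hom_det p_def by metis
  qed
  have "p \<noteq> 0" using assms by (auto simp: nonsingular_iff_det p)
  then have "finite {e. poly p e = 0}" by (rule poly_roots_finite)
  then show ?thesis by (simp add: nonsingular_iff_det p)
qed

text \<open>A rectangular matrix is made square by multiplying from the left with the conjugate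
  transpose of its value at \<open>e0\<close>. Freezing that factor keeps the product
  \<open>G\<close> polynomial in the parameter. A kernel vector of the original matrix at
  \<open>e\<close> is a kernel vector of \<open>G\<close> at \<open>e\<close>.\<close>

lemma injective_poly_cofinite:
  fixes A :: "nat \<Rightarrow> nat \<Rightarrow> complex poly"
  assumes inj: "\<And>b. (\<And>k. k < m \<Longrightarrow> (\<Sum>j<n. poly (A k j) e0 * b j) = 0) \<Longrightarrow> \<forall>j<n. b j = 0"
  shows "finite {e. \<exists>b. (\<forall>k<m. (\<Sum>j<n. poly (A k j) e * b j) = 0) \<and> (\<exists>j<n. b j \<noteq> 0)}"
proof -
  define G where "G i j = (\<Sum>k<m. smult (cnj (poly (A k i) e0)) (A k j))" for i j
  have G: "(\<Sum>j<n. poly (G i j) e * b j)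
      = (\<Sum>k<m. cnj (poly (A k i) e0) * (\<Sum>j<n. poly (A k j) e * b j))" for i e b
  proof -
    have "(\<Sum>j<n. poly (G i j) e * b j)
        = (\<Sum>j<n. \<Sum>k<m. cnj (poly (A k i) e0) * poly (A k j) e * b j)"
      by (simp add: G_def poly_sum sum_distrib_right)
    then show ?thesis
      by (subst (asm) sum.swap) (simp add: sum_distrib_left mult.assoc)
  qed
  have "nonsingular n (\<lambda>i j. poly (G i j) e0)"
    unfolding nonsingular_def
  proof (intro allI impI)
    fix b j assume b: "\<forall>i<n. (\<Sum>j<n. poly (G i j) e0 * b j) = 0" and j: "j < n"
    define y where "y k = (\<Sum>j<n. poly (A k j) e0 * b j)" for k
    \<comment> \<open>At \<open>e0\<close> the matrix \<open>G\<close> is a Gram matrix: its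
      quadratic form at \<open>b\<close> is the squared norm of the image of \<open>b\<close>, so a
      kernel vector of \<open>G\<close> is mapped to zero by the original matrix.\<close>
    have "(\<Sum>k<m. cnj (y k) * y k) = (\<Sum>i<n. cnj (b i) * (\<Sum>k<m. cnj (poly (A k i) e0) * y k))"
    proof -
      have "(\<Sum>k<m. cnj (y k) * y k) = (\<Sum>k<m. \<Sum>i<n. cnj (b i) * (cnj (poly (A k i) e0) * y k))"
        by (simp add: y_def[THEN arg_cong[where f = cnj]] sum_distrib_left sum_distrib_right mult_ac)
      then show ?thesis by (subst (asm) sum.swap) (simp add: sum_distrib_left)
    qed
    also have "\<dots> = 0" using b G[of _ e0 b] by (simp add: y_def)
    finally have "(\<Sum>k<m. cnj (y k) * y k) = 0" .
    moreover have "cnj (y k) * y k = of_real ((cmod (y k))\<^sup>2)" for k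
      by (metis complex_norm_square mult.commute)
    ultimately have "(\<Sum>k<m. complex_of_real ((cmod (y k))\<^sup>2)) = 0" by simp
    then have "(\<Sum>k<m. (cmod (y k))\<^sup>2) = 0"
      by (metis of_real_sum of_real_eq_0_iff)
    then have "y k = 0" if "k < m" for k
      using that by (simp add: sum_nonneg_eq_0_iff)
    then show "b j = 0" using inj j by (auto simp: y_def)
  qed
  then have "finite {e. \<not> nonsingular n (\<lambda>i j. poly (G i j) e)}"
    by (rule nonsingular_poly_cofinite)
  moreover have "\<not> nonsingular n (\<lambda>i j. poly (G i j) e)"
    if "\<forall>k<m. (\<Sum>j<n. poly (A k j) e * b j) = 0" "\<exists>j<n. b j \<noteq> 0" for e b
  proof -
    have "(\<Sum>j<n. poly (G i j) e * b j) = 0" for i using that(1) by (simp add: G)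
    then show ?thesis using that(2) unfolding nonsingular_def by blast
  qed
  ultimately show ?thesis
    by (elim rev_finite_subset) blast
qed

section \<open>Bases given by finite families, traces and triangular operators\<close>

text \<open>The scalar multiplication stays a parameter because the lemmas are applied both to Lie
  algebras and, in \<open>ex_derivation_basis\<close>, to a space of maps.\<close>

locale complex_space = vector_space scale for scale :: "complex \<Rightarrow> 'b::ab_group_add \<Rightarrow> 'b"
begin

lemma subspace_scale_cancel:
  assumes "subspace U" "scale c x \<in> U" "c \<noteq> 0"
  shows "x \<in> U"
  using subspace_scale[OF assms(1,2), of "inverse c"] assms(3) by simp

text \<open>The order matters: the spans of the initial segments form a strictly increasing flag,
  and a family is extended by any vector outside its span. Repetitions are excluded
  automatically.\<close>

definition indep_family :: "(nat \<Rightarrow> 'b) \<Rightarrow> nat \<Rightarrow> bool" where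
  "indep_family f n \<longleftrightarrow> (\<forall>i<n. f i \<notin> span (f ` {..<i}))"

definition family_span :: "(nat \<Rightarrow> 'b) \<Rightarrow> nat \<Rightarrow> 'b set" where
  "family_span f n = span (f ` {..<n})"

definition coord :: "(nat \<Rightarrow> 'b) \<Rightarrow> nat \<Rightarrow> 'b \<Rightarrow> nat \<Rightarrow> complex" where
  "coord f n v i = representation (f ` {..<n}) v (f i)"

lemma subspace_family_span [simp, intro]: "subspace (family_span f n)"
  by (simp add: family_span_def)

lemma family_span_0 [simp]: "family_span f 0 = {0}"
  by (simp add: family_span_def)

lemma family_span_mono: "i \<le> j \<Longrightarrow> family_span f i \<subseteq> family_span f j"
  by (auto simp: family_span_def intro!: span_mono)

lemma family_span_base: "i < n \<Longrightarrow> f i \<in> family_span f n"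
  by (auto simp: family_span_def intro!: span_base)

lemma family_span_cong: "(\<And>i. i < n \<Longrightarrow> f i = g i) \<Longrightarrow> family_span f n = family_span g n"
  unfolding family_span_def by (metis (mono_tags, lifting) image_cong lessThan_iff)

lemma family_span_Suc: "family_span f (Suc n) = {x. \<exists>k. x - scale k (f n) \<in> family_span f n}"
  by (simp add: family_span_def lessThan_Suc span_insert)

lemma family_span_least:
  "subspace W \<Longrightarrow> (\<And>i. i < n \<Longrightarrow> f i \<in> W) \<Longrightarrow> family_span f n \<subseteq> W"
  unfolding family_span_def by (rule span_minimal) auto

lemma indep_familyD: "indep_family f n \<Longrightarrow> i < n \<Longrightarrow> f i \<notin> family_span f i"
  by (simp add: indep_family_def family_span_def)

lemma indep_family_mono: "indep_family f n \<Longrightarrow> k \<le> n \<Longrightarrow> indep_family f k"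
  by (simp add: indep_family_def)

lemma indep_family_cong: "(\<And>i. i < n \<Longrightarrow> f i = g i) \<Longrightarrow> indep_family f n \<longleftrightarrow> indep_family g n"
  unfolding indep_family_def using family_span_cong[of _ f g, unfolded family_span_def] by auto

lemma indep_family_Suc: "indep_family f (Suc n) \<longleftrightarrow> indep_family f n \<and> f n \<notin> family_span f n"
  by (auto simp: indep_family_def less_Suc_eq family_span_def)

lemma indep_family_independent:
  assumes "indep_family f n"
  shows "independent (f ` {..<n})" "inj_on f {..<n}"
proof -
  have "independent (f ` {..<n}) \<and> inj_on f {..<n}" using assms
  proof (induction n)
    case (Suc n)
    then have n: "f n \<notin> span (f ` {..<n})" by (simp add: indep_family_def)
    then have "f n \<notin> f ` {..<n}" using span_superset[of "f ` {..<n}"] by blast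
    moreover have "indep_family f n" using Suc.prems by (simp add: indep_family_def)
    ultimately show ?case
      using Suc.IH n by (auto simp: lessThan_Suc independent_insert)
  qed (simp add: independent_empty)
  then show "independent (f ` {..<n})" "inj_on f {..<n}" by auto
qed

lemma dim_family_span: "indep_family f n \<Longrightarrow> dim (family_span f n) = n"
  using indep_family_independent[of f n]
  by (simp add: family_span_def dim_eq_card_independent card_image)

lemma indep_family_le_card:
  assumes "indep_family f n" "family_span f n \<subseteq> span B" "finite B"
  shows "n \<le> card B"
proof -
  have "f ` {..<n} \<subseteq> span B"
    using assms(2) span_superset[of "f ` {..<n}"] unfolding family_span_def by (rule order_trans[rotated])
  then have "card (f ` {..<n}) \<le> card B"
    using independent_span_bound[OF assms(3)] indep_family_independent(1)[OF assms(1)] by blast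
  then show ?thesis using indep_family_independent(2)[OF assms(1)] by (simp add: card_image)
qed

lemma sum_coord:
  assumes "indep_family f n" "v \<in> family_span f n"
  shows "(\<Sum>i<n. scale (coord f n v i) (f i)) = v"
proof -
  note f = indep_family_independent[OF assms(1)]
  have "(\<Sum>b\<in>f ` {..<n}. scale (representation (f ` {..<n}) v b) b) = v"
    using f assms(2) by (intro sum_representation_eq) (auto simp: family_span_def)
  then show ?thesis using f(2) by (simp add: sum.reindex coord_def)
qed

lemma coord_add:
  "indep_family f n \<Longrightarrow> u \<in> family_span f n \<Longrightarrow> v \<in> family_span f n \<Longrightarrow>
    coord f n (u + v) i = coord f n u i + coord f n v i"
  using indep_family_independent(1)[of f n] by (simp add: coord_def family_span_def representation_add)

lemma coord_scale:
  "indep_family f n \<Longrightarrow> v \<in> family_span f n \<Longrightarrow> coord f n (scale c v) i = c * coord f n v i"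
  using indep_family_independent(1)[of f n] by (simp add: coord_def family_span_def representation_scale)

lemma coord_diff:
  "indep_family f n \<Longrightarrow> u \<in> family_span f n \<Longrightarrow> v \<in> family_span f n \<Longrightarrow>
    coord f n (u - v) i = coord f n u i - coord f n v i"
  using indep_family_independent(1)[of f n] by (simp add: coord_def family_span_def representation_diff)

lemma coord_zero [simp]: "coord f n 0 i = 0"
  by (simp add: coord_def representation_zero)

lemma coord_sum:
  "indep_family f n \<Longrightarrow> (\<And>j. j \<in> J \<Longrightarrow> v j \<in> family_span f n) \<Longrightarrow>
    coord f n (\<Sum>j\<in>J. v j) i = (\<Sum>j\<in>J. coord f n (v j) i)"
  using indep_family_independent(1)[of f n] by (simp add: coord_def family_span_def representation_sum)

lemma coord_lincomb:
  assumes "indep_family f n" "\<And>j. j \<in> J \<Longrightarrow> v j \<in> family_span f n"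
  shows "coord f n (\<Sum>j\<in>J. scale (c j) (v j)) i = (\<Sum>j\<in>J. c j * coord f n (v j) i)"
proof -
  have "coord f n (\<Sum>j\<in>J. scale (c j) (v j)) i = (\<Sum>j\<in>J. coord f n (scale (c j) (v j)) i)"
    using assms by (intro coord_sum subspace_scale) auto
  then show ?thesis using assms by (simp add: coord_scale)
qed

lemma coord_base:
  assumes "indep_family f n" "i < n" "j < n"
  shows "coord f n (f i) j = (if i = j then 1 else 0)"
proof -
  note f = indep_family_independent[OF assms(1)]
  have "f j = f i \<longleftrightarrow> i = j" using inj_on_eq_iff[OF f(2), of j i] assms by auto
  then show ?thesis using representation_basis[OF f(1), of "f i"] assms by (simp add: coord_def)
qed

lemma coord_sum_scale:
  assumes "indep_family f n" "i < n"
  shows "coord f n (\<Sum>j<n. scale (c j) (f j)) i = c i"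
proof -
  have "coord f n (\<Sum>j<n. scale (c j) (f j)) i = (\<Sum>j<n. c j * coord f n (f j) i)"
    using assms(1) by (rule coord_lincomb) (simp add: family_span_base)
  also have "\<dots> = (\<Sum>j<n. if j = i then c j else 0)"
    using assms by (intro sum.cong) (auto simp: coord_base)
  also have "\<dots> = c i" using assms by simp
  finally show ?thesis .
qed

lemma in_family_span_iff:
  "indep_family f n \<Longrightarrow> v \<in> family_span f n \<longleftrightarrow> (\<exists>c. v = (\<Sum>i<n. scale (c i) (f i)))"
  by (auto intro: sum_coord[symmetric] subspace_sum subspace_scale family_span_base)

lemma coord_eqI:
  assumes "indep_family f n" "u \<in> family_span f n" "v \<in> family_span f n"
    "\<And>i. i < n \<Longrightarrow> coord f n u i = coord f n v i"
  shows "u = v"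
proof -
  have "(\<Sum>i<n. scale (coord f n u i) (f i)) = (\<Sum>i<n. scale (coord f n v i) (f i))"
    using assms(4) by (intro sum.cong) auto
  then show ?thesis using sum_coord[OF assms(1)] assms(2,3) by metis
qed

lemma in_span_image_iff_coord:
  assumes "indep_family f n" "S \<subseteq> {..<n}"
  shows "v \<in> span (f ` S) \<longleftrightarrow> v \<in> family_span f n \<and> (\<forall>i<n. i \<notin> S \<longrightarrow> coord f n v i = 0)"
proof (intro iffI conjI allI impI)
  assume v: "v \<in> span (f ` S)"
  have "span (f ` S) \<subseteq> family_span f n"
    unfolding family_span_def using assms(2) by (intro span_mono) auto
  then show "v \<in> family_span f n" using v by blast
  fix i assume i: "i < n" "i \<notin> S"
  have "subspace {w \<in> family_span f n. coord f n w i = 0}"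
    unfolding subspace_def using assms(1)
    by (auto simp: coord_add coord_scale subspace_0 subspace_add subspace_scale)
  moreover have "f ` S \<subseteq> {w \<in> family_span f n. coord f n w i = 0}"
  proof -
    have "f j \<in> family_span f n \<and> coord f n (f j) i = 0" if "j \<in> S" for j
    proof -
      have "j < n" "j \<noteq> i" using that i assms(2) by auto
      then show ?thesis using coord_base[OF assms(1), of j i] i family_span_base by simp
    qed
    then show ?thesis by blast
  qed
  ultimately show "coord f n v i = 0" using v span_minimal by blast
next
  assume v: "v \<in> family_span f n \<and> (\<forall>i<n. i \<notin> S \<longrightarrow> coord f n v i = 0)"
  have "(\<Sum>i<n. scale (coord f n v i) (f i)) \<in> span (f ` S)"
  proof (rule subspace_sum[OF subspace_span])
    fix i assume "i \<in> {..<n}"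
    then show "scale (coord f n v i) (f i) \<in> span (f ` S)"
      using v by (cases "i \<in> S") (auto intro: span_scale span_base span_zero)
  qed
  then show "v \<in> span (f ` S)" using sum_coord[OF assms(1)] v by simp
qed

lemma coord_lower:
  "indep_family f n \<Longrightarrow> k \<le> n \<Longrightarrow> v \<in> family_span f k \<Longrightarrow> k \<le> i \<Longrightarrow> i < n \<Longrightarrow> coord f n v i = 0"
  using in_span_image_iff_coord[of f n "{..<k}" v] by (auto simp: family_span_def)

lemma coord_restrict:
  assumes "indep_family f n" "k \<le> n" "v \<in> family_span f k"
  shows "coord f n v i = coord f k v i"
  unfolding coord_def using assms
  by (subst representation_extend[OF indep_family_independent(1)[OF assms(1)], of _ "f ` {..<k}"])
     (auto simp: family_span_def)

text \<open>Greedy extension by one vector at a time; it ends because an independent family inside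
  \<open>span B\<close> has at most \<open>card B\<close> members. The predicate \<open>Q\<close>
  relates each new vector to the span of its predecessors: it is trivial for plain basis extension
  and says "common eigenvector modulo the predecessors" for the flags of Lie's theorem.\<close>

lemma flag_extend:
  assumes f: "indep_family f n" "\<And>i. i < n \<Longrightarrow> Q (family_span f i) (f i)"
    and W: "subspace W" "family_span f n \<subseteq> W" "W \<subseteq> span B" "finite B"
    and step: "\<And>g k. indep_family g k \<Longrightarrow> (\<And>i. i < k \<Longrightarrow> Q (family_span g i) (g i)) \<Longrightarrow>
      family_span g k \<subset> W \<Longrightarrow> n \<le> k \<Longrightarrow> (\<And>i. i < n \<Longrightarrow> g i = f i) \<Longrightarrow>
      \<exists>v\<in>W. v \<notin> family_span g k \<and> Q (family_span g k) v"
  shows "\<exists>g m. n \<le> m \<and> (\<forall>i<n. g i = f i) \<and> indep_family g m \<and> family_span g m = W \<and>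
    (\<forall>i<m. Q (family_span g i) (g i))"
proof -
  have "\<exists>g m. n \<le> m \<and> (\<forall>i<n. g i = f i) \<and> indep_family g m \<and> family_span g m = W \<and>
      (\<forall>i<m. Q (family_span g i) (g i))"
    if "indep_family h k" "\<forall>i<k. Q (family_span h i) (h i)" "family_span h k \<subseteq> W" "n \<le> k"
      "\<forall>i<n. h i = f i" for h k
    using that
  proof (induction "card B - k" arbitrary: h k rule: less_induct)
    case less
    show ?case
    proof (cases "family_span h k = W")
      case False
      then obtain v where v: "v \<in> W" "v \<notin> family_span h k" "Q (family_span h k) v"
        using step[of h k] less.prems by blast
      define h' where "h' = h(k := v)"
      have h': "h' i = h i" if "i < k" for i using that by (simp add: h'_def)
      have sp: "family_span h' i = family_span h i" if "i \<le> k" for i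
        using that h' by (intro family_span_cong) auto
      have ind: "indep_family h' (Suc k)"
        using less.prems(1) indep_family_cong[of k h' h] h' sp v(2)
        by (simp add: indep_family_Suc) (simp add: h'_def)
      have Q: "\<forall>i<Suc k. Q (family_span h' i) (h' i)"
        using less.prems(2) v(3) sp h' by (auto simp: less_Suc_eq) (simp add: h'_def)
      have sub: "family_span h' (Suc k) \<subseteq> W"
        using less.prems(3) family_span_base[of _ k h] v(1)
        by (intro family_span_least W(1)) (auto simp: less_Suc_eq h'_def)
      have "Suc k \<le> card B" using indep_family_le_card[OF ind _ W(4)] sub W(3) by blast
      then have "card B - Suc k < card B - k" by simp
      moreover have "\<forall>i<n. h' i = f i" using less.prems(4,5) h' by auto
      ultimately show ?thesis using less.hyps[of "Suc k" h'] ind Q sub less.prems(4) by simp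
    qed (use less.prems in blast)
  qed
  from this[of f n] f W(2) show ?thesis by blast
qed

lemma basis_extend:
  assumes "indep_family f n" "subspace W" "family_span f n \<subseteq> W" "W \<subseteq> span B" "finite B"
  shows "\<exists>g m. n \<le> m \<and> (\<forall>i<n. g i = f i) \<and> indep_family g m \<and> family_span g m = W"
proof -
  have "\<exists>g m. n \<le> m \<and> (\<forall>i<n. g i = f i) \<and> indep_family g m \<and> family_span g m = W \<and>
      (\<forall>i<m. True)"
    by (rule flag_extend[of f n "\<lambda>_ _. True" W B]) (use assms in auto)
  then show ?thesis by simp
qed

lemma ex_basis_family:
  assumes "subspace W" "W \<subseteq> span B" "finite B"
  shows "\<exists>g m. indep_family g m \<and> family_span g m = W"
proof -
  have "indep_family (\<lambda>_. 0) 0" "family_span (\<lambda>_. 0) 0 \<subseteq> W"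
    using assms(1) by (auto simp: indep_family_def subspace_0)
  from basis_extend[OF this(1) assms(1) this(2) assms(2,3)] show ?thesis by metis
qed

lemma dim_psubset_finite:
  assumes "subspace U" "subspace W" "U \<subset> W" "W \<subseteq> span B" "finite B"
  shows "dim U < dim W"
proof -
  have "U \<subseteq> span B" using assms(3,4) by blast
  then obtain f n where f: "indep_family f n" "family_span f n = U"
    using ex_basis_family[OF assms(1) _ assms(5)] by blast
  have "family_span f n \<subseteq> W" using f(2) assms(3) by blast
  then obtain g m where g: "n \<le> m" "\<forall>i<n. g i = f i" "indep_family g m" "family_span g m = W"
    using basis_extend[OF f(1) assms(2) _ assms(4,5)] by blast
  have "n \<noteq> m"
  proof
    assume "n = m"
    then have "W = U" using family_span_cong[of n g f] g(2,4) f(2) by simp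
    then show False using assms(3) by blast
  qed
  then show ?thesis using dim_family_span[OF f(1)] dim_family_span[OF g(3)] f(2) g(1,4) by simp
qed

section \<open>Linear operators on a subspace and their traces\<close>

definition linear_on :: "'b set \<Rightarrow> ('b \<Rightarrow> 'b) \<Rightarrow> bool" where
  "linear_on V A \<longleftrightarrow> (\<forall>x\<in>V. A x \<in> V) \<and> (\<forall>x\<in>V. \<forall>y\<in>V. A (x + y) = A x + A y) \<and>
     (\<forall>c. \<forall>x\<in>V. A (scale c x) = scale c (A x))"

lemma linear_onD:
  "linear_on V A \<Longrightarrow> x \<in> V \<Longrightarrow> A x \<in> V"
  "linear_on V A \<Longrightarrow> x \<in> V \<Longrightarrow> y \<in> V \<Longrightarrow> A (x + y) = A x + A y"
  "linear_on V A \<Longrightarrow> x \<in> V \<Longrightarrow> A (scale c x) = scale c (A x)"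
  by (auto simp: linear_on_def)

lemma linear_on_subset:
  "linear_on V A \<Longrightarrow> U \<subseteq> V \<Longrightarrow> (\<And>x. x \<in> U \<Longrightarrow> A x \<in> U) \<Longrightarrow> linear_on U A"
  by (simp add: linear_on_def subset_iff)

lemma linear_on_0: "linear_on V A \<Longrightarrow> subspace V \<Longrightarrow> A 0 = 0"
  using linear_onD(3)[of V A 0 0] by (simp add: subspace_0)

lemma linear_on_sum:
  assumes "linear_on V A" "subspace V" "\<And>i. i \<in> S \<Longrightarrow> g i \<in> V"
  shows "A (\<Sum>i\<in>S. scale (c i) (g i)) = (\<Sum>i\<in>S. scale (c i) (A (g i)))"
  using assms(3)
proof (induction S rule: infinite_finite_induct)
  case (insert x F)
  then show ?case using assms(1,2)
    by (simp add: linear_onD subspace_scale subspace_sum)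
qed (simp_all add: linear_on_0[OF assms(1,2)])

lemma linear_on_comp: "linear_on V A \<Longrightarrow> linear_on V B \<Longrightarrow> linear_on V (\<lambda>x. A (B x))"
  by (simp add: linear_on_def)

lemma linear_on_funpow: "linear_on V A \<Longrightarrow> linear_on V (A ^^ k)"
  by (induction k) (simp_all add: linear_on_def)

lemma linear_on_diff: "linear_on V A \<Longrightarrow> linear_on V B \<Longrightarrow> subspace V \<Longrightarrow> linear_on V (\<lambda>v. A v - B v)"
  by (simp add: linear_on_def subspace_diff algebra_simps scale_right_diff_distrib)

definition trace_on :: "(nat \<Rightarrow> 'b) \<Rightarrow> nat \<Rightarrow> ('b \<Rightarrow> 'b) \<Rightarrow> complex" where
  "trace_on f n A = (\<Sum>i<n. coord f n (A (f i)) i)"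

lemma coord_linear:
  assumes "indep_family f n" "indep_family g m" "family_span g m = family_span f n"
    "linear_on (family_span f n) A" "v \<in> family_span f n"
  shows "coord f n (A v) i = (\<Sum>j<m. coord g m v j * coord f n (A (g j)) i)"
proof -
  let ?V = "family_span f n"
  have g: "g j \<in> ?V" if "j < m" for j using family_span_base[OF that, of g] assms(3) by simp
  have "A v = A (\<Sum>j<m. scale (coord g m v j) (g j))"
    using sum_coord[OF assms(2)] assms(3,5) by simp
  also have "\<dots> = (\<Sum>j<m. scale (coord g m v j) (A (g j)))"
    using g by (intro linear_on_sum[OF assms(4)]) auto
  finally show ?thesis
    using coord_lincomb[OF assms(1), of "{..<m}" "\<lambda>j. A (g j)"] g linear_onD(1)[OF assms(4)] by simp
qed

text \<open>Two bases are carried along so that one computation serves twice: equal bases give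
  cyclicity of the trace, and the identity for \<open>B\<close> gives independence of the
  basis.\<close>

lemma trace_comm_gen:
  assumes f: "indep_family f n" and g: "indep_family g m" and sp: "family_span g m = family_span f n"
    and A: "linear_on (family_span f n) A" and B: "linear_on (family_span f n) B"
  shows "trace_on f n (\<lambda>x. A (B x)) = trace_on g m (\<lambda>x. B (A x))"
proof -
  have fV: "f i \<in> family_span f n" if "i < n" for i using family_span_base[OF that] .
  have gV: "g j \<in> family_span f n" if "j < m" for j using family_span_base[OF that, of g] sp by simp
  have "trace_on f n (\<lambda>x. A (B x)) = (\<Sum>i<n. \<Sum>j<m. coord g m (B (f i)) j * coord f n (A (g j)) i)"
    unfolding trace_on_def using fV linear_onD(1)[OF B]
    by (intro sum.cong) (auto simp: coord_linear[OF f g sp A])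
  also have "\<dots> = (\<Sum>j<m. \<Sum>i<n. coord f n (A (g j)) i * coord g m (B (f i)) j)"
    by (subst sum.swap) (simp add: mult.commute)
  also have "\<dots> = trace_on g m (\<lambda>x. B (A x))"
    unfolding trace_on_def using gV linear_onD(1)[OF A] sp B
    by (intro sum.cong) (auto simp: coord_linear[OF g f sp[symmetric], of B])
  finally show ?thesis .
qed

lemma linear_on_id: "linear_on V (\<lambda>x. x)"
  by (simp add: linear_on_def)

lemma trace_on_basis_indep:
  assumes "indep_family f n" "indep_family g m" "family_span g m = family_span f n"
    "linear_on (family_span f n) A"
  shows "trace_on f n A = trace_on g m A"
  using trace_comm_gen[OF assms linear_on_id] .

lemma trace_comm:
  assumes "indep_family f n" "linear_on (family_span f n) A" "linear_on (family_span f n) B"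
  shows "trace_on f n (\<lambda>x. A (B x)) = trace_on f n (\<lambda>x. B (A x))"
  using trace_comm_gen[OF assms(1,1) refl assms(2,3)] .

lemma trace_on_restrict:
  assumes f: "indep_family f n" and "k \<le> n"
    and "\<And>x. x \<in> family_span f n \<Longrightarrow> A x \<in> family_span f k"
  shows "trace_on f n A = trace_on f k A"
proof -
  have "trace_on f n A = (\<Sum>i<k. coord f n (A (f i)) i)"
    unfolding trace_on_def using assms coord_lower[OF f assms(2)] family_span_base[of _ n f]
    by (intro sum.mono_neutral_right) auto
  also have "\<dots> = trace_on f k A"
    unfolding trace_on_def using assms(2,3) coord_restrict[OF f assms(2)] family_span_base[of _ n f]
    by (intro sum.cong) auto
  finally show ?thesis .
qed

text \<open>For a basis of \<open>V 0\<close> that extends one of \<open>V 1\<close>, the image of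
  \<open>A\<close> lies in \<open>V 1\<close>, so only the trace on \<open>V 1\<close> survives;
  then the shorter chain is used. The chain is an argument in place of bare nilpotency because the
  lower central series supplies it directly.\<close>

lemma trace_nilpotent_chain:
  assumes "indep_family f n" "family_span f n = V 0" "\<And>p. subspace (V p)"
    "\<And>p. V (Suc p) \<subseteq> V p" "\<And>p x. x \<in> V p \<Longrightarrow> A x \<in> V (Suc p)" "V P = {0}" "linear_on (V 0) A"
  shows "trace_on f n A = 0"
  using assms
proof (induction P arbitrary: V f n)
  case 0
  have "n = 0"
    using indep_familyD[OF "0.prems"(1), of 0] family_span_base[of 0 n f] "0.prems"(2,6) by auto
  then show ?case by (simp add: trace_on_def)
next
  case (Suc P)
  have sp: "V 0 \<subseteq> span (f ` {..<n})" using Suc.prems(2) by (simp add: family_span_def)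
  have 1: "V 1 \<subseteq> V 0" using Suc.prems(4)[of 0] by simp
  obtain g k where g: "indep_family g k" "family_span g k = V 1"
    using ex_basis_family[OF Suc.prems(3)[of 1] subset_trans[OF 1 sp]] by blast
  obtain h m where h: "k \<le> m" "\<forall>i<k. h i = g i" "indep_family h m" "family_span h m = V 0"
    using basis_extend[OF g(1) Suc.prems(3)[of 0] _ sp] g(2) 1 by auto
  have hk: "family_span h k = V 1" using family_span_cong[of k h g] h(2) g(2) by simp
  have "trace_on f n A = trace_on h m A"
    using Suc.prems(1,2,7) h by (intro trace_on_basis_indep) auto
  also have "\<dots> = trace_on h k A"
    using Suc.prems(5)[of _ 0] h hk by (intro trace_on_restrict) auto
  also have "\<dots> = 0"
  proof (rule Suc.IH[of h k "\<lambda>p. V (Suc p)"])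
    show "indep_family h k" using indep_family_mono h by blast
    show "linear_on (V (Suc 0)) A"
      using Suc.prems(4)[of 0] Suc.prems(4)[of 1] Suc.prems(5)[of _ 1]
      by (intro linear_on_subset[OF Suc.prems(7)]) auto
  qed (use Suc.prems hk in auto)
  finally show ?case .
qed

section \<open>Triangular operators and their diagonals\<close>

definition triangular :: "(nat \<Rightarrow> 'b) \<Rightarrow> nat \<Rightarrow> ('b \<Rightarrow> 'b) \<Rightarrow> (nat \<Rightarrow> complex) \<Rightarrow> bool" where
  "triangular f n A d \<longleftrightarrow> (\<forall>i<n. A (f i) - scale (d i) (f i) \<in> family_span f i)"

lemma triangular_family_span:
  assumes "triangular f n A d" "linear_on V A" "subspace V" "family_span f n \<subseteq> V" "k \<le> n" "v \<in> family_span f k"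
  shows "A v \<in> family_span f k"
proof -
  have "subspace {v \<in> family_span f k. A v \<in> family_span f k}"
    unfolding subspace_def
    using assms(2-5) family_span_mono[OF assms(5), of f] linear_on_0[OF assms(2,3)]
    by (auto simp: subspace_0 subspace_add subspace_scale linear_onD subset_iff)
  moreover have "f i \<in> {v \<in> family_span f k. A v \<in> family_span f k}" if "i < k" for i
  proof -
    have "A (f i) - scale (d i) (f i) \<in> family_span f k"
      using assms(1,5) that family_span_mono[of i k f] by (auto simp: triangular_def)
    moreover have "scale (d i) (f i) \<in> family_span f k"
      using that by (intro subspace_scale family_span_base) auto
    ultimately have "A (f i) \<in> family_span f k"
      using subspace_add[OF subspace_family_span, of _ f k] by fastforce
    then show ?thesis using family_span_base[OF that] by simp
  qed
  ultimately show ?thesis using family_span_least[of _ k f] assms(6) by blast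
qed

lemma triangular_unique:
  assumes "indep_family f n" "triangular f n A d" "triangular f n A e" "i < n"
  shows "d i = e i"
proof (rule ccontr)
  assume ne: "d i \<noteq> e i"
  have "(A (f i) - scale (d i) (f i)) - (A (f i) - scale (e i) (f i)) \<in> family_span f i"
    using assms by (intro subspace_diff[OF subspace_family_span, of "_ - _" f i "_ - _"]) (simp_all add: triangular_def)
  then have "scale (e i - d i) (f i) \<in> family_span f i" by (simp add: scale_left_diff_distrib)
  then have "f i \<in> family_span f i"
    by (rule subspace_scale_cancel[OF subspace_family_span]) (use ne in simp)
  then show False using indep_familyD assms(1,4) by blast
qed

lemma triangular_cong:
  "triangular f n A d \<Longrightarrow> (\<And>i. i < n \<Longrightarrow> A (f i) = B (f i)) \<Longrightarrow> (\<And>i. i < n \<Longrightarrow> d i = e i)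
    \<Longrightarrow> triangular f n B e"
  by (simp add: triangular_def)

lemma triangular_add:
  assumes "triangular f n A d" "triangular f n B e"
  shows "triangular f n (\<lambda>x. A x + B x) (\<lambda>i. d i + e i)"
  unfolding triangular_def
proof (intro allI impI)
  fix i assume "i < n"
  then have "(A (f i) - scale (d i) (f i)) + (B (f i) - scale (e i) (f i)) \<in> family_span f i"
    using assms by (intro subspace_add[OF subspace_family_span]) (auto simp only: triangular_def)
  then show "A (f i) + B (f i) - scale (d i + e i) (f i) \<in> family_span f i"
    by (simp add: scale_left_distrib algebra_simps)
qed

lemma triangular_scale:
  assumes "triangular f n A d"
  shows "triangular f n (\<lambda>x. scale c (A x)) (\<lambda>i. c * d i)"
  unfolding triangular_def
proof (intro allI impI)
  fix i assume "i < n"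
  then have "scale c (A (f i) - scale (d i) (f i)) \<in> family_span f i"
    using assms by (intro subspace_scale[OF subspace_family_span]) (auto simp only: triangular_def)
  then show "scale c (A (f i)) - scale (c * d i) (f i) \<in> family_span f i"
    by (simp add: scale_right_diff_distrib)
qed

text \<open>For \<open>k = 0\<close> the truncated difference gives \<open>family_span f 0\<close>,
  which is zero and is mapped to zero, so no case distinction is needed.\<close>

lemma triangular_strict:
  assumes "triangular f n A (\<lambda>_. 0)" "linear_on V A" "subspace V" "family_span f n \<subseteq> V"
    "v \<in> family_span f k" "k \<le> n"
  shows "A v \<in> family_span f (k - 1)"
proof -
  have kV: "family_span f k \<subseteq> V" using family_span_mono[OF assms(6)] assms(4) by blast
  have "subspace {v \<in> family_span f k. A v \<in> family_span f (k - 1)}"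
    unfolding subspace_def using assms(2) kV linear_on_0[OF assms(2,3)]
    by (auto simp: subspace_0 subspace_add subspace_scale linear_onD subset_iff)
  moreover have "f i \<in> {v \<in> family_span f k. A v \<in> family_span f (k - 1)}" if "i < k" for i
  proof -
    have "A (f i) \<in> family_span f i" using assms(1,6) that by (simp add: triangular_def)
    moreover have "family_span f i \<subseteq> family_span f (k - 1)" using that by (intro family_span_mono) simp
    ultimately show ?thesis using family_span_base[OF that] by blast
  qed
  ultimately show ?thesis using family_span_least[of _ k f] assms(5) by blast
qed

lemma trace_triangular:
  assumes "indep_family f n" "triangular f n A d"
  shows "trace_on f n A = (\<Sum>i<n. d i)"
  unfolding trace_on_def
proof (rule sum.cong[OF refl])
  fix i assume "i \<in> {..<n}"
  then have i: "i < n" by simp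
  let ?u = "A (f i) - scale (d i) (f i)"
  have u: "?u \<in> family_span f i" using assms(2) i by (simp add: triangular_def)
  have "coord f n (?u + scale (d i) (f i)) i = coord f n ?u i + coord f n (scale (d i) (f i)) i"
    using u family_span_mono[of i n f] i
    by (intro coord_add[OF assms(1)]) (auto intro!: subspace_scale family_span_base)
  also have "coord f n ?u i = 0"
    using coord_lower[OF assms(1) _ u, of i] i by simp
  also have "coord f n (scale (d i) (f i)) i = d i"
    using i assms(1) by (simp add: coord_scale coord_base family_span_base)
  finally show "coord f n (A (f i)) i = d i" by simp
qed

lemma triangular_comp:
  assumes "triangular f n A d" "triangular f n B e" "linear_on V A" "subspace V" "family_span f n \<subseteq> V"
    "linear_on V B"
  shows "triangular f n (\<lambda>x. A (B x)) (\<lambda>i. d i * e i)"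
  unfolding triangular_def
proof (intro allI impI)
  fix i assume i: "i < n"
  let ?u = "B (f i) - scale (e i) (f i)" and ?w = "A (f i) - scale (d i) (f i)"
  have u: "?u \<in> family_span f i" and w: "?w \<in> family_span f i"
    using assms(1,2) i by (auto simp: triangular_def)
  have fV: "f i \<in> V" using family_span_base[OF i, of f] assms(5) by blast
  have uV: "?u \<in> V" using u family_span_mono[of i n f] i assms(5) by auto
  have "A (B (f i)) = A (?u + scale (e i) (f i))" by simp
  also have "\<dots> = A ?u + scale (e i) (A (f i))"
    using linear_onD[OF assms(3)] uV fV assms(4) by (metis subspace_scale)
  also have "\<dots> - scale (d i * e i) (f i) = A ?u + scale (e i) ?w"
    by (simp add: scale_right_diff_distrib mult.commute)
  also have "\<dots> \<in> family_span f i"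
    using triangular_family_span[OF assms(1,3,4,5) _ u] i w
    by (intro subspace_add subspace_scale) auto
  finally show "A (B (f i)) - scale (d i * e i) (f i) \<in> family_span f i" .
qed

lemma triangular_funpow:
  assumes "triangular f n A d" "linear_on V A" "subspace V" "family_span f n \<subseteq> V"
  shows "triangular f n (A ^^ k) (\<lambda>i. d i ^ k)"
proof (induction k)
  case 0
  then show ?case by (simp add: triangular_def subspace_0)
next
  case (Suc k)
  then show ?case
    using triangular_comp[OF assms(1) Suc assms(2-4) linear_on_funpow[OF assms(2)]] by (simp add: o_def)
qed

end

section \<open>Eigenvectors modulo a subspace, and vectors avoiding finitely many kernels\<close>

context complex_space
begin

text \<open>Existence of an eigenvector on the quotient of \<open>W\<close> by \<open>V\<close>.
  Among the nonzero polynomials \<open>p\<close> for which \<open>p(A) w\<close> lies in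
  \<open>V\<close>, take one of least degree; it is not constant because \<open>w\<close> is outside
  \<open>V\<close>. Splitting off a root \<open>c\<close> leaves \<open>q\<close>, and
  \<open>q(A) w\<close> is outside \<open>V\<close> by minimality while \<open>A - c\<close> sends
  it into \<open>V\<close>.\<close>

lemma eigenvector_modulo:
  assumes W: "subspace W" "W \<subseteq> span B" "finite B" and V: "subspace V" "V \<subset> W"
    and A: "linear_on W A" "\<And>v. v \<in> V \<Longrightarrow> A v \<in> V"
  shows "\<exists>v\<in>W. v \<notin> V \<and> (\<exists>c. A v - scale c v \<in> V)"
proof -
  obtain w where w: "w \<in> W" "w \<notin> V" using V(2) by blast
  obtain g m where g: "indep_family g m" "family_span g m = W"
    using ex_basis_family[OF W] by blast
  define ev where "ev p = (\<Sum>i\<le>degree p. scale (coeff p i) ((A ^^ i) w))" for p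
  have Aw: "(A ^^ i) w \<in> W" for i
    using linear_onD(1)[OF linear_on_funpow[OF A(1)]] w(1) by simp
  have evN: "ev p = (\<Sum>i<N. scale (coeff p i) ((A ^^ i) w))" if "degree p < N" for p N
    unfolding ev_def using that by (intro sum.mono_neutral_left) (auto simp: coeff_eq_0)
  have evW: "ev p \<in> W" for p
    unfolding ev_def using Aw W(1) by (intro subspace_sum subspace_scale)
  have root: "ev ([:-c, 1:] * q) = A (ev q) - scale c (ev q)" for c q
  proof -
    define N where "N = Suc (degree q)"
    have N: "degree q < N" "degree q < Suc N" by (simp_all add: N_def)
    have "degree ([:-c, 1:] * q) < Suc N"
      using degree_mult_le[of "[:-c, 1:]" q] by (simp add: N_def)
    then have "ev ([:-c, 1:] * q)
        = (\<Sum>i<Suc N. scale (coeff (pCons 0 q) i - c * coeff q i) ((A ^^ i) w))"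
      by (subst evN[of _ "Suc N"]) (auto intro: sum.cong)
    also have "\<dots> = (\<Sum>i<Suc N. scale (coeff (pCons 0 q) i) ((A ^^ i) w))
        - (\<Sum>i<Suc N. scale (c * coeff q i) ((A ^^ i) w))"
      by (simp add: scale_left_diff_distrib sum_subtractf del: sum.lessThan_Suc)
    also have "(\<Sum>i<Suc N. scale (coeff (pCons 0 q) i) ((A ^^ i) w))
        = (\<Sum>i<N. scale (coeff q i) (A ((A ^^ i) w)))"
      by (subst sum.lessThan_Suc_shift) simp
    also have "\<dots> = A (ev q)"
      unfolding evN[OF N(1)] using Aw by (intro linear_on_sum[OF A(1) W(1), symmetric])
    also have "(\<Sum>i<Suc N. scale (c * coeff q i) ((A ^^ i) w)) = scale c (ev q)"
      unfolding evN[OF N(2)] by (simp only: scale_sum_right scale_scale)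
    finally show ?thesis .
  qed
  \<comment> \<open>The \<open>Suc m\<close> vectors obtained from \<open>w\<close> by powers of
    \<open>A\<close> are dependent in dimension \<open>m\<close>; the coefficients of the dependence
    form a first polynomial that annihilates \<open>w\<close>.\<close>
  obtain b where b: "\<exists>j<Suc m. b j \<noteq> 0"
    "\<And>i. i < m \<Longrightarrow> (\<Sum>j<Suc m. coord g m ((A ^^ j) w) i * b j) = 0"
    using underdetermined_system[OF lessI, of m "\<lambda>i j. coord g m ((A ^^ j) w) i"] by blast
  define p0 where "p0 = (\<Sum>j<Suc m. monom (b j) j)"
  have cp0: "coeff p0 j = (if j < Suc m then b j else 0)" for j
    by (simp add: p0_def coeff_sum del: sum.lessThan_Suc)
  then have "p0 \<noteq> 0" using b(1) by (metis coeff_0)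
  have "degree p0 < Suc m"
    using cp0 \<open>p0 \<noteq> 0\<close> by (metis leading_coeff_0_iff)
  have "ev p0 = 0"
  proof (rule coord_eqI[OF g(1)])
    show "ev p0 \<in> family_span g m" "0 \<in> family_span g m" using evW g(2) subspace_0[OF W(1)] by auto
    fix i assume "i < m"
    have "coord g m (ev p0) i = (\<Sum>j<Suc m. b j * coord g m ((A ^^ j) w) i)"
      unfolding evN[OF \<open>degree p0 < Suc m\<close>] using Aw g(2)
      by (subst coord_lincomb[OF g(1)]) (auto simp: cp0 simp del: sum.lessThan_Suc)
    also have "\<dots> = 0" using b(2)[OF \<open>i < m\<close>] by (simp add: mult.commute)
    finally show "coord g m (ev p0) i = coord g m 0 i" by simp
  qed
  define P where "P p \<longleftrightarrow> p \<noteq> 0 \<and> ev p \<in> V" for p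
  have "P p0" unfolding P_def using \<open>p0 \<noteq> 0\<close> \<open>ev p0 = 0\<close> subspace_0[OF V(1)] by simp
  define p where "p = arg_min degree P"
  have p: "P p" unfolding p_def by (rule arg_min_natI[of P, OF \<open>P p0\<close>])
  have p_min: "degree p \<le> degree q" if "P q" for q
    unfolding p_def by (rule arg_min_nat_le[of P, OF that])
  have "degree p \<noteq> 0"
  proof
    assume "degree p = 0"
    then have *: "ev p = scale (coeff p 0) w" "coeff p 0 \<noteq> 0"
      using p by (auto simp: ev_def P_def elim!: degree_eq_zeroE)
    then have "scale (inverse (coeff p 0)) (ev p) = w" by simp
    then show False using p w(2) subspace_scale[OF V(1)] P_def by metis
  qed
  then have "\<not> constant (poly p)" by (simp add: constant_degree)
  then obtain c where "poly p c = 0" using fundamental_theorem_of_algebra by blast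
  then obtain q where q: "p = [:-c, 1:] * q" using poly_eq_0_iff_dvd by blast
  have "q \<noteq> 0" using p q by (auto simp: P_def)
  then have "degree p = Suc (degree q)" unfolding q by (subst degree_mult_eq) auto
  then have "\<not> P q" using p_min[of q] by auto
  then have "ev q \<notin> V" using \<open>q \<noteq> 0\<close> by (simp add: P_def)
  moreover have "A (ev q) - scale c (ev q) \<in> V" using p root[of c q] q by (simp add: P_def)
  ultimately show ?thesis using evW by blast
qed

text \<open>A complex vector space is not a finite union of kernels of nonzero functionals: if
  \<open>x\<close> is good for \<open>F\<close> and \<open>z\<close> for the new functional, then
  \<open>x + e z\<close> is good for all of them except for finitely many \<open>e\<close>.\<close>

lemma ex_common_nonzero:
  assumes V: "subspace V" and "finite F"
    and F: "\<And>\<phi>. \<phi> \<in> F \<Longrightarrow> (\<exists>z\<in>V. \<phi> z \<noteq> (0::complex))"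
      "\<And>\<phi> x y. \<phi> \<in> F \<Longrightarrow> x \<in> V \<Longrightarrow> y \<in> V \<Longrightarrow> \<phi> (x + y) = \<phi> x + \<phi> y"
      "\<And>\<phi> c x. \<phi> \<in> F \<Longrightarrow> x \<in> V \<Longrightarrow> \<phi> (scale c x) = c * \<phi> x"
  shows "\<exists>x\<in>V. \<forall>\<phi>\<in>F. \<phi> x \<noteq> 0"
  using assms(2) F
proof (induction F)
    case empty
    then show ?case using subspace_0[OF V] by blast
  next
    case (insert \<phi> F)
    then obtain x where x: "x \<in> V" "\<forall>\<psi>\<in>F. \<psi> x \<noteq> 0" by auto
    obtain z where z: "z \<in> V" "\<phi> z \<noteq> 0" using insert.prems(1)[of \<phi>] by blast
    \<comment> \<open>For a functional that vanishes at \<open>z\<close> the quotient is 0 by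
      convention, which merely excludes \<open>e = 0\<close> as well.\<close>
    have "finite ((\<lambda>\<psi>. - \<psi> x / \<psi> z) ` insert \<phi> F)" using insert.hyps(1) by blast
    then obtain e where e: "e \<notin> (\<lambda>\<psi>. - \<psi> x / \<psi> z) ` insert \<phi> F"
      using ex_new_if_finite infinite_UNIV_char_0 by blast
    have "\<psi> (x + scale e z) \<noteq> 0" if "\<psi> \<in> insert \<phi> F" for \<psi>
    proof
      assume "\<psi> (x + scale e z) = 0"
      then have *: "\<psi> x + e * \<psi> z = 0"
        using insert.prems(2)[OF that x(1), of "scale e z"] insert.prems(3)[OF that z(1)]
          subspace_scale[OF V z(1)] by simp
      have "\<psi> z \<noteq> 0"
      proof
        assume "\<psi> z = 0"
        then have "\<psi> x = 0" "\<psi> \<noteq> \<phi>" using * z(2) by auto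
        then show False using x(2) that by blast
      qed
      then have "e = - \<psi> x / \<psi> z" using * by (simp add: field_simps add_eq_0_iff)
      then show False using e that by blast
    qed
    then show ?case using x(1) z(1) V by (meson subspace_add subspace_scale)
qed

end

section \<open>Lie's theorem\<close>

sublocale lie_algebra \<subseteq> complex_space "lscale L" ..

context lie_algebra
begin

lemma carrier_closed [simp]:
  "0 \<in> lcarrier L"
  "x \<in> lcarrier L \<Longrightarrow> y \<in> lcarrier L \<Longrightarrow> x + y \<in> lcarrier L"
  "x \<in> lcarrier L \<Longrightarrow> y \<in> lcarrier L \<Longrightarrow> x - y \<in> lcarrier L"
  "x \<in> lcarrier L \<Longrightarrow> - x \<in> lcarrier L"
  "x \<in> lcarrier L \<Longrightarrow> lscale L c x \<in> lcarrier L"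
  "x \<in> lcarrier L \<Longrightarrow> y \<in> lcarrier L \<Longrightarrow> lbracket L x y \<in> lcarrier L"
  using carrier_subspace bracket_closed
  by (auto simp: subspace_0 subspace_add subspace_diff subspace_neg subspace_scale)

lemma linear_on_bracket: "z \<in> lcarrier L \<Longrightarrow> linear_on (lcarrier L) (lbracket L z)"
  by (simp add: linear_on_def bracket_add_right bracket_scale_right)

lemma bracket_0_left [simp]: "x \<in> lcarrier L \<Longrightarrow> lbracket L 0 x = 0"
  using bracket_scale_left[of 0 x 0] by simp

lemma bracket_0_right [simp]: "x \<in> lcarrier L \<Longrightarrow> lbracket L x 0 = 0"
  using bracket_scale_right[of x 0 0] by simp

lemma bracket_minus_left: "x \<in> lcarrier L \<Longrightarrow> y \<in> lcarrier L \<Longrightarrow> lbracket L (- x) y = - lbracket L x y"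
  using bracket_scale_left[of x y "-1"] by simp

lemma bracket_minus_right: "x \<in> lcarrier L \<Longrightarrow> y \<in> lcarrier L \<Longrightarrow> lbracket L x (- y) = - lbracket L x y"
  using bracket_scale_right[of x y "-1"] by simp

lemma bracket_diff_left:
  "x \<in> lcarrier L \<Longrightarrow> y \<in> lcarrier L \<Longrightarrow> z \<in> lcarrier L \<Longrightarrow>
    lbracket L (x - y) z = lbracket L x z - lbracket L y z"
  using bracket_add_left[of x "- y" z] by (simp add: bracket_minus_left)

lemma bracket_diff_right:
  "x \<in> lcarrier L \<Longrightarrow> y \<in> lcarrier L \<Longrightarrow> z \<in> lcarrier L \<Longrightarrow>
    lbracket L z (x - y) = lbracket L z x - lbracket L z y"
  using bracket_add_right[of z x "- y"] by (simp add: bracket_minus_right)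

lemma bracket_anticomm:
  assumes "x \<in> lcarrier L" "y \<in> lcarrier L"
  shows "lbracket L x y = - lbracket L y x"
proof -
  have "lbracket L (x + y) (x + y) = 0" using assms by (simp add: bracket_self)
  then have "lbracket L x y + lbracket L y x = 0"
    using assms bracket_self[of x] bracket_self[of y] by (simp add: bracket_add_left bracket_add_right add.commute)
  then show ?thesis by (simp add: eq_neg_iff_add_eq_0)
qed

lemma bracket_derivation:
  assumes "x \<in> lcarrier L" "y \<in> lcarrier L" "z \<in> lcarrier L"
  shows "lbracket L x (lbracket L y z) = lbracket L (lbracket L x y) z + lbracket L y (lbracket L x z)"
proof -
  have "lbracket L y (lbracket L z x) = - lbracket L y (lbracket L x z)"
    using assms bracket_anticomm[of z x] by (simp add: bracket_minus_right)
  moreover have "lbracket L z (lbracket L x y) = - lbracket L (lbracket L x y) z"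
    using assms by (intro bracket_anticomm) auto
  ultimately show ?thesis using jacobi[OF assms] by (simp add: algebra_simps)
qed

lemma carrier_in_span: "\<exists>B. finite B \<and> lcarrier L \<subseteq> span B"
  using carrier_fin_dim by blast

text \<open>A subspace equal to the span of its own brackets would be contained in every term of the
  derived series.\<close>

lemma solvable_not_perfect:
  assumes "lie_solvable L" "subspace K" "K \<subseteq> lcarrier L" "K \<noteq> {0}"
  shows "bracket_span L K K \<noteq> K"
proof
  assume eq: "bracket_span L K K = K"
  have "K \<subseteq> derived_series L n" for n
  proof (induction n)
    case (Suc n)
    then have "bracket_span L K K \<subseteq> derived_series L (Suc n)"
      unfolding derived_series.simps bracket_span_def by (intro span_mono) blast
    then show ?case using eq by simp
  qed (use assms(3) in simp)
  then have "K \<subseteq> {0}" using assms(1) unfolding lie_solvable_def by metis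
  then show False using assms(2,4) subspace_0 by blast
qed

text \<open>With \<open>w\<^sub>i = (ad y)\<^sup>i w\<close>, an element \<open>z\<close> of \<open>K\<close> maps \<open>w\<^sub>i\<^sub>+\<^sub>1\<close> to
  \<open>\<mu>(z) w\<^sub>i\<^sub>+\<^sub>1 + (i + 1) \<mu>([z,y]) w\<^sub>i\<close> modulo \<open>V\<close> and the earlier \<open>w\<^sub>j\<close>. Comparing coefficients
  at the first linear dependence kills \<open>\<mu>([z,y])\<close>.\<close>

lemma weight_bracket_zero:
  assumes V: "subspace V" "V \<subseteq> lcarrier L" and K: "K \<subseteq> lcarrier L" and y: "y \<in> lcarrier L"
    and KV: "\<And>z v. z \<in> K \<Longrightarrow> v \<in> V \<Longrightarrow> lbracket L z v \<in> V"
    and yV: "\<And>v. v \<in> V \<Longrightarrow> lbracket L y v \<in> V"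
    and yK: "\<And>z. z \<in> K \<Longrightarrow> lbracket L z y \<in> K"
    and w: "w \<in> lcarrier L" "w \<notin> V"
    and mu: "\<And>z. z \<in> K \<Longrightarrow> lbracket L z w - lscale L (\<mu> z) w \<in> V"
    and z: "z \<in> K"
  shows "\<mu> (lbracket L z y) = 0"
proof -
  define u where "u i = (lbracket L y ^^ i) w" for i
  have u_Suc: "u (Suc i) = lbracket L y (u i)" for i by (simp add: u_def)
  have uC: "u i \<in> lcarrier L" for i
    by (induction i) (use w(1) y in \<open>simp_all add: u_def\<close>)
  \<comment> \<open>Including \<open>V\<close> in every \<open>U i\<close> replaces the passage to
    the quotient by \<open>V\<close>.\<close>
  define U where "U i = span (V \<union> u ` {..<i})" for i
  have U_sub: "subspace (U i)" for i by (simp add: U_def)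
  have UC: "U i \<subseteq> lcarrier L" for i
    unfolding U_def using V(2) uC by (intro span_minimal carrier_subspace) auto
  have VU: "v \<in> V \<Longrightarrow> v \<in> U i" for v i by (auto simp: U_def intro: span_base)
  have U_mono: "i \<le> j \<Longrightarrow> U i \<subseteq> U j" for i j unfolding U_def by (intro span_mono) auto
  have uU: "i < j \<Longrightarrow> u i \<in> U j" for i j by (auto simp: U_def intro: span_base)
  have U_induct: "U i \<subseteq> {x. P x}"
    if "subspace {x. P x}" "\<And>v. v \<in> V \<Longrightarrow> P v" "\<And>j. j < i \<Longrightarrow> P (u j)" for P i
    unfolding U_def using that by (intro span_minimal) auto
  have yU: "lbracket L y x \<in> U (Suc i)" if "x \<in> U i" for x i
  proof -
    have "U i \<subseteq> {x. x \<in> lcarrier L \<and> lbracket L y x \<in> U (Suc i)}"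
    proof (rule U_induct)
      show "subspace {x. x \<in> lcarrier L \<and> lbracket L y x \<in> U (Suc i)}"
        unfolding subspace_def using y U_sub
        by (auto simp: bracket_add_right bracket_scale_right subspace_0 subspace_add subspace_scale)
    qed (use V(2) yV VU uC uU u_Suc[symmetric] in auto)
    then show ?thesis using that by blast
  qed
  have step: "lbracket L z (u (Suc i)) - lscale L (\<mu> z) (u (Suc i))
      - lscale L (of_nat (Suc i) * \<mu> (lbracket L z y)) (u i) \<in> U i" if "z \<in> K" for z i
    using that
  proof (induction i arbitrary: z)
    case 0
    have zC: "z \<in> lcarrier L" "lbracket L z y \<in> K" "lbracket L z y \<in> lcarrier L" using 0 K yK by auto
    define v where "v = lbracket L z w - lscale L (\<mu> z) w"
    define v' where "v' = lbracket L (lbracket L z y) w - lscale L (\<mu> (lbracket L z y)) w"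
    have v: "v \<in> V" "v' \<in> V" using mu 0 zC by (auto simp: v_def v'_def)
    have "lbracket L z (u 1) = lbracket L (lbracket L z y) w + lbracket L y (lscale L (\<mu> z) w + v)"
      using bracket_derivation[OF zC(1) y w(1)] by (simp add: u_def v_def)
    also have "\<dots> = v' + lscale L (\<mu> (lbracket L z y)) w + (lscale L (\<mu> z) (u 1) + lbracket L y v)"
      using v V(2) w(1) y by (simp add: v'_def u_def bracket_add_right bracket_scale_right subset_iff)
    finally have "lbracket L z (u 1) - lscale L (\<mu> z) (u 1) - lscale L (\<mu> (lbracket L z y)) (u 0)
        = v' + lbracket L y v"
      by (simp add: u_def)
    also have "\<dots> \<in> U 0" using v yV VU U_sub by (simp add: subspace_add)
    finally show ?case by simp
  next
    case (Suc i)
    let ?zy = "lbracket L z y" and ?k = "of_nat (Suc i) :: complex"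
    have zC: "z \<in> lcarrier L" "?zy \<in> K" "?zy \<in> lcarrier L" using Suc.prems K yK by auto
    define a where "a = lbracket L z (u (Suc i)) - lscale L (\<mu> z) (u (Suc i)) - lscale L (?k * \<mu> ?zy) (u i)"
    define b where "b = lbracket L ?zy (u (Suc i)) - lscale L (\<mu> ?zy) (u (Suc i))
      - lscale L (?k * \<mu> (lbracket L ?zy y)) (u i)"
    have a: "a \<in> U i" and b: "b \<in> U i"
      unfolding a_def b_def by (fact Suc.IH[OF Suc.prems] Suc.IH[OF zC(2)])+
    have aC: "a \<in> lcarrier L" using a UC by blast
    have "lbracket L z (u (Suc (Suc i))) = lbracket L ?zy (u (Suc i)) + lbracket L y (lbracket L z (u (Suc i)))"
      unfolding u_Suc[of "Suc i"] using bracket_derivation[OF zC(1) y uC] .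
    also have "lbracket L z (u (Suc i)) = lscale L (\<mu> z) (u (Suc i)) + lscale L (?k * \<mu> ?zy) (u i) + a"
      by (simp add: a_def)
    also have "lbracket L y \<dots> = lscale L (\<mu> z) (u (Suc (Suc i))) + lscale L (?k * \<mu> ?zy) (u (Suc i)) + lbracket L y a"
      using y uC aC by (simp add: bracket_add_right bracket_scale_right u_Suc del: of_nat_Suc)
    also have "lbracket L ?zy (u (Suc i)) = lscale L (\<mu> ?zy) (u (Suc i)) + lscale L (?k * \<mu> (lbracket L ?zy y)) (u i) + b"
      by (simp add: b_def)
    moreover have e: "lscale L (of_nat (Suc (Suc i)) * \<mu> ?zy) (u (Suc i))
        = lscale L (\<mu> ?zy) (u (Suc i)) + lscale L (?k * \<mu> ?zy) (u (Suc i))"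
      by (simp only: of_nat_Suc distrib_right mult_1 scale_left_distrib)
    ultimately have "lbracket L z (u (Suc (Suc i))) - lscale L (\<mu> z) (u (Suc (Suc i)))
       - lscale L (of_nat (Suc (Suc i)) * \<mu> ?zy) (u (Suc i))
       = lscale L (?k * \<mu> (lbracket L ?zy y)) (u i) + b + lbracket L y a"
      unfolding e by (simp add: algebra_simps del: of_nat_Suc)
    also have "\<dots> \<in> U (Suc i)"
      using uU[of i "Suc i"] b yU[OF a] U_mono[of i "Suc i"] U_sub
      by (intro subspace_add subspace_scale) auto
    finally show ?case .
  qed
  have weak: "lbracket L z (u j) - lscale L (\<mu> z) (u j) \<in> U j" for j
  proof (cases j)
    case 0
    then show ?thesis using mu[OF z] VU by (simp add: u_def)
  next
    case (Suc i)
    have "lbracket L z (u j) - lscale L (\<mu> z) (u j) - lscale L (of_nat (Suc i) * \<mu> (lbracket L z y)) (u i) \<in> U j"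
      using step[OF z, of i] U_mono[of i j] Suc by auto
    moreover have "lscale L (of_nat (Suc i) * \<mu> (lbracket L z y)) (u i) \<in> U j"
      using uU[of i j] Suc U_sub by (intro subspace_scale) auto
    ultimately have "lbracket L z (u j) - lscale L (\<mu> z) (u j) - lscale L (of_nat (Suc i) * \<mu> (lbracket L z y)) (u i)
        + lscale L (of_nat (Suc i) * \<mu> (lbracket L z y)) (u i) \<in> U j"
      by (rule subspace_add[OF U_sub])
    then show ?thesis by simp
  qed
  \<comment> \<open>Otherwise the \<open>u i\<close> would form arbitrarily long independent
    families in a finite-dimensional space.\<close>
  have "\<exists>n. u n \<in> U n"
  proof (rule ccontr)
    assume no: "\<nexists>n. u n \<in> U n"
    have "u i \<notin> family_span u i" for i
    proof -
      have "family_span u i \<subseteq> U i" unfolding family_span_def U_def by (intro span_mono) auto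
      then show ?thesis using no by blast
    qed
    then have ind: "indep_family u n" for n by (simp add: indep_family_def family_span_def)
    obtain B where B: "finite B" "lcarrier L \<subseteq> span B" using carrier_in_span by blast
    have "family_span u n \<subseteq> span B" for n
      using family_span_least[OF carrier_subspace, of n u] uC B(2) by blast
    then have "Suc (card B) \<le> card B" using indep_family_le_card[OF ind _ B(1)] by blast
    then show False by simp
  qed
  define n where "n = (LEAST n. u n \<in> U n)"
  have n: "u n \<in> U n" unfolding n_def using \<open>\<exists>n. u n \<in> U n\<close> by (rule LeastI_ex)
  have "U 0 = V" using V(1) by (simp add: U_def span_eq_iff)
  then have "n \<noteq> 0" using n w(2) by (auto simp: u_def intro!: gr0I)
  then obtain p where p: "n = Suc p" using not0_implies_Suc by blast
  have np: "u p \<notin> U p" using not_less_Least[of p "\<lambda>n. u n \<in> U n"] p n_def by simp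
  have zC: "z \<in> lcarrier L" using z K by blast
  \<comment> \<open>All generators of \<open>U n\<close> are sent by \<open>z - \<mu>(z)\<close>
    into \<open>U p\<close>. As \<open>u n\<close> now lies in \<open>U n\<close>, its image lands
    there too, whereas \<open>step\<close> computes that image as a multiple of \<open>u p\<close>
    modulo \<open>U p\<close>.\<close>
  have "U (Suc p) \<subseteq> {x. x \<in> lcarrier L \<and> lbracket L z x - lscale L (\<mu> z) x \<in> U p}"
  proof (rule U_induct)
    have "lbracket L z (x + x') - lscale L (\<mu> z) (x + x')
        = (lbracket L z x - lscale L (\<mu> z) x) + (lbracket L z x' - lscale L (\<mu> z) x')"
      if "x \<in> lcarrier L" "x' \<in> lcarrier L" for x x'
      using that zC by (simp add: bracket_add_right scale_right_distrib)
    moreover have "lbracket L z (lscale L c x) - lscale L (\<mu> z) (lscale L c x)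
        = lscale L c (lbracket L z x - lscale L (\<mu> z) x)" if "x \<in> lcarrier L" for c x
      using that zC by (simp add: bracket_scale_right scale_right_diff_distrib mult.commute)
    ultimately show "subspace {x. x \<in> lcarrier L \<and> lbracket L z x - lscale L (\<mu> z) x \<in> U p}"
      unfolding subspace_def using zC U_sub
      by (simp add: subspace_0 subspace_add subspace_scale)
    show "v \<in> lcarrier L \<and> lbracket L z v - lscale L (\<mu> z) v \<in> U p" if "v \<in> V" for v
      using that V(2) KV[OF z that] VU V(1) by (auto intro!: VU subspace_diff subspace_scale)
    show "u j \<in> lcarrier L \<and> lbracket L z (u j) - lscale L (\<mu> z) (u j) \<in> U p" if "j < Suc p" for j
      using uC weak U_mono[of j p] that by auto
  qed
  then have "lbracket L z (u n) - lscale L (\<mu> z) (u n) \<in> U p" using n p by blast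
  from subspace_diff[OF U_sub this step[OF z, of p, folded p]]
  have *: "lscale L (of_nat n * \<mu> (lbracket L z y)) (u p) \<in> U p" by simp
  show ?thesis
  proof (rule ccontr)
    assume "\<mu> (lbracket L z y) \<noteq> 0"
    \<comment> \<open>Characteristic zero enters here: the factor \<open>n\<close> is a nonzero
      scalar.\<close>
    then have ne: "(of_nat n :: complex) * \<mu> (lbracket L z y) \<noteq> 0" using \<open>n \<noteq> 0\<close> by simp
    then show False using subspace_scale_cancel[OF U_sub * ne] np by blast
  qed
qed

text \<open>Lie's theorem modulo \<open>V\<close>, by induction on the dimension of the subalgebra
  \<open>K\<close>. A hyperplane \<open>K'\<close> of \<open>K\<close> containing all brackets of
  \<open>K\<close> has a weight vector by induction. Its weight space \<open>W'\<close> modulo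
  \<open>V\<close> is stable under a complementary \<open>y\<close>: in
  \<open>[z, [y, x]] = [[z, y], x] + [y, [z, x]]\<close> the first term lies in \<open>V\<close>
  because \<open>weight_bracket_zero\<close> kills the weight of \<open>[z, y]\<close>. An
  eigenvector of \<open>y\<close> in \<open>W'\<close> modulo \<open>V\<close> serves all of
  \<open>K\<close>.\<close>

lemma common_eigenvector_modulo:
  assumes solv: "lie_solvable L"
    and W: "subspace W" "W \<subseteq> lcarrier L" and V: "subspace V" "V \<subset> W"
    and K: "subspace K" "K \<subseteq> lcarrier L" "\<And>x y. x \<in> K \<Longrightarrow> y \<in> K \<Longrightarrow> lbracket L x y \<in> K"
    and KW: "\<And>z w. z \<in> K \<Longrightarrow> w \<in> W \<Longrightarrow> lbracket L z w \<in> W"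
    and KV: "\<And>z v. z \<in> K \<Longrightarrow> v \<in> V \<Longrightarrow> lbracket L z v \<in> V"
  shows "\<exists>w\<in>W. w \<notin> V \<and> (\<forall>z\<in>K. \<exists>c. lbracket L z w - lscale L c w \<in> V)"
  using K KW KV
proof (induction "dim K" arbitrary: K rule: less_induct)
  case less
  note K = less.prems(1-3) and KW = less.prems(4) and KV = less.prems(5)
  obtain B where B: "finite B" "lcarrier L \<subseteq> span B" using carrier_in_span by blast
  show ?case
  proof (cases "K = {0}")
    case True
    obtain w where w: "w \<in> W" "w \<notin> V" using V(2) by blast
    then have "w \<in> lcarrier L" using W(2) by blast
    then have "lbracket L 0 w - lscale L 0 w \<in> V" using subspace_0[OF V(1)] by simp
    then show ?thesis using w True by blast
  next
    case False
    let ?D = "bracket_span L K K"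
    have "{lbracket L x y | x y. x \<in> K \<and> y \<in> K} \<subseteq> K" using K(3) by blast
    then have D: "?D \<subseteq> K" "subspace ?D"
      unfolding bracket_span_def by (simp_all add: span_minimal K(1))
    have DB: "?D \<subseteq> span B" "K \<subseteq> span B" using D(1) K(2) B(2) by auto
    obtain g k where g: "indep_family g k" "family_span g k = ?D"
      using ex_basis_family[OF D(2) DB(1) B(1)] by blast
    obtain h m where h: "k \<le> m" "\<forall>i<k. h i = g i" "indep_family h m" "family_span h m = K"
      using basis_extend[OF g(1) K(1) _ DB(2) B(1)] g(2) D(1) by blast
    have hk: "family_span h k = ?D" using family_span_cong[of k h g] h(2) g(2) by simp
    have "k \<noteq> m" using solvable_not_perfect[OF solv K(1,2) False] hk h(4) by blast
    then have km: "k < m" using h(1) by simp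
    \<comment> \<open>The basis \<open>h\<close> begins with a basis of the span of brackets, which
      has length \<open>k\<close>. Hence \<open>h k\<close> is the first vector outside it, and the
      kernel of the coordinate \<open>k\<close> is a hyperplane containing all brackets.\<close>
    define y where "y = h k"
    have yK: "y \<in> K" using family_span_base[OF km, of h] h(4) by (simp add: y_def)
    define K' where "K' = {v \<in> K. coord h m v k = 0}"
    have K'K: "K' \<subseteq> K" by (auto simp: K'_def)
    have sub': "subspace K'"
      unfolding subspace_def K'_def using h(3,4) K(1)
      by (auto simp: coord_add coord_scale subspace_0 subspace_add subspace_scale)
    have DK': "lbracket L a b \<in> K'" if "a \<in> K" "b \<in> K" for a b
    proof -
      have "lbracket L a b \<in> ?D" unfolding bracket_span_def using that by (intro span_base) blast
      then show ?thesis using coord_lower[OF h(3) h(1), of _ k] hk km D(1) by (auto simp: K'_def)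
    qed
    have "y \<notin> K'" using coord_base[OF h(3) km km] by (simp add: K'_def y_def)
    then have "K' \<subset> K" using K'K yK by blast
    then have "dim K' < dim K" using dim_psubset_finite[OF sub' K(1) _ DB(2) B(1)] by blast
    then have "\<exists>w\<in>W. w \<notin> V \<and> (\<forall>z\<in>K'. \<exists>c. lbracket L z w - lscale L c w \<in> V)"
    proof (rule less.hyps[OF _ sub'])
      show "K' \<subseteq> lcarrier L" using K'K K(2) by (rule order_trans)
      show "lbracket L a b \<in> K'" if "a \<in> K'" "b \<in> K'" for a b
        by (rule DK'; rule subsetD[OF K'K]) fact+
      show "lbracket L z v \<in> W" if "z \<in> K'" "v \<in> W" for z v
        using KW[OF subsetD[OF K'K that(1)] that(2)] .
      show "lbracket L z v \<in> V" if "z \<in> K'" "v \<in> V" for z v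
        using KV[OF subsetD[OF K'K that(1)] that(2)] .
    qed
    then obtain w where w: "w \<in> W" "w \<notin> V" "\<forall>z\<in>K'. \<exists>c. lbracket L z w - lscale L c w \<in> V" by blast
    then obtain \<mu> where mu: "\<forall>z\<in>K'. lbracket L z w - lscale L (\<mu> z) w \<in> V" by metis
    define W' where "W' = {x \<in> W. \<forall>z\<in>K'. lbracket L z x - lscale L (\<mu> z) x \<in> V}"
    have yC: "y \<in> lcarrier L" using yK K(2) by blast
    have VC: "V \<subseteq> lcarrier L" using V(2) W(2) by blast
    have W'C: "W' \<subseteq> lcarrier L" "W' \<subseteq> W" using W(2) by (auto simp: W'_def)
    have VW': "v \<in> W'" if "v \<in> V" for v
      unfolding W'_def using that V KV K'K subspace_scale[OF V(1) that]
      by (auto intro!: subspace_diff[OF V(1)])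
    have "w \<in> W'" using w(1) mu by (simp add: W'_def)
    then have VsW': "V \<subset> W'" using VW' w(2) by blast
    have subW': "subspace W'"
    proof -
      have "lbracket L z (x + x') - lscale L (\<mu> z) (x + x')
          = (lbracket L z x - lscale L (\<mu> z) x) + (lbracket L z x' - lscale L (\<mu> z) x')"
        if "x \<in> W" "x' \<in> W" "z \<in> K'" for x x' z
      proof -
        have "x \<in> lcarrier L" "x' \<in> lcarrier L" "z \<in> lcarrier L" using that W(2) K'K K(2) by auto
        then show ?thesis by (simp add: bracket_add_right scale_right_distrib)
      qed
      moreover have "lbracket L z (lscale L c x) - lscale L (\<mu> z) (lscale L c x)
          = lscale L c (lbracket L z x - lscale L (\<mu> z) x)" if "x \<in> W" "z \<in> K'" for c x z
      proof -
        have "x \<in> lcarrier L" "z \<in> lcarrier L" using that W(2) K'K K(2) by auto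
        then show ?thesis by (simp add: bracket_scale_right scale_right_diff_distrib mult.commute)
      qed
      moreover have "lbracket L z 0 - lscale L (\<mu> z) 0 \<in> V" if "z \<in> K'" for z
      proof -
        have "z \<in> lcarrier L" using that K'K K(2) by auto
        then show ?thesis using subspace_0[OF V(1)] by simp
      qed
      ultimately show ?thesis
        unfolding subspace_def W'_def using W(1) V(1)
        by (simp add: subspace_0 subspace_add subspace_scale)
    qed
    have yW': "lbracket L y x \<in> W'" if x: "x \<in> W'" for x
    proof (cases "x \<in> V")
      case True
      then show ?thesis using VW' KV yK by blast
    next
      case False
      have xC: "x \<in> W" "x \<in> lcarrier L" using x W'C by auto
      have "lbracket L z (lbracket L y x) - lscale L (\<mu> z) (lbracket L y x) \<in> V" if z: "z \<in> K'" for z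
      proof -
        have zC: "z \<in> lcarrier L" using z K'K K(2) by blast
        have m0: "\<mu> (lbracket L z y) = 0"
        proof (rule weight_bracket_zero[OF V(1) VC _ yC])
          show "K' \<subseteq> lcarrier L" using K'K K(2) by blast
          show "lbracket L z v \<in> V" if "z \<in> K'" "v \<in> V" for z v using that KV K'K by blast
          show "lbracket L y v \<in> V" if "v \<in> V" for v using that KV yK by blast
          show "lbracket L z y \<in> K'" if "z \<in> K'" for z using that DK' K'K yK by blast
          show "lbracket L z x - lscale L (\<mu> z) x \<in> V" if "z \<in> K'" for z
            using that x by (simp add: W'_def)
        qed (use xC False z in auto)
        define v where "v = lbracket L z x - lscale L (\<mu> z) x"
        have v: "v \<in> V" using x z by (simp add: W'_def v_def)
        then have vC: "v \<in> lcarrier L" using VC by blast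
        have zy: "lbracket L z y \<in> K'" using DK' z K'K yK by blast
        have "lbracket L z (lbracket L y x) = lbracket L (lbracket L z y) x + lbracket L y (lscale L (\<mu> z) x + v)"
          using bracket_derivation[OF zC yC xC(2)] by (simp add: v_def)
        then have "lbracket L z (lbracket L y x) - lscale L (\<mu> z) (lbracket L y x)
            = lbracket L (lbracket L z y) x + lbracket L y v"
          using yC xC(2) vC by (simp add: bracket_add_right bracket_scale_right)
        moreover have "lbracket L (lbracket L z y) x \<in> V" using x zy m0 by (auto simp: W'_def)
        moreover have "lbracket L y v \<in> V" using v KV yK by blast
        ultimately show ?thesis using subspace_add[OF V(1)] by simp
      qed
      then show ?thesis using KW[OF yK xC(1)] by (simp add: W'_def)
    qed
    have "linear_on W' (lbracket L y)"
      using yW' by (intro linear_on_subset[OF linear_on_bracket[OF yC] W'C(1)])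
    moreover have "W' \<subseteq> span B" using W'C(1) B(2) by blast
    ultimately obtain x c where x: "x \<in> W'" "x \<notin> V" "lbracket L y x - lscale L c x \<in> V"
      using eigenvector_modulo[OF subW' _ B(1) V(1) VsW', of "lbracket L y"] KV[OF yK] by blast
    have "\<exists>d. lbracket L z x - lscale L d x \<in> V" if z: "z \<in> K" for z
    proof -
      define e where "e = coord h m z k"
      define z' where "z' = z - lscale L e y"
      have "z' \<in> K" unfolding z'_def using z yK K(1) by (simp add: subspace_diff subspace_scale)
      moreover have "coord h m z' k = 0"
        unfolding z'_def using z yK h(3,4) K(1) coord_base[OF h(3) km km]
        by (simp add: coord_diff coord_scale subspace_scale e_def y_def)
      ultimately have z': "z' \<in> K'" by (simp add: K'_def)
      have C: "x \<in> lcarrier L" "z' \<in> lcarrier L" using x(1) W'C(1) \<open>z' \<in> K\<close> K(2) by auto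
      have "z = z' + lscale L e y" by (simp add: z'_def)
      then have "lbracket L z x - lscale L (\<mu> z' + e * c) x
          = (lbracket L z' x - lscale L (\<mu> z') x) + lscale L e (lbracket L y x - lscale L c x)"
        using C yC by (simp add: bracket_add_left bracket_scale_left scale_left_distrib scale_right_diff_distrib)
      also have "\<dots> \<in> V"
        using x z' by (intro subspace_add[OF V(1)] subspace_scale[OF V(1)]) (auto simp: W'_def)
      finally show ?thesis by blast
    qed
    then show ?thesis using x(1,2) W'C(2) by blast
  qed
qed

end

section \<open>Weights and the nilradical\<close>

text \<open>\<open>wt z i\<close> is the diagonal entry of \<open>ad z\<close> at the
  \<open>i\<close>-th step of a flag of ideals through \<open>I\<close>. This part is separate from
  \<open>weight_basis\<close> because the rules for \<open>wt\<close> are already needed to prove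
  that the nilradical is the common kernel of the weights.\<close>

locale weight_flag = lie_algebra L for L :: "'a::ab_group_add lie" +
  fixes I :: "'a set" and f :: "nat \<Rightarrow> 'a" and n m :: nat and wt :: "'a \<Rightarrow> nat \<Rightarrow> complex"
  assumes le: "n \<le> m"
    and indep: "indep_family f m"
    and carrier: "family_span f m = lcarrier L"
    and ideal: "family_span f n = I"
    and triangular_bracket: "z \<in> lcarrier L \<Longrightarrow> triangular f m (lbracket L z) (wt z)"
begin

lemma basis_in_carrier: "i < m \<Longrightarrow> f i \<in> lcarrier L"
  using family_span_base[of i m f] carrier by simp

lemma ideal_subset: "I \<subseteq> lcarrier L"
  using family_span_mono[OF le, of f] carrier ideal by simp

lemma subspace_ideal: "subspace I"
  using ideal subspace_family_span[of f n] by simp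

lemma wt_eqI:
  "z \<in> lcarrier L \<Longrightarrow> triangular f m (lbracket L z) d \<Longrightarrow> i < m \<Longrightarrow> wt z i = d i"
  using triangular_unique[OF indep triangular_bracket] by blast

lemma wt_add:
  assumes "x \<in> lcarrier L" "y \<in> lcarrier L" "i < m"
  shows "wt (x + y) i = wt x i + wt y i"
proof (rule wt_eqI)
  show "triangular f m (lbracket L (x + y)) (\<lambda>i. wt x i + wt y i)"
    by (rule triangular_cong[OF triangular_add[OF triangular_bracket triangular_bracket]])
       (use assms basis_in_carrier in \<open>simp_all add: bracket_add_left\<close>)
qed (use assms in auto)

lemma wt_scale:
  assumes "x \<in> lcarrier L" "i < m"
  shows "wt (lscale L c x) i = c * wt x i"
proof (rule wt_eqI)
  show "triangular f m (lbracket L (lscale L c x)) (\<lambda>i. c * wt x i)"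
    by (rule triangular_cong[OF triangular_scale[OF triangular_bracket]])
       (use assms basis_in_carrier in \<open>simp_all add: bracket_scale_left\<close>)
qed (use assms in auto)

text \<open>\<open>ad [x, y]\<close> is a commutator of triangular operators, and the products of
  their diagonal entries cancel.\<close>

lemma wt_bracket:
  assumes "x \<in> lcarrier L" "y \<in> lcarrier L" "i < m"
  shows "wt (lbracket L x y) i = 0"
proof -
  note lin = linear_on_bracket[OF assms(1)] linear_on_bracket[OF assms(2)]
  have sub: "family_span f m \<subseteq> lcarrier L" using carrier by simp
  note tri = triangular_bracket[OF assms(1)] triangular_bracket[OF assms(2)]
  have c1: "triangular f m (\<lambda>v. lbracket L x (lbracket L y v)) (\<lambda>i. wt x i * wt y i)"
    by (rule triangular_comp[OF tri lin(1) carrier_subspace sub lin(2)])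
  have c2: "triangular f m (\<lambda>v. lbracket L y (lbracket L x v)) (\<lambda>i. wt y i * wt x i)"
    by (rule triangular_comp[OF tri(2,1) lin(2) carrier_subspace sub lin(1)])
  have "triangular f m (lbracket L (lbracket L x y)) (\<lambda>i. 0)"
    by (rule triangular_cong[OF triangular_add[OF c1 triangular_scale[OF c2, of "-1"]]])
       (simp_all add: bracket_derivation[OF assms(1,2) basis_in_carrier])
  then show ?thesis using wt_eqI assms by simp
qed

end

locale weight_basis = weight_flag +
  assumes bracket_carrier: "y \<in> lcarrier L \<Longrightarrow> z \<in> lcarrier L \<Longrightarrow> lbracket L y z \<in> I"
    and wt_zero_imp: "z \<in> lcarrier L \<Longrightarrow> (\<And>i. i < m \<Longrightarrow> wt z i = 0) \<Longrightarrow> z \<in> I"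
    and wt_ideal: "z \<in> I \<Longrightarrow> i < m \<Longrightarrow> wt z i = 0"
begin

lemma wt_zero: "i < m \<Longrightarrow> wt 0 i = 0"
  using wt_ideal subspace_0[OF subspace_ideal] by simp

lemma wt_lincomb:
  assumes "\<And>j. j \<in> J \<Longrightarrow> x j \<in> lcarrier L" "i < m"
  shows "wt (\<Sum>j\<in>J. lscale L (c j) (x j)) i = (\<Sum>j\<in>J. c j * wt (x j) i)"
  using assms(1)
proof (induction J rule: infinite_finite_induct)
  case (insert j J)
  then have "(\<Sum>j\<in>J. lscale L (c j) (x j)) \<in> lcarrier L"
    by (intro subspace_sum[OF carrier_subspace]) auto
  then show ?case using insert assms(2) by (simp add: wt_add wt_scale)
qed (use assms(2) in \<open>simp_all add: wt_zero\<close>)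

text \<open>All brackets lie in \<open>I\<close>, the span of the first \<open>n\<close> basis
  vectors, hence below \<open>f i\<close> as soon as \<open>n \<le> i\<close>. So only the weights
  on \<open>I\<close> can be nonzero.\<close>

lemma wt_high:
  assumes "z \<in> lcarrier L" "n \<le> i" "i < m"
  shows "wt z i = 0"
proof -
  have "triangular f m (lbracket L z) (\<lambda>j. if n \<le> j then 0 else wt z j)"
    unfolding triangular_def
  proof (intro allI impI)
    fix j assume j: "j < m"
    show "lbracket L z (f j) - lscale L (if n \<le> j then 0 else wt z j) (f j) \<in> family_span f j"
    proof (cases "n \<le> j")
      case True
      then have "lbracket L z (f j) \<in> family_span f j"
        using bracket_carrier[OF assms(1) basis_in_carrier[OF j]] ideal family_span_mono[of n j f] by blast
      then show ?thesis using True by simp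
    next
      case False
      then show ?thesis using triangular_bracket[OF assms(1)] j by (simp add: triangular_def)
    qed
  qed
  from wt_eqI[OF assms(1) this assms(3)] show ?thesis using assms(2) by simp
qed

lemma in_ideal_iff_wt: "z \<in> I \<longleftrightarrow> z \<in> lcarrier L \<and> (\<forall>i<n. wt z i = 0)"
  using wt_zero_imp[of z] wt_high[of z] wt_ideal[of z] ideal_subset le
  by (meson less_le_trans not_le subsetD)

lemma dim_carrier: "lie_dim L = m"
  using dim_family_span[OF indep] carrier by (simp add: lie_dim_def)

lemma indep_ideal: "indep_family f n"
  using indep_family_mono[OF indep le] .

end

context lie_algebra
begin

text \<open>Lie's theorem builds the flag in two stages, first inside \<open>I\<close> and then from
  \<open>I\<close> up to the whole algebra, so that \<open>I\<close> becomes one of its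
  members.\<close>

lemma ex_ideal_flag:
  assumes solv: "lie_solvable L" and I: "lie_ideal L I"
  shows "\<exists>f n m. n \<le> m \<and> indep_family f m \<and> family_span f m = lcarrier L \<and> family_span f n = I \<and>
    (\<forall>i<m. \<forall>z\<in>lcarrier L. \<exists>c. lbracket L z (f i) - lscale L c (f i) \<in> family_span f i)"
proof -
  obtain B where B: "finite B" "lcarrier L \<subseteq> span B" using carrier_in_span by blast
  have I: "I \<subseteq> lcarrier L" "subspace I" "\<And>z v. z \<in> lcarrier L \<Longrightarrow> v \<in> I \<Longrightarrow> lbracket L z v \<in> I"
    using I by (auto simp: lie_ideal_def)
  define Q where "Q V v \<longleftrightarrow> (\<forall>z\<in>lcarrier L. \<exists>c. lbracket L z v - lscale L c v \<in> V)" for V v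
  have step: "\<exists>v\<in>W. v \<notin> family_span g k \<and> Q (family_span g k) v"
    if Qg: "\<And>i. i < k \<Longrightarrow> Q (family_span g i) (g i)" and sub: "family_span g k \<subset> W"
      and W: "subspace W" "W \<subseteq> lcarrier L" "\<And>z v. z \<in> lcarrier L \<Longrightarrow> v \<in> W \<Longrightarrow> lbracket L z v \<in> W"
    for g k W
  proof -
    \<comment> \<open>Each flag member is again an ideal, because every vector was a common
      eigenvector modulo its predecessors; this is the invariance that the next application of Lie's
      theorem needs.\<close>
    have inv: "lbracket L z v \<in> family_span g k" if z: "z \<in> lcarrier L" and v: "v \<in> family_span g k" for z v
    proof -
      have "\<forall>i<k. \<exists>c. lbracket L z (g i) - lscale L c (g i) \<in> family_span g i"
        using Qg z unfolding Q_def by simp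
      then obtain d where "\<forall>i<k. lbracket L z (g i) - lscale L (d i) (g i) \<in> family_span g i"
        by metis
      then have "triangular g k (lbracket L z) d" by (simp add: triangular_def)
      then show ?thesis
        using triangular_family_span[OF _ linear_on_bracket[OF z] carrier_subspace _ order_refl v] sub W(2)
        by blast
    qed
    show ?thesis
      unfolding Q_def
      by (rule common_eigenvector_modulo[OF solv W(1,2) subspace_family_span sub carrier_subspace])
         (use W(3) inv in auto)
  qed
  have "\<exists>f n. 0 \<le> n \<and> (\<forall>i<0. f i = 0) \<and> indep_family f n \<and> family_span f n = I \<and>
      (\<forall>i<n. Q (family_span f i) (f i))"
    by (rule flag_extend[where B = B])
       (use step[OF _ _ I(2,1,3)] I B subspace_0[OF I(2)] in \<open>auto simp: indep_family_def\<close>)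
  then obtain f n where f: "indep_family f n" "family_span f n = I" "\<forall>i<n. Q (family_span f i) (f i)"
    by blast
  have "\<exists>g m. n \<le> m \<and> (\<forall>i<n. g i = f i) \<and> indep_family g m \<and> family_span g m = lcarrier L \<and>
      (\<forall>i<m. Q (family_span g i) (g i))"
    by (rule flag_extend[where B = B])
       (use step[of _ _ "lcarrier L"] carrier_subspace f I(1) B in auto)
  then obtain g m where g: "n \<le> m" "\<forall>i<n. g i = f i" "indep_family g m" "family_span g m = lcarrier L"
      "\<forall>i<m. Q (family_span g i) (g i)"
    by blast
  have "family_span g n = I" using family_span_cong[of n g f] g(2) f(2) by simp
  then show ?thesis using g unfolding Q_def by blast
qed

text \<open>The common kernel \<open>J\<close> of the weights is an ideal because weights vanish on
  brackets, and it is nilpotent because its elements act strictly triangularly; hence it lies in the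
  nilradical. Conversely, elements of the nilradical act nilpotently on the whole algebra, which
  makes their weights zero. All brackets then lie in \<open>J\<close> and so in
  \<open>I\<close>.\<close>

lemma ex_weight_basis:
  assumes solv: "lie_solvable L" and nil: "is_nilradical L I"
  shows "\<exists>f n m wt. weight_basis L I f n m wt"
proof -
  have I: "lie_ideal L I" "lie_nilpotent (L\<lparr>lcarrier := I\<rparr>)"
    "\<And>J. lie_ideal L J \<Longrightarrow> lie_nilpotent (L\<lparr>lcarrier := J\<rparr>) \<Longrightarrow> J \<subseteq> I"
    using nil by (auto simp: is_nilradical_def)
  have Isub: "I \<subseteq> lcarrier L" using I(1) by (simp add: lie_ideal_def)
  obtain f n m where f: "n \<le> m" "indep_family f m" "family_span f m = lcarrier L" "family_span f n = I"
    "\<forall>i<m. \<forall>z\<in>lcarrier L. \<exists>c. lbracket L z (f i) - lscale L c (f i) \<in> family_span f i"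
    using ex_ideal_flag[OF solv I(1)] by blast
  define wt where "wt z i = (SOME c. lbracket L z (f i) - lscale L c (f i) \<in> family_span f i)" for z i
  have tri: "triangular f m (lbracket L z) (wt z)" if "z \<in> lcarrier L" for z
    unfolding triangular_def wt_def using f(5) that by (auto intro: someI_ex)
  interpret weight_flag L I f n m wt
    by unfold_locales (use f(1-4) tri in blast)+
  define J where "J = {z \<in> lcarrier L. \<forall>i<m. wt z i = 0}"
  have JC: "J \<subseteq> lcarrier L" by (auto simp: J_def)
  have subJ: "subspace J"
    unfolding subspace_def J_def using wt_scale[of 0 _ 0] by (auto simp: wt_add wt_scale)
  have idJ: "lie_ideal L J"
    unfolding lie_ideal_def using subJ JC wt_bracket by (auto simp: J_def)
  \<comment> \<open>Each bracket with an element of \<open>J\<close> descends at least one step of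
    the flag, so after \<open>m\<close> steps nothing is left.\<close>
  have "lower_central (L\<lparr>lcarrier := J\<rparr>) k \<subseteq> family_span f (m - k)" for k
  proof (induction k)
    case 0
    then show ?case using JC f(3) by simp
  next
    case (Suc k)
    have "lbracket L z v \<in> family_span f (m - Suc k)"
      if z: "z \<in> J" and v: "v \<in> lower_central (L\<lparr>lcarrier := J\<rparr>) k" for z v
    proof -
      have zC: "z \<in> lcarrier L" using z JC by blast
      have "triangular f m (lbracket L z) (\<lambda>_. 0)"
        by (rule triangular_cong[OF tri[OF zC]]) (use z in \<open>auto simp: J_def\<close>)
      from triangular_strict[OF this linear_on_bracket[OF zC] carrier_subspace, of v "m - k"]
      show ?thesis using v Suc f(3) by auto
    qed
    then have "{lbracket L z v | z v. z \<in> J \<and> v \<in> lower_central (L\<lparr>lcarrier := J\<rparr>) k}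
        \<subseteq> family_span f (m - Suc k)" by blast
    then show ?case by (simp add: bracket_span_def span_minimal)
  qed
  then have "lower_central (L\<lparr>lcarrier := J\<rparr>) m \<subseteq> {0}" by (metis diff_self_eq_0 family_span_0)
  moreover have "0 \<in> lower_central (L\<lparr>lcarrier := J\<rparr>) m"
    using subspace_0[OF subJ] by (cases m) (auto simp: bracket_span_def span_zero)
  ultimately have "lie_nilpotent (L\<lparr>lcarrier := J\<rparr>)" unfolding lie_nilpotent_def by blast
  then have JI: "J \<subseteq> I" using I(3) idJ by blast
  have IJ: "wt z i = 0" if z: "z \<in> I" and i: "i < m" for z i
  proof -
    have zC: "z \<in> lcarrier L" using z Isub by blast
    obtain P where P: "lower_central (L\<lparr>lcarrier := I\<rparr>) P = {0}"
      using I(2) by (auto simp: lie_nilpotent_def)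
    \<comment> \<open>One application is spent on moving from the whole algebra into
      \<open>I\<close>; only the following ones descend in the lower central series, which explains
      the shift by one.\<close>
    have low: "(lbracket L z ^^ Suc k) v \<in> lower_central (L\<lparr>lcarrier := I\<rparr>) k" if v: "v \<in> lcarrier L" for v k
    proof (induction k)
      case 0
      have "lbracket L v z \<in> I" using I(1) v z by (auto simp: lie_ideal_def)
      then have "lbracket L z v \<in> I"
        using bracket_anticomm[OF zC v] subspace_neg[of I] I(1) by (auto simp: lie_ideal_def)
      then show ?case by simp
    next
      case (Suc k)
      then show ?case using z by (auto simp: bracket_span_def intro!: span_base)
    qed
    have "triangular f m (lbracket L z ^^ Suc P) (\<lambda>i. wt z i ^ Suc P)"
      using tri[OF zC] f(3) linear_on_bracket[OF zC] by (intro triangular_funpow[OF _ _ carrier_subspace]) auto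
    moreover have "triangular f m (lbracket L z ^^ Suc P) (\<lambda>_. 0)"
      unfolding triangular_def using low[OF basis_in_carrier, of _ P] P by (auto simp: subspace_0)
    ultimately have "wt z i ^ Suc P = 0" using triangular_unique[OF f(2)] i by blast
    then show ?thesis by auto
  qed
  have CI: "lbracket L x y \<in> I" if "x \<in> lcarrier L" "y \<in> lcarrier L" for x y
    using that wt_bracket JI by (auto simp: J_def)
  have zero: "z \<in> I" if "z \<in> lcarrier L" "\<And>i. i < m \<Longrightarrow> wt z i = 0" for z
    using that JI unfolding J_def by blast
  have "weight_basis L I f n m wt"
    by unfold_locales (use f CI tri zero IJ in auto)
  then show ?thesis by blast
qed

end

section \<open>A basis adapted to a generic element\<close>

context complex_space
begin

lemma indep_family_SucI:
  assumes "indep_family e k" "family_span e k = family_span f k" "f k \<notin> family_span f k"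
    "f k - e k \<in> family_span f k"
  shows "indep_family e (Suc k)"
proof -
  have "e k \<notin> family_span f k"
  proof
    assume "e k \<in> family_span f k"
    then have "(f k - e k) + e k \<in> family_span f k"
      by (rule subspace_add[OF subspace_family_span assms(4)])
    then show False using assms(3) by simp
  qed
  then show ?thesis using assms(1,2) by (simp add: indep_family_Suc)
qed

lemma family_span_Suc_eqI:
  assumes "family_span e k = family_span f k" "f k - e k \<in> family_span f k"
  shows "family_span e (Suc k) = family_span f (Suc k)"
  unfolding family_span_Suc assms(1)
proof (intro Collect_cong ex_cong1 iffI)
  fix v c
  have d: "scale c (f k - e k) \<in> family_span f k" by (rule subspace_scale[OF subspace_family_span assms(2)])
  show "v - scale c (f k) \<in> family_span f k" if "v - scale c (e k) \<in> family_span f k"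
    using subspace_diff[OF subspace_family_span that d] by (simp add: scale_right_diff_distrib)
  show "v - scale c (e k) \<in> family_span f k" if "v - scale c (f k) \<in> family_span f k"
    using subspace_add[OF subspace_family_span that d] by (simp add: scale_right_diff_distrib)
qed

text \<open>A triangular operator becomes block diagonal, with one block per diagonal value, by a
  unitriangular change of basis. The flag is preserved, so that other operators triangular in
  \<open>f\<close> can be compared in the new basis.\<close>

lemma adapt_basis_to_operator:
  assumes ind: "indep_family f m" and tri: "triangular f m A d"
    and lin: "linear_on V A" "subspace V" "family_span f m \<subseteq> V"
  shows "\<exists>e. indep_family e m \<and> (\<forall>i\<le>m. family_span e i = family_span f i) \<and>
    (\<forall>i<m. f i - e i \<in> family_span f i) \<and>
    (\<forall>i<m. A (e i) - scale (d i) (e i) \<in> span (e ` {l. l < i \<and> d l = d i}))"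
  using ind tri lin(3)
proof (induction m)
  case 0
  show ?case by (simp add: indep_family_def)
next
  case (Suc k)
  have fk: "f k \<notin> family_span f k" using indep_familyD[OF Suc.prems(1), of k] by simp
  have "indep_family f k" "triangular f k A d" "family_span f k \<subseteq> V"
    using Suc.prems indep_family_mono[of f "Suc k" k] family_span_mono[of k "Suc k" f]
    by (auto simp: triangular_def)
  then obtain e0 where e0: "indep_family e0 k" "\<forall>i\<le>k. family_span e0 i = family_span f i"
    "\<forall>i<k. f i - e0 i \<in> family_span f i"
    "\<forall>i<k. A (e0 i) - scale (d i) (e0 i) \<in> span (e0 ` {l. l < i \<and> d l = d i})"
    using Suc.IH by blast
  let ?U = "family_span e0 k" and ?S = "span (e0 ` {l. l < k \<and> d l = d k})"
  have UV: "?U \<subseteq> V" using e0(2) \<open>family_span f k \<subseteq> V\<close> by simp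
  \<comment> \<open>\<open>X\<close> collects what is reachable from \<open>U\<close> by
    \<open>A - d k\<close>, up to earlier vectors of the same diagonal value. It contains every
    \<open>e0 j\<close>: if \<open>d j\<close> differs from \<open>d k\<close>, then
    \<open>A - d k\<close> multiplies \<open>e0 j\<close> by a nonzero scalar up to a remainder
    already in \<open>X\<close>.\<close>
  define X where "X = {w. \<exists>u\<in>?U. \<exists>w'\<in>?S. w = A u - scale (d k) u + w'}"
  have XI: "A u - scale (d k) u + w' \<in> X" if "u \<in> ?U" "w' \<in> ?S" for u w'
    unfolding X_def using that by blast
  have XE: "\<exists>u w'. u \<in> ?U \<and> w' \<in> ?S \<and> w = A u - scale (d k) u + w'" if "w \<in> X" for w
    using that unfolding X_def by blast
  have A0: "A 0 = 0" by (rule linear_on_0[OF lin(1,2)])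
  have X: "subspace X"
  proof -
    have "A 0 - scale (d k) 0 + 0 \<in> X"
      by (rule XI) (simp_all add: span_zero subspace_0)
    then have "0 \<in> X" by (simp add: A0)
    moreover have "w1 + w2 \<in> X" if w12: "w1 \<in> X" "w2 \<in> X" for w1 w2
    proof -
      obtain u1 w1' where 1: "u1 \<in> ?U" "w1' \<in> ?S" "w1 = A u1 - scale (d k) u1 + w1'"
        using XE[OF w12(1)] by blast
      obtain u2 w2' where 2: "u2 \<in> ?U" "w2' \<in> ?S" "w2 = A u2 - scale (d k) u2 + w2'"
        using XE[OF w12(2)] by blast
      have "A (u1 + u2) - scale (d k) (u1 + u2) + (w1' + w2') \<in> X"
        using 1 2 by (intro XI) (simp_all add: subspace_add span_add)
      moreover have "A (u1 + u2) = A u1 + A u2"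
        using linear_onD(2)[OF lin(1), of u1 u2] 1(1) 2(1) UV by blast
      ultimately show ?thesis unfolding 1(3) 2(3) by (simp add: scale_right_distrib algebra_simps)
    qed
    moreover have "scale c w \<in> X" if wX: "w \<in> X" for c w
    proof -
      obtain u w' where *: "u \<in> ?U" "w' \<in> ?S" "w = A u - scale (d k) u + w'"
        using XE[OF wX] by blast
      have "A (scale c u) - scale (d k) (scale c u) + scale c w' \<in> X"
        using * by (intro XI) (simp_all add: subspace_scale span_scale)
      moreover have "A (scale c u) = scale c (A u)"
        using linear_onD(3)[OF lin(1), of u c] *(1) UV by blast
      ultimately show ?thesis
        unfolding *(3) by (simp add: scale_right_distrib scale_right_diff_distrib mult.commute)
    qed
    ultimately show ?thesis by (simp add: subspace_def)
  qed
  have e0X: "e0 j \<in> X" if "j < k" for j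
    using that
  proof (induction j rule: less_induct)
    case (less j)
    show ?case
    proof (cases "d j = d k")
      case True
      then have "e0 j \<in> ?S" using less.prems by (intro span_base) auto
      then have "A 0 - scale (d k) 0 + e0 j \<in> X" by (intro XI) (simp_all add: subspace_0)
      then show ?thesis by (simp add: A0)
    next
      case False
      define r where "r = A (e0 j) - scale (d j) (e0 j)"
      have "r \<in> span (e0 ` {l. l < j \<and> d l = d j})" unfolding r_def using e0(4) less.prems by blast
      moreover have "span (e0 ` {l. l < j \<and> d l = d j}) \<subseteq> X"
        using less.IH less.prems by (intro span_minimal[OF _ X]) auto
      ultimately have r: "r \<in> X" by blast
      have "A (e0 j) - scale (d k) (e0 j) + 0 \<in> X"
        by (rule XI[OF family_span_base[OF less.prems] span_zero])
      from subspace_diff[OF X this r] have "scale (d j - d k) (e0 j) \<in> X"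
        by (simp add: r_def scale_left_diff_distrib)
      then show ?thesis by (rule subspace_scale_cancel[OF X]) (use False in simp)
    qed
  qed
  have UX: "?U \<subseteq> X" by (rule family_span_least[OF X]) (use e0X in blast)
  have "A (f k) - scale (d k) (f k) \<in> ?U"
    using Suc.prems(2) e0(2) by (simp add: triangular_def)
  then obtain u w where u: "u \<in> ?U" and w: "w \<in> ?S" "A (f k) - scale (d k) (f k) = A u - scale (d k) u + w"
    using UX XE by blast
  \<comment> \<open>Subtracting \<open>u\<close> removes from \<open>(A - d k) (f k)\<close>
    everything outside the block of \<open>d k\<close>; only \<open>w\<close> remains.\<close>
  define e where "e = e0(k := f k - u)"
  have e: "e i = e0 i" if "i < k" for i using that by (simp add: e_def)
  have ek: "e k = f k - u" by (simp add: e_def)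
  have sp: "family_span e i = family_span f i" if "i \<le> k" for i
    using family_span_cong[of i e e0] e e0(2) that by simp
  have fek: "f k - e k \<in> family_span f k" using u e0(2) ek by simp
  have "indep_family e k" using indep_family_cong[of k e e0] e e0(1) by simp
  then have "indep_family e (Suc k)" by (rule indep_family_SucI[OF _ sp fk fek]) simp
  moreover have "family_span e (Suc k) = family_span f (Suc k)"
    by (rule family_span_Suc_eqI[OF sp fek]) simp
  then have "\<forall>i\<le>Suc k. family_span e i = family_span f i" using sp by (auto simp: le_Suc_eq)
  moreover have "\<forall>i<Suc k. f i - e i \<in> family_span f i"
    using e0(3) e fek by (simp add: less_Suc_eq)
  moreover have "A (e i) - scale (d i) (e i) \<in> span (e ` {l. l < i \<and> d l = d i})" if i: "i < Suc k" for i
  proof -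
    have im: "e ` {l. l < i \<and> d l = d i} = e0 ` {l. l < i \<and> d l = d i}"
      using e i by (intro image_cong) auto
    show ?thesis
    proof (cases "i = k")
      case True
      have "f k \<in> V" using family_span_base[of k "Suc k" f] Suc.prems(3) by auto
      then have "A (f k - u) = A (f k) - A u"
        using linear_onD(2)[OF lin(1), of "f k - u" u] subspace_diff[OF lin(2), of "f k" u] u UV
        by (auto simp: algebra_simps)
      then have "A (e k) - scale (d k) (e k) = (A (f k) - scale (d k) (f k)) - (A u - scale (d k) u)"
        unfolding ek by (simp add: scale_right_diff_distrib)
      also have "\<dots> = w" unfolding w(2) by simp
      finally have "A (e k) - scale (d k) (e k) = w" .
      then show ?thesis using True w(1) im by simp
    next
      case False
      then show ?thesis using e0(4) i im e by simp
    qed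
  qed
  ultimately show ?case by (intro exI[of _ e] conjI allI impI) simp_all
qed

text \<open>If \<open>p\<close> had a component outside the block of \<kappa>, take the last index
  \<open>k\<close> where this happens: the coordinate \<open>k\<close> of
  \<open>A p - \<kappa> p\<close> would be the coordinate of \<open>p\<close> times the nonzero
  scalar \<open>d k - \<kappa>\<close>.\<close>

lemma block_diagonal_eigenspace:
  assumes ind: "indep_family e m" and lin: "linear_on (family_span e m) A"
    and A: "\<And>i. i < m \<Longrightarrow> A (e i) - scale (d i) (e i) \<in> span (e ` {l. l < i \<and> d l = d i})"
    and p: "p \<in> family_span e m"
    and ev: "A p - scale \<kappa> p \<in> span (e ` {l. l < m \<and> d l = \<kappa>})"
  shows "p \<in> span (e ` {l. l < m \<and> d l = \<kappa>})"
proof (rule ccontr)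
  have sub: "{l. l < m \<and> P l} \<subseteq> {..<m}" for P by auto
  note span_iff = in_span_image_iff_coord[OF ind sub]
  define K where "K = {k. k < m \<and> d k \<noteq> \<kappa> \<and> coord e m p k \<noteq> 0}"
  assume "p \<notin> span (e ` {l. l < m \<and> d l = \<kappa>})"
  then have "K \<noteq> {}" using span_iff p unfolding K_def by auto
  have "finite K" unfolding K_def by simp
  define k where "k = Max K"
  have "k \<in> K" unfolding k_def using \<open>finite K\<close> \<open>K \<noteq> {}\<close> by simp
  then have k: "k < m" "d k \<noteq> \<kappa>" "coord e m p k \<noteq> 0" by (auto simp: K_def)
  have above: "l \<notin> K" if "k < l" for l
    using Max_ge[OF \<open>finite K\<close>, of l] that unfolding k_def by auto
  \<comment> \<open>Coordinate \<open>k\<close> receives contributions only from \<open>e k\<close>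
    itself and from later vectors with the same diagonal value; for the latter the coordinate of
    \<open>p\<close> is zero by maximality of \<open>k\<close>.\<close>
  have Ae: "coord e m (A (e l)) k = (if l = k then d k else 0)"
    if l: "l < m" "\<not> (k < l \<and> d l = d k)" for l
  proof -
    let ?r = "A (e l) - scale (d l) (e l)"
    have eC: "e l \<in> family_span e m" using family_span_base[OF l(1)] .
    have "{i. i < l \<and> d i = d l} \<subseteq> {..<m}" using l(1) by auto
    then have r: "?r \<in> family_span e m" "coord e m ?r k = 0"
      using in_span_image_iff_coord[OF ind, of "{i. i < l \<and> d i = d l}" ?r] A[OF l(1)] k(1) l(2) by auto
    have "coord e m (A (e l)) k = coord e m (?r + scale (d l) (e l)) k" by simp
    also have "\<dots> = d l * (if l = k then 1 else 0)"
      using r eC ind l(1) k(1) subspace_scale[OF subspace_family_span eC]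
      by (simp only: coord_add coord_scale coord_base) simp
    finally show ?thesis by simp
  qed
  have "coord e m (A p) k = (\<Sum>j<m. coord e m p j * coord e m (A (e j)) k)"
    by (rule coord_linear[OF ind ind refl lin p])
  also have "\<dots> = (\<Sum>j<m. coord e m p j * (if j = k then d k else 0))"
  proof (rule sum.cong[OF refl])
    fix j assume "j \<in> {..<m}"
    then have j: "j < m" by simp
    show "coord e m p j * coord e m (A (e j)) k = coord e m p j * (if j = k then d k else 0)"
    proof (cases "k < j \<and> d j = d k")
      case True
      then have "coord e m p j = 0" using above[of j] j k(2) by (auto simp: K_def)
      then show ?thesis by simp
    next
      case False
      then show ?thesis using Ae[OF j] by simp
    qed
  qed
  also have "\<dots> = (\<Sum>j<m. if j = k then coord e m p j * d k else 0)" by (intro sum.cong) auto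
  also have "\<dots> = coord e m p k * d k" using k(1) by simp
  finally have "coord e m (A p - scale \<kappa> p) k = coord e m p k * (d k - \<kappa>)"
    using ind p linear_onD(1)[OF lin p] subspace_scale[OF subspace_family_span p]
    by (simp add: coord_diff coord_scale algebra_simps)
  moreover have "coord e m (A p - scale \<kappa> p) k = 0" using span_iff ev k(1,2) by auto
  ultimately show False using k(2,3) by simp
qed

end

context weight_basis
begin

text \<open>The differences between two weights, and between a weight and a sum of two, are finitely
  many functionals. Those that are not identically zero can be made nonzero at one common
  \<open>x\<close>, so a relation that holds at \<open>x\<close> is no accident.\<close>

lemma ex_generic:
  "\<exists>x\<in>lcarrier L. (\<forall>i<m. \<forall>j<m. wt x i = wt x j \<longrightarrow> (\<forall>z\<in>lcarrier L. wt z i = wt z j)) \<and>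
     (\<forall>i<m. \<forall>j<m. \<forall>k<m. wt x k = wt x i + wt x j \<longrightarrow> (\<forall>z\<in>lcarrier L. wt z k = wt z i + wt z j))"
proof -
  define \<Phi> where "\<Phi> = (\<lambda>(i, j) z. wt z i - wt z j) ` ({..<m} \<times> {..<m}) \<union>
    (\<lambda>(i, j, k) z. wt z k - (wt z i + wt z j)) ` ({..<m} \<times> {..<m} \<times> {..<m})"
  define F where "F = {\<phi> \<in> \<Phi>. \<exists>z\<in>lcarrier L. \<phi> z \<noteq> 0}"
  have "finite F" unfolding F_def \<Phi>_def by simp
  have lin: "\<phi> (x + y) = \<phi> x + \<phi> y" "\<phi> (lscale L c x) = c * \<phi> x"
    if "\<phi> \<in> F" "x \<in> lcarrier L" "y \<in> lcarrier L" for \<phi> x y c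
    using that unfolding F_def \<Phi>_def by (auto simp: wt_add wt_scale algebra_simps)
  have "\<exists>x\<in>lcarrier L. \<forall>\<phi>\<in>F. \<phi> x \<noteq> 0"
    by (rule ex_common_nonzero[OF carrier_subspace \<open>finite F\<close>]) (use lin in \<open>auto simp: F_def\<close>)
  then obtain x where x: "x \<in> lcarrier L" "\<forall>\<phi>\<in>F. \<phi> x \<noteq> 0" by blast
  have zero: "\<phi> z = 0" if "\<phi> \<in> \<Phi>" "\<phi> x = 0" "z \<in> lcarrier L" for \<phi> z
    using x(2) that unfolding F_def by blast
  have 1: "(\<lambda>z. wt z i - wt z j) \<in> \<Phi>" if "i < m" "j < m" for i j
    unfolding \<Phi>_def by (rule UnI1, rule image_eqI[of _ _ "(i, j)"]) (use that in simp_all)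
  have 2: "(\<lambda>z. wt z k - (wt z i + wt z j)) \<in> \<Phi>" if "i < m" "j < m" "k < m" for i j k
    unfolding \<Phi>_def by (rule UnI2, rule image_eqI[of _ _ "(i, j, k)"]) (use that in simp_all)
  have "wt z i = wt z j" if "i < m" "j < m" "wt x i = wt x j" "z \<in> lcarrier L" for i j z
    using zero[OF 1[of i j], of z] that by simp
  moreover have "wt z k = wt z i + wt z j"
    if "i < m" "j < m" "k < m" "wt x k = wt x i + wt x j" "z \<in> lcarrier L" for i j k z
    using zero[OF 2[of i j k], of z] that by simp
  ultimately show ?thesis using x(1) by (intro bexI[of _ x] conjI allI impI ballI) blast+
qed

end

locale adapted_weight_basis = weight_basis +
  fixes x
  assumes x_carrier: "x \<in> lcarrier L"
    and generic_eq: "i < m \<Longrightarrow> j < m \<Longrightarrow> wt x i = wt x j \<Longrightarrow> z \<in> lcarrier L \<Longrightarrow> wt z i = wt z j"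
    and generic_add: "i < m \<Longrightarrow> j < m \<Longrightarrow> k < m \<Longrightarrow> wt x k = wt x i + wt x j \<Longrightarrow> z \<in> lcarrier L \<Longrightarrow>
      wt z k = wt z i + wt z j"
    and adapted: "i < m \<Longrightarrow> lbracket L x (f i) - lscale L (wt x i) (f i) \<in> span (f ` {l. l < i \<and> wt x l = wt x i})"

text \<open>The new basis differs from the old one unitriangularly, so every \<open>ad z\<close>
  keeps its diagonal, and the same \<open>wt\<close> serves although the basis was adapted to
  \<open>x\<close> alone.\<close>

lemma (in weight_basis) ex_adapted: "\<exists>e x. adapted_weight_basis L I e n m wt x"
proof -
  obtain x where x: "x \<in> lcarrier L"
    "\<forall>i<m. \<forall>j<m. wt x i = wt x j \<longrightarrow> (\<forall>z\<in>lcarrier L. wt z i = wt z j)"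
    "\<forall>i<m. \<forall>j<m. \<forall>k<m. wt x k = wt x i + wt x j \<longrightarrow> (\<forall>z\<in>lcarrier L. wt z k = wt z i + wt z j)"
    using ex_generic by blast
  have sub: "family_span f m \<subseteq> lcarrier L" using carrier by simp
  obtain e where e: "indep_family e m" "\<forall>i\<le>m. family_span e i = family_span f i"
    "\<forall>i<m. f i - e i \<in> family_span f i"
    "\<forall>i<m. lbracket L x (e i) - lscale L (wt x i) (e i) \<in> span (e ` {l. l < i \<and> wt x l = wt x i})"
    using adapt_basis_to_operator[OF indep triangular_bracket linear_on_bracket carrier_subspace sub] x(1)
    by blast
  have tri: "triangular e m (lbracket L z) (wt z)" if z: "z \<in> lcarrier L" for z
    unfolding triangular_def
  proof (intro allI impI)
    fix i assume i: "i < m"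
    let ?u = "f i - e i"
    have sp: "family_span e i = family_span f i" using e(2) i by simp
    have u: "?u \<in> family_span f i" using e(3) i by simp
    have fi: "f i \<in> lcarrier L" by (rule basis_in_carrier[OF i])
    have "?u \<in> lcarrier L" using u family_span_mono[of i m f] i sub by auto
    then have eC: "e i \<in> lcarrier L" using carrier_closed(3)[OF fi, of ?u] by simp
    have "lbracket L z ?u \<in> family_span f i"
      using triangular_family_span[OF triangular_bracket[OF z] linear_on_bracket[OF z] carrier_subspace sub _ u] i
      by simp
    then have w: "lbracket L z ?u - lscale L (wt z i) ?u \<in> family_span f i"
      by (rule subspace_diff[OF subspace_family_span _ subspace_scale[OF subspace_family_span u]])
    have "lbracket L z (f i) - lscale L (wt z i) (f i) \<in> family_span f i"
      using triangular_bracket[OF z] i by (simp add: triangular_def)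
    from subspace_diff[OF subspace_family_span this w]
    show "lbracket L z (e i) - lscale L (wt z i) (e i) \<in> family_span e i"
      using z fi eC by (simp add: sp bracket_diff_right scale_right_diff_distrib)
  qed
  have "adapted_weight_basis L I e n m wt x"
  proof unfold_locales
    show "n \<le> m" by (rule le)
    show "indep_family e m" by (rule e(1))
    show "family_span e m = lcarrier L" using e(2) carrier by simp
    show "family_span e n = I" using e(2) le ideal by simp
    show "x \<in> lcarrier L" by (rule x(1))
    show "lbracket L y z \<in> I" if "y \<in> lcarrier L" "z \<in> lcarrier L" for y z
      using bracket_carrier that .
    show "triangular e m (lbracket L z) (wt z)" if "z \<in> lcarrier L" for z using tri that .
    show "z \<in> I" if "z \<in> lcarrier L" "\<And>i. i < m \<Longrightarrow> wt z i = 0" for z using wt_zero_imp that .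
    show "wt z i = 0" if "z \<in> I" "i < m" for z i using wt_ideal that .
    show "wt z i = wt z j" if "i < m" "j < m" "wt x i = wt x j" "z \<in> lcarrier L" for i j z
      using x(2) that by blast
    show "wt z k = wt z i + wt z j"
      if "i < m" "j < m" "k < m" "wt x k = wt x i + wt x j" "z \<in> lcarrier L" for i j k z
      using x(3) that by blast
    show "lbracket L x (e i) - lscale L (wt x i) (e i) \<in> span (e ` {l. l < i \<and> wt x l = wt x i})"
      if "i < m" for i using e(4) that by blast
  qed
  then show ?thesis by blast
qed

section \<open>The grading by a generic element and the diagonal derivations\<close>

context lie_algebra
begin

lemma linear_on_bracket_left: "z \<in> lcarrier L \<Longrightarrow> linear_on (lcarrier L) (\<lambda>v. lbracket L v z)"
  by (simp add: linear_on_def bracket_add_left bracket_scale_left)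

lemma bracket_sum_left:
  assumes "\<And>j. j \<in> J \<Longrightarrow> a j \<in> lcarrier L" "v \<in> lcarrier L"
  shows "lbracket L (\<Sum>j\<in>J. lscale L (c j) (a j)) v = (\<Sum>j\<in>J. lscale L (c j) (lbracket L (a j) v))"
  using linear_on_sum[OF linear_on_bracket_left[OF assms(2)] carrier_subspace] assms(1) by blast

lemma derivation_on_basis:
  assumes V: "family_span e k \<subseteq> lcarrier L"
      "\<And>u v. u \<in> family_span e k \<Longrightarrow> v \<in> family_span e k \<Longrightarrow> lbracket L u v \<in> family_span e k"
    and D: "linear_on (family_span e k) D"
    and basis: "\<And>i j. i < k \<Longrightarrow> j < k \<Longrightarrow>
      D (lbracket L (e i) (e j)) = lbracket L (D (e i)) (e j) + lbracket L (e i) (D (e j))"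
  shows "lie_derivation (L\<lparr>lcarrier := family_span e k\<rparr>) D"
proof -
  let ?V = "family_span e k"
  note Dl = linear_onD[OF D]
  have VC: "v \<in> lcarrier L" if "v \<in> ?V" for v using that V(1) by blast
  have VV: "0 \<in> ?V" "\<And>u v. u \<in> ?V \<Longrightarrow> v \<in> ?V \<Longrightarrow> u + v \<in> ?V" "\<And>c v. v \<in> ?V \<Longrightarrow> lscale L c v \<in> ?V"
    by (simp_all add: subspace_0 subspace_add subspace_scale)
  have D0: "D 0 = 0" by (rule linear_on_0[OF D subspace_family_span])
  have 1: "D (lbracket L u (e j)) = lbracket L (D u) (e j) + lbracket L u (D (e j))"
    if j: "j < k" and u: "u \<in> ?V" for u j
  proof -
    let ?X = "{u \<in> ?V. D (lbracket L u (e j)) = lbracket L (D u) (e j) + lbracket L u (D (e j))}"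
    have ej: "e j \<in> ?V" "D (e j) \<in> ?V" using family_span_base[OF j] Dl(1) by auto
    have "subspace ?X"
      unfolding subspace_def using ej VV V(2) VC Dl D0
      by (simp add: bracket_add_left bracket_scale_left scale_right_distrib add_ac)
    then have "?V \<subseteq> ?X" using basis j family_span_base by (intro family_span_least) auto
    then show ?thesis using u by blast
  qed
  have 2: "D (lbracket L u v) = lbracket L (D u) v + lbracket L u (D v)"
    if u: "u \<in> ?V" and v: "v \<in> ?V" for u v
  proof -
    let ?X = "{v \<in> ?V. D (lbracket L u v) = lbracket L (D u) v + lbracket L u (D v)}"
    have Du: "D u \<in> ?V" using u Dl(1) by auto
    have "subspace ?X"
      unfolding subspace_def using u Du VV V(2) VC Dl D0
      by (simp add: bracket_add_right bracket_scale_right scale_right_distrib add_ac)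
    then have "?V \<subseteq> ?X" using 1 u family_span_base by (intro family_span_least) auto
    then show ?thesis using v by blast
  qed
  show ?thesis unfolding lie_derivation_def using Dl 2 by simp
qed

end

context adapted_weight_basis
begin

text \<open>Generalised eigenspaces of \<open>ad x\<close> multiply by adding eigenvalues. By the
  Jacobi identity \<open>ad x - (wt x i + wt x j)\<close> sends \<open>[f i, f j]\<close> to
  \<open>[a, f j] + [f i, b]\<close>, where \<open>a\<close> and \<open>b\<close> are combinations
  of earlier basis vectors of the same weights. Induction on \<open>i + j\<close> puts both terms in
  the expected block, and \<open>block_diagonal_eigenspace\<close> transfers this to
  \<open>[f i, f j]\<close>.\<close>

lemma bracket_graded_span:
  "i < m \<Longrightarrow> j < m \<Longrightarrow> lbracket L (f i) (f j) \<in> span (f ` {l. l < m \<and> wt x l = wt x i + wt x j})"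
proof (induction "i + j" arbitrary: i j rule: less_induct)
  case less
  note ij = less.prems
  let ?\<kappa> = "wt x i + wt x j"
  let ?W = "span (f ` {l. l < m \<and> wt x l = ?\<kappa>})"
  let ?p = "lbracket L (f i) (f j)"
  have C: "f i \<in> lcarrier L" "f j \<in> lcarrier L" using basis_in_carrier ij by auto
  let ?a = "lbracket L x (f i) - lscale L (wt x i) (f i)" and ?b = "lbracket L x (f j) - lscale L (wt x j) (f j)"
  have "span (f ` {l. l < i \<and> wt x l = wt x i}) \<subseteq> {v \<in> lcarrier L. lbracket L v (f j) \<in> ?W}"
  proof (rule span_minimal)
    show "f ` {l. l < i \<and> wt x l = wt x i} \<subseteq> {v \<in> lcarrier L. lbracket L v (f j) \<in> ?W}"
    proof (rule image_subsetI)
      fix l assume "l \<in> {l. l < i \<and> wt x l = wt x i}"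
      then have l: "l < i" "wt x l = wt x i" by auto
      then show "f l \<in> {v \<in> lcarrier L. lbracket L v (f j) \<in> ?W}"
        using less.hyps[of l j] ij basis_in_carrier[of l] by simp
    qed
    show "subspace {v \<in> lcarrier L. lbracket L v (f j) \<in> ?W}"
      unfolding subspace_def using C
      by (simp add: bracket_add_left bracket_scale_left span_add span_scale span_zero)
  qed
  then have a: "lbracket L ?a (f j) \<in> ?W" using adapted[OF ij(1)] by blast
  have "span (f ` {l. l < j \<and> wt x l = wt x j}) \<subseteq> {v \<in> lcarrier L. lbracket L (f i) v \<in> ?W}"
  proof (rule span_minimal)
    show "f ` {l. l < j \<and> wt x l = wt x j} \<subseteq> {v \<in> lcarrier L. lbracket L (f i) v \<in> ?W}"
    proof (rule image_subsetI)
      fix l assume "l \<in> {l. l < j \<and> wt x l = wt x j}"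
      then have l: "l < j" "wt x l = wt x j" by auto
      then show "f l \<in> {v \<in> lcarrier L. lbracket L (f i) v \<in> ?W}"
        using less.hyps[of i l] ij basis_in_carrier[of l] by simp
    qed
    show "subspace {v \<in> lcarrier L. lbracket L (f i) v \<in> ?W}"
      unfolding subspace_def using C
      by (simp add: bracket_add_right bracket_scale_right span_add span_scale span_zero)
  qed
  then have b: "lbracket L (f i) ?b \<in> ?W" using adapted[OF ij(2)] by blast
  have "lbracket L x ?p - lscale L ?\<kappa> ?p = lbracket L ?a (f j) + lbracket L (f i) ?b"
    using bracket_derivation[OF x_carrier C] C x_carrier
    by (simp add: bracket_diff_left bracket_diff_right bracket_scale_left bracket_scale_right
        scale_left_distrib algebra_simps)
  then have ev: "lbracket L x ?p - lscale L ?\<kappa> ?p \<in> ?W" using span_add[OF a b] by simp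
  have "linear_on (family_span f m) (lbracket L x)"
    using linear_on_bracket[OF x_carrier] carrier by simp
  moreover have "?p \<in> family_span f m" using C carrier by simp
  ultimately show ?case using block_diagonal_eigenspace[OF indep _ adapted] ev by blast
qed

lemma bracket_graded:
  assumes "i < m" "j < m" "k < m" "coord f m (lbracket L (f i) (f j)) k \<noteq> 0"
  shows "wt x k = wt x i + wt x j"
proof (rule ccontr)
  have sub: "{l. l < m \<and> wt x l = wt x i + wt x j} \<subseteq> {..<m}" by auto
  assume "wt x k \<noteq> wt x i + wt x j"
  then show False
    using in_span_image_iff_coord[OF indep sub, THEN iffD1, OF bracket_graded_span] assms by blast
qed

text \<open>The diagonal part of \<open>ad z\<close> in the adapted basis; for \<open>z = x\<close>
  it is the semisimple Jordan part of \<open>ad x\<close>.\<close>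

definition weight_map :: "'a \<Rightarrow> 'a \<Rightarrow> 'a" where
  "weight_map z v = (\<Sum>k<m. lscale L (wt z k * coord f m v k) (f k))"

lemma weight_map_carrier [simp]: "weight_map z v \<in> lcarrier L"
  unfolding weight_map_def
  by (rule subspace_sum[OF carrier_subspace]) (simp add: basis_in_carrier)

lemma coord_weight_map: "k < m \<Longrightarrow> coord f m (weight_map z v) k = wt z k * coord f m v k"
  unfolding weight_map_def by (rule coord_sum_scale[OF indep])

lemma eq_by_coord:
  "u \<in> lcarrier L \<Longrightarrow> v \<in> lcarrier L \<Longrightarrow> (\<And>k. k < m \<Longrightarrow> coord f m u k = coord f m v k) \<Longrightarrow> u = v"
  using coord_eqI[OF indep] carrier by blast

lemmas coord_linear_carrier = coord_add[OF indep, unfolded carrier] coord_scale[OF indep, unfolded carrier]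

lemma linear_on_weight_map: "linear_on (lcarrier L) (weight_map z)"
  unfolding linear_on_def
  by (auto intro!: eq_by_coord simp: coord_weight_map coord_linear_carrier algebra_simps)

lemma weight_map_basis: "i < m \<Longrightarrow> weight_map z (f i) = lscale L (wt z i) (f i)"
  by (rule eq_by_coord)
     (auto simp: coord_weight_map coord_linear_carrier coord_base[OF indep] basis_in_carrier)

text \<open>Wherever a structure constant is nonzero, the weights at \<open>x\<close> add up by
  \<open>bracket_graded\<close>, and by genericity so do the weights at \<open>z\<close>. That
  additivity is the Leibniz rule for a diagonal operator.\<close>

lemma derivation_weight_map:
  assumes "z \<in> lcarrier L"
  shows "lie_derivation L (weight_map z)"
proof -
  have "lie_derivation (L\<lparr>lcarrier := family_span f m\<rparr>) (weight_map z)"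
  proof (rule derivation_on_basis)
    fix i j assume ij: "i < m" "j < m"
    have C: "f i \<in> lcarrier L" "f j \<in> lcarrier L" using basis_in_carrier ij by auto
    have "weight_map z (lbracket L (f i) (f j)) = lscale L (wt z i + wt z j) (lbracket L (f i) (f j))"
    proof (rule eq_by_coord)
      fix k assume k: "k < m"
      show "coord f m (weight_map z (lbracket L (f i) (f j))) k
          = coord f m (lscale L (wt z i + wt z j) (lbracket L (f i) (f j))) k"
      proof (cases "coord f m (lbracket L (f i) (f j)) k = 0")
        case False
        then have "wt z k = wt z i + wt z j"
          using generic_add[OF ij k bracket_graded[OF ij k False] assms] by blast
        then show ?thesis using C k by (simp add: coord_weight_map coord_linear_carrier)
      qed (use C k in \<open>simp add: coord_weight_map coord_linear_carrier\<close>)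
    qed (use C in auto)
    then show "weight_map z (lbracket L (f i) (f j))
        = lbracket L (weight_map z (f i)) (f j) + lbracket L (f i) (weight_map z (f j))"
      using C ij by (simp add: weight_map_basis bracket_scale_left bracket_scale_right scale_left_distrib)
  qed (use carrier linear_on_weight_map in auto)
  then show ?thesis by (simp add: carrier)
qed

end

section \<open>Degree components of derivations of the nilradical\<close>

context adapted_weight_basis
begin

abbreviation "idl \<equiv> L\<lparr>lcarrier := I\<rparr>"

lemma coord_ideal: "v \<in> I \<Longrightarrow> coord f m v i = coord f n v i"
  using coord_restrict[OF indep le] ideal by simp

lemma coord_ideal_high: "v \<in> I \<Longrightarrow> n \<le> i \<Longrightarrow> i < m \<Longrightarrow> coord f m v i = 0"
  using coord_lower[OF indep le] ideal by simp

lemma basis_in_ideal: "i < n \<Longrightarrow> f i \<in> I"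
  using family_span_base[of i n f] ideal by simp

lemma ideal_in_carrier: "v \<in> I \<Longrightarrow> v \<in> lcarrier L"
  using ideal_subset by blast

lemmas ideal_closed = subspace_0[OF subspace_ideal] subspace_add[OF subspace_ideal]
  subspace_diff[OF subspace_ideal] subspace_scale[OF subspace_ideal]

lemmas coord_linear_ideal = coord_add[OF indep_ideal, unfolded ideal] coord_diff[OF indep_ideal, unfolded ideal]
  coord_scale[OF indep_ideal, unfolded ideal]

lemma eq_by_coord_ideal:
  "u \<in> I \<Longrightarrow> v \<in> I \<Longrightarrow> (\<And>k. k < n \<Longrightarrow> coord f n u k = coord f n v k) \<Longrightarrow> u = v"
  using coord_eqI[OF indep_ideal] ideal by blast

lemma bracket_graded_ideal:
  assumes "i < n" "j < n" "k < n" "coord f n (lbracket L (f i) (f j)) k \<noteq> 0"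
  shows "wt x k = wt x i + wt x j"
  using bracket_graded[of i j k] assms le coord_ideal[OF bracket_carrier] basis_in_carrier by simp

lemma linear_on_ideal_of_derivation:
  "lie_derivation idl D \<Longrightarrow> linear_on I D"
  by (simp add: lie_derivation_def linear_on_def)

text \<open>The matrix entries of \<open>D\<close> are rescaled by a function of the degree of the entry for the grading
  given by \<open>x\<close>. The cases used are the projection to degree zero and the inverse of
  \<open>[weight_map x, -]\<close> on the nonzero degrees.\<close>

definition twist :: "(complex \<Rightarrow> complex) \<Rightarrow> ('a \<Rightarrow> 'a) \<Rightarrow> 'a \<Rightarrow> 'a" where
  "twist \<phi> D v = (\<Sum>k<n. lscale L (\<Sum>i<n. coord f n v i * (\<phi> (wt x k - wt x i) * coord f n (D (f i)) k)) (f k))"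

lemma twist_ideal [simp]: "twist \<phi> D v \<in> I"
  unfolding twist_def
  by (rule subspace_sum[OF subspace_ideal]) (simp add: basis_in_ideal ideal_closed)

lemma coord_twist:
  "k < n \<Longrightarrow> coord f n (twist \<phi> D v) k = (\<Sum>i<n. coord f n v i * (\<phi> (wt x k - wt x i) * coord f n (D (f i)) k))"
  unfolding twist_def by (rule coord_sum_scale[OF indep_ideal])

lemma linear_on_twist: "linear_on I (twist \<phi> D)"
  unfolding linear_on_def
  by (auto intro!: eq_by_coord_ideal
      simp: coord_twist coord_linear_ideal ideal_closed distrib_right sum.distrib sum_distrib_left mult.assoc)

lemma coord_twist_basis:
  assumes "i < n" "k < n"
  shows "coord f n (twist \<phi> D (f i)) k = \<phi> (wt x k - wt x i) * coord f n (D (f i)) k"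
proof -
  have "coord f n (twist \<phi> D (f i)) k
      = (\<Sum>j<n. if j = i then \<phi> (wt x k - wt x i) * coord f n (D (f i)) k else 0)"
    unfolding coord_twist[OF assms(2)] using assms(1)
    by (intro sum.cong) (auto simp: coord_base[OF indep_ideal])
  then show ?thesis using assms(1) by simp
qed

lemma coord_linear_sum:
  assumes "linear_on I A" "v \<in> I"
  shows "coord f n (A v) k = (\<Sum>j<n. coord f n v j * coord f n (A (f j)) k)"
  using coord_linear[OF indep_ideal indep_ideal refl, unfolded ideal, OF assms] .

lemma linear_on_ideal_bracket:
  assumes "z \<in> lcarrier L"
  shows "linear_on I (lbracket L z)" "linear_on I (\<lambda>v. lbracket L v z)"
  using assms ideal_in_carrier bracket_carrier
  by (auto intro!: linear_on_subset[OF linear_on_bracket ideal_subset]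
      linear_on_subset[OF linear_on_bracket_left ideal_subset])

text \<open>In coordinate \<open>k\<close> of the Leibniz identity at \<open>f i\<close>,
  \<open>f j\<close>, all nonzero terms use entries of \<open>D\<close> of the same degree
  \<open>wt x k - wt x i - wt x j\<close>, since structure constants respect the grading. Hence the
  whole identity is multiplied by a single value of \<phi>.\<close>

lemma derivation_twist:
  assumes D: "lie_derivation idl D"
  shows "lie_derivation idl (twist \<phi> D)"
proof -
  have Dl: "linear_on I D" by (rule linear_on_ideal_of_derivation[OF D])
  have DI: "D v \<in> I" if "v \<in> I" for v using linear_onD(1)[OF Dl that] .
  have "lie_derivation (L\<lparr>lcarrier := family_span f n\<rparr>) (twist \<phi> D)"
  proof (rule derivation_on_basis)
    fix i j assume ij: "i < n" "j < n"
    have fI: "f i \<in> I" "f j \<in> I" using ij basis_in_ideal by auto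
    have fC: "f i \<in> lcarrier L" "f j \<in> lcarrier L" using fI ideal_in_carrier by auto
    let ?br = "lbracket L (f i) (f j)"
    have brI: "?br \<in> I" using fC bracket_carrier by simp
    have tC: "twist \<phi> D v \<in> lcarrier L" for v using ideal_in_carrier by simp
    have DC: "D (f i) \<in> lcarrier L" "D (f j) \<in> lcarrier L" using DI fI ideal_in_carrier by auto
    show "twist \<phi> D ?br = lbracket L (twist \<phi> D (f i)) (f j) + lbracket L (f i) (twist \<phi> D (f j))"
    proof (rule eq_by_coord_ideal)
      fix k assume k: "k < n"
      let ?c = "\<phi> (wt x k - wt x i - wt x j)"
      have "coord f n (twist \<phi> D ?br) k = (\<Sum>l<n. ?c * (coord f n ?br l * coord f n (D (f l)) k))"
        unfolding coord_twist[OF k]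
      proof (rule sum.cong[OF refl])
        fix l assume "l \<in> {..<n}"
        then have l: "l < n" by simp
        show "coord f n ?br l * (\<phi> (wt x k - wt x l) * coord f n (D (f l)) k)
            = ?c * (coord f n ?br l * coord f n (D (f l)) k)"
          using bracket_graded_ideal[OF ij l]
          by (cases "coord f n ?br l = 0") (simp_all add: diff_diff_eq)
      qed
      also have "\<dots> = ?c * coord f n (D ?br) k"
        using coord_linear_sum[OF Dl brI] by (simp add: sum_distrib_left)
      finally have 1: "coord f n (twist \<phi> D ?br) k = ?c * coord f n (D ?br) k" .
      have "coord f n (lbracket L (twist \<phi> D (f i)) (f j)) k
          = (\<Sum>l<n. ?c * (coord f n (D (f i)) l * coord f n (lbracket L (f l) (f j)) k))"
        unfolding coord_linear_sum[OF linear_on_ideal_bracket(2)[OF fC(2)] twist_ideal]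
      proof (rule sum.cong[OF refl])
        fix l assume "l \<in> {..<n}"
        then have l: "l < n" by simp
        show "coord f n (twist \<phi> D (f i)) l * coord f n (lbracket L (f l) (f j)) k
            = ?c * (coord f n (D (f i)) l * coord f n (lbracket L (f l) (f j)) k)"
          using bracket_graded_ideal[OF l ij(2) k]
          by (cases "coord f n (lbracket L (f l) (f j)) k = 0")
             (simp_all add: coord_twist_basis[OF ij(1) l] algebra_simps)
      qed
      also have "\<dots> = ?c * coord f n (lbracket L (D (f i)) (f j)) k"
        using coord_linear_sum[OF linear_on_ideal_bracket(2)[OF fC(2)] DI[OF fI(1)]]
        by (simp add: sum_distrib_left)
      finally have 2: "coord f n (lbracket L (twist \<phi> D (f i)) (f j)) k
          = ?c * coord f n (lbracket L (D (f i)) (f j)) k" .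
      have "coord f n (lbracket L (f i) (twist \<phi> D (f j))) k
          = (\<Sum>l<n. ?c * (coord f n (D (f j)) l * coord f n (lbracket L (f i) (f l)) k))"
        unfolding coord_linear_sum[OF linear_on_ideal_bracket(1)[OF fC(1)] twist_ideal]
      proof (rule sum.cong[OF refl])
        fix l assume "l \<in> {..<n}"
        then have l: "l < n" by simp
        show "coord f n (twist \<phi> D (f j)) l * coord f n (lbracket L (f i) (f l)) k
            = ?c * (coord f n (D (f j)) l * coord f n (lbracket L (f i) (f l)) k)"
          using bracket_graded_ideal[OF ij(1) l k]
          by (cases "coord f n (lbracket L (f i) (f l)) k = 0")
             (simp_all add: coord_twist_basis[OF ij(2) l] algebra_simps)
      qed
      also have "\<dots> = ?c * coord f n (lbracket L (f i) (D (f j))) k"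
        using coord_linear_sum[OF linear_on_ideal_bracket(1)[OF fC(1)] DI[OF fI(2)]]
        by (simp add: sum_distrib_left)
      finally have 3: "coord f n (lbracket L (f i) (twist \<phi> D (f j))) k
          = ?c * coord f n (lbracket L (f i) (D (f j))) k" .
      have "D ?br = lbracket L (D (f i)) (f j) + lbracket L (f i) (D (f j))"
        using D fI by (simp add: lie_derivation_def)
      then show "coord f n (twist \<phi> D ?br) k
          = coord f n (lbracket L (twist \<phi> D (f i)) (f j) + lbracket L (f i) (twist \<phi> D (f j))) k"
        using fC tC DC bracket_carrier by (simp add: 1 2 3 coord_linear_ideal distrib_left)
    qed (use fC tC bracket_carrier ideal_closed in auto)
  qed (use ideal ideal_subset bracket_carrier ideal_in_carrier linear_on_twist in auto)
  then show ?thesis by (simp add: ideal)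
qed

lemma weight_map_ideal: "v \<in> I \<Longrightarrow> weight_map z v \<in> I"
  unfolding weight_map_def
proof (rule subspace_sum[OF subspace_ideal])
  fix k assume "v \<in> I" "k \<in> {..<m}"
  then show "lscale L (wt z k * coord f m v k) (f k) \<in> I"
    using coord_ideal_high[of v k] basis_in_ideal[of k] by (cases "k < n") (auto simp: ideal_closed)
qed

lemma coord_weight_map_ideal:
  assumes "v \<in> I" "k < n"
  shows "coord f n (weight_map z v) k = wt z k * coord f n v k"
  using coord_weight_map[of k z v] coord_ideal[OF assms(1)] coord_ideal[OF weight_map_ideal[OF assms(1)]] assms(2) le
  by simp

lemma linear_on_weight_map_ideal: "linear_on I (weight_map z)"
  by (rule linear_on_subset[OF linear_on_weight_map ideal_subset weight_map_ideal])

lemma eq_on_basis: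
  assumes "linear_on I A" "linear_on I B" "\<And>i. i < n \<Longrightarrow> A (f i) = B (f i)" "v \<in> I"
  shows "A v = B v"
  using assms coord_linear_sum[OF assms(1,4)] coord_linear_sum[OF assms(2,4)] linear_onD(1)
  by (intro eq_by_coord_ideal) auto

text \<open>Entries of degree zero connect only basis vectors of equal weight at \<open>x\<close>,
  and by genericity these have equal weight at every \<open>z\<close>.\<close>

lemma weight_map_twist_commute:
  assumes z: "z \<in> lcarrier L" and D: "lie_derivation idl D" and v: "v \<in> I"
  shows "weight_map z (twist (\<lambda>c. if c = 0 then 1 else 0) D v)
    = twist (\<lambda>c. if c = 0 then 1 else 0) D (weight_map z v)"
proof (rule eq_on_basis[OF linear_on_comp[OF linear_on_weight_map_ideal linear_on_twist]
      linear_on_comp[OF linear_on_twist linear_on_weight_map_ideal] _ v])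
  let ?T = "twist (\<lambda>c. if c = 0 then 1 else 0) D"
  fix i assume i: "i < n"
  have fI: "f i \<in> I" using basis_in_ideal[OF i] .
  have im: "i < m" using i le by simp
  have "?T (weight_map z (f i)) = lscale L (wt z i) (?T (f i))"
    using linear_onD(3)[OF linear_on_twist fI] by (simp add: weight_map_basis[OF im])
  moreover have "weight_map z (?T (f i)) = lscale L (wt z i) (?T (f i))"
  proof (rule eq_by_coord_ideal)
    fix k assume k: "k < n"
    then have "wt x k = wt x i \<Longrightarrow> wt z k = wt z i" using generic_eq[of k i] im le z by simp
    then show "coord f n (weight_map z (?T (f i))) k = coord f n (lscale L (wt z i) (?T (f i))) k"
      using k i by (simp add: coord_weight_map_ideal coord_linear_ideal coord_twist_basis)
  qed (simp_all add: weight_map_ideal ideal_closed)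
  ultimately show "weight_map z (?T (f i)) = ?T (weight_map z (f i))" by simp
qed

text \<open>Commuting with \<open>weight_map x\<close> multiplies an entry of degree
  \<open>c\<close> by \<open>c\<close>, so \<open>twist inverse D\<close> restores every entry of
  nonzero degree. The convention \<open>inverse 0 = 0\<close> makes the commutator vanish in degree
  zero, where the first summand takes over.\<close>

lemma derivation_decomposition:
  assumes D: "lie_derivation idl D" and v: "v \<in> I"
  shows "D v = twist (\<lambda>c. if c = 0 then 1 else 0) D v
    + (weight_map x (twist inverse D v) - twist inverse D (weight_map x v))"
proof -
  let ?T = "twist (\<lambda>c. if c = 0 then 1 else 0) D" and ?E = "twist inverse D" and ?t = "weight_map x"
  have Dl: "linear_on I D" by (rule linear_on_ideal_of_derivation[OF D])
  have lE: "linear_on I (\<lambda>v. ?t (?E v) - ?E (?t v))"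
    by (rule linear_on_diff[OF linear_on_comp[OF linear_on_weight_map_ideal linear_on_twist]
          linear_on_comp[OF linear_on_twist linear_on_weight_map_ideal] subspace_ideal])
  have "D v - ?T v = ?t (?E v) - ?E (?t v)"
  proof (rule eq_on_basis[OF linear_on_diff[OF Dl linear_on_twist subspace_ideal] lE _ v])
    fix i assume i: "i < n"
    have fI: "f i \<in> I" "D (f i) \<in> I" using basis_in_ideal[OF i] linear_onD(1)[OF Dl] by auto
    have im: "i < m" using i le by simp
    have Et: "?E (?t (f i)) = lscale L (wt x i) (?E (f i))"
      using linear_onD(3)[OF linear_on_twist fI(1)] by (simp add: weight_map_basis[OF im])
    show "D (f i) - ?T (f i) = ?t (?E (f i)) - ?E (?t (f i))"
      unfolding Et
    proof (rule eq_by_coord_ideal)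
      fix k assume k: "k < n"
      show "coord f n (D (f i) - ?T (f i)) k = coord f n (?t (?E (f i)) - lscale L (wt x i) (?E (f i))) k"
        using k i fI
        by (simp add: coord_linear_ideal ideal_closed weight_map_ideal coord_weight_map_ideal
            coord_twist_basis field_simps)
    qed (use fI in \<open>simp_all add: weight_map_ideal ideal_closed\<close>)
  qed
  then show ?thesis by (simp add: algebra_simps)
qed

end

section \<open>Algebras all of whose derivations are inner\<close>

locale complete_weight_basis = adapted_weight_basis +
  assumes complete: "lie_derivation L D \<Longrightarrow> inner_derivation L D"
begin

text \<open>Such an element is determined only up to the centre, so the choice need not depend
  linearly on \<open>z\<close>.\<close>

definition torus :: "'a \<Rightarrow> 'a" where
  "torus z = (SOME a. a \<in> lcarrier L \<and> (\<forall>v\<in>lcarrier L. weight_map z v = lbracket L a v))"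

lemma torus:
  assumes "z \<in> lcarrier L"
  shows "torus z \<in> lcarrier L" "v \<in> lcarrier L \<Longrightarrow> lbracket L (torus z) v = weight_map z v"
proof -
  have "\<exists>a. a \<in> lcarrier L \<and> (\<forall>v\<in>lcarrier L. weight_map z v = lbracket L a v)"
    using complete[OF derivation_weight_map[OF assms]] unfolding inner_derivation_def by blast
  from someI_ex[OF this] show "torus z \<in> lcarrier L"
    "v \<in> lcarrier L \<Longrightarrow> lbracket L (torus z) v = weight_map z v"
    unfolding torus_def by auto
qed

lemma weight_map_comm:
  "v \<in> lcarrier L \<Longrightarrow> weight_map z (weight_map w v) = weight_map w (weight_map z v)"
  by (rule eq_by_coord) (simp_all add: coord_weight_map)

text \<open>The bracket \<open>u\<close> of two torus elements is central, so \<open>weight_map z\<close>, a diagonal operator, has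
  square zero on \<open>torus w\<close> and kills it.\<close>

lemma torus_commute:
  assumes z: "z \<in> lcarrier L" and w: "w \<in> lcarrier L"
  shows "lbracket L (torus z) (torus w) = 0"
proof -
  note T = torus(1)[OF z] torus(1)[OF w]
  let ?u = "lbracket L (torus z) (torus w)"
  have u: "?u = weight_map z (torus w)" using torus(2)[OF z T(2)] .
  have central: "lbracket L ?u v = 0" if v: "v \<in> lcarrier L" for v
  proof -
    have "lbracket L (torus z) (lbracket L (torus w) v) = weight_map z (weight_map w v)"
      "lbracket L (torus w) (lbracket L (torus z) v) = weight_map w (weight_map z v)"
      using torus(2)[OF z] torus(2)[OF w] v by simp_all
    then show ?thesis
      using bracket_derivation[OF T(1,2) v] weight_map_comm[OF v, of z w] by simp
  qed
  have "weight_map z (weight_map z (torus w)) = lbracket L (torus z) ?u"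
    unfolding u using torus(2)[OF z weight_map_carrier] by (rule sym)
  also have "\<dots> = 0" using central[OF T(1)] bracket_anticomm[of "torus z" ?u] T by simp
  finally have "weight_map z (weight_map z (torus w)) = 0" .
  then have sq: "wt z k * (wt z k * coord f m (torus w) k) = 0" if "k < m" for k
    using that coord_weight_map[of k z] by (metis coord_zero)
  show ?thesis
    unfolding u by (rule eq_by_coord) (use sq in \<open>auto simp: coord_weight_map\<close>)
qed

lemma wt_torus:
  assumes z: "z \<in> lcarrier L" and i: "i < m"
  shows "wt (torus z) i = wt z i"
proof (rule wt_eqI[OF torus(1)[OF z] _ i])
  show "triangular f m (lbracket L (torus z)) (wt z)"
    using torus(2)[OF z] basis_in_carrier
    by (simp add: triangular_def weight_map_basis subspace_0)
qed

text \<open>Both elements have the same weights, and the ideal is the common kernel of the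
  weights.\<close>

lemma diff_torus_ideal:
  assumes "z \<in> lcarrier L"
  shows "z - torus z \<in> I"
proof (rule wt_zero_imp)
  fix i assume i: "i < m"
  have "wt (z - torus z + torus z) i = wt (z - torus z) i + wt (torus z) i"
    using assms torus(1)[OF assms] i by (intro wt_add) auto
  then show "wt (z - torus z) i = 0" using wt_torus[OF assms i] by simp
qed (use assms torus in auto)

text \<open>A linear projection with kernel \<open>I\<close> onto an abelian complement. It uses the
  values of \<open>torus\<close> on basis vectors only, because \<open>torus\<close> itself need not
  be linear.\<close>

definition torus_part :: "'a \<Rightarrow> 'a" where
  "torus_part v = (\<Sum>j\<in>{n..<m}. lscale L (coord f m v j) (torus (f j)))"

lemma torus_basis: "j < m \<Longrightarrow> torus (f j) \<in> lcarrier L"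
  using torus(1) basis_in_carrier by simp

lemma torus_part_carrier [simp]: "torus_part v \<in> lcarrier L"
  unfolding torus_part_def by (rule subspace_sum[OF carrier_subspace]) (simp add: torus_basis)

lemma linear_on_torus_part: "linear_on (lcarrier L) torus_part"
proof -
  have "torus_part (u + v) = torus_part u + torus_part v" if "u \<in> lcarrier L" "v \<in> lcarrier L" for u v
    using that by (simp add: torus_part_def coord_linear_carrier scale_left_distrib sum.distrib)
  moreover have "torus_part (lscale L c v) = lscale L c (torus_part v)" if "v \<in> lcarrier L" for c v
    using that by (simp add: torus_part_def coord_linear_carrier scale_sum_right)
  ultimately show ?thesis by (simp add: linear_on_def)
qed

lemma torus_part_ideal: "v \<in> I \<Longrightarrow> torus_part v = 0"
  unfolding torus_part_def by (intro sum.neutral) (simp add: coord_ideal_high)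

lemma diff_torus_part_ideal:
  assumes "v \<in> lcarrier L"
  shows "v - torus_part v \<in> I"
proof -
  have "v = (\<Sum>j<m. lscale L (coord f m v j) (f j))" using sum_coord[OF indep] assms carrier by simp
  also have "\<dots> = (\<Sum>j<n. lscale L (coord f m v j) (f j)) + (\<Sum>j\<in>{n..<m}. lscale L (coord f m v j) (f j))"
    using le by (subst sum.union_disjoint[symmetric]) (auto intro!: sum.cong)
  finally have "v - torus_part v = (\<Sum>j<n. lscale L (coord f m v j) (f j))
      + (\<Sum>j\<in>{n..<m}. lscale L (coord f m v j) (f j - torus (f j)))"
    by (simp add: torus_part_def scale_right_diff_distrib sum_subtractf)
  also have "\<dots> \<in> I"
    using diff_torus_ideal basis_in_carrier
    by (intro ideal_closed(2) subspace_sum[OF subspace_ideal]) (auto simp: ideal_closed(4) basis_in_ideal)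
  finally show ?thesis .
qed

lemma torus_part_commute: "lbracket L (torus_part u) (torus_part v) = 0"
proof -
  have "lbracket L (torus (f i)) (torus_part v) = 0" if i: "i < m" for i
    unfolding torus_part_def
    using linear_on_sum[OF linear_on_bracket[OF torus_basis[OF i]] carrier_subspace, of "{n..<m}" "\<lambda>j. torus (f j)"]
      torus_commute basis_in_carrier i by (simp add: torus_basis)
  then show ?thesis
    unfolding torus_part_def[of u]
    using bracket_sum_left[of "{n..<m}" "\<lambda>j. torus (f j)" "torus_part v"] by (simp add: torus_basis)
qed

text \<open>On \<open>I\<close> the complement acts by linear combinations of the maps
  \<open>weight_map (f j)\<close>, each of which commutes with the degree-zero part of
  \<open>D\<close>.\<close>

lemma degree_zero_commute:
  assumes D: "lie_derivation idl D" and v: "v \<in> I"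
  defines "T \<equiv> twist (\<lambda>c. if c = 0 then 1 else 0) D"
  shows "T (lbracket L (torus_part u) v) = lbracket L (torus_part u) (T v)"
proof -
  have TI: "T v \<in> I" for v by (simp add: T_def)
  have ad: "lbracket L (torus_part u) w = (\<Sum>j\<in>{n..<m}. lscale L (coord f m u j) (weight_map (f j) w))"
    if "w \<in> I" for w
    unfolding torus_part_def
    using bracket_sum_left[of "{n..<m}" "\<lambda>j. torus (f j)" w] that torus basis_in_carrier ideal_in_carrier
    by simp
  have "T (lbracket L (torus_part u) v) = (\<Sum>j\<in>{n..<m}. lscale L (coord f m u j) (T (weight_map (f j) v)))"
    unfolding ad[OF v] unfolding T_def
    by (rule linear_on_sum[OF linear_on_twist subspace_ideal weight_map_ideal[OF v]])
  also have "\<dots> = (\<Sum>j\<in>{n..<m}. lscale L (coord f m u j) (weight_map (f j) (T v)))"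
    using weight_map_twist_commute[OF basis_in_carrier D v] by (intro sum.cong) (auto simp: T_def)
  finally show ?thesis using ad[OF TI] by simp
qed

lemma degree_zero_inner:
  assumes D: "lie_derivation idl D"
  defines "T \<equiv> twist (\<lambda>c. if c = 0 then 1 else 0) D"
  shows "\<exists>a\<in>lcarrier L. \<forall>v\<in>I. T v = lbracket L a v"
proof -
  have Tl: "linear_on I T" unfolding T_def by (rule linear_on_twist)
  have TI: "T v \<in> I" "T v \<in> lcarrier L" for v by (simp_all add: T_def ideal_in_carrier)
  have Tder: "T (lbracket L p q) = lbracket L (T p) q + lbracket L p (T q)" if "p \<in> I" "q \<in> I" for p q
    using derivation_twist[OF D] that by (simp add: T_def lie_derivation_def)
  define D' where "D' v = T (v - torus_part v)" for v
  note P = diff_torus_part_ideal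
  have "D' (u + v) = D' u + D' v" if "u \<in> lcarrier L" "v \<in> lcarrier L" for u v
  proof -
    have e: "u + v - torus_part (u + v) = (u - torus_part u) + (v - torus_part v)"
      using linear_onD(2)[OF linear_on_torus_part] that by simp
    show ?thesis
      unfolding D'_def e by (rule linear_onD(2)[OF Tl P[OF that(1)] P[OF that(2)]])
  qed
  moreover have "D' (lscale L c v) = lscale L c (D' v)" if "v \<in> lcarrier L" for c v
  proof -
    have e: "lscale L c v - torus_part (lscale L c v) = lscale L c (v - torus_part v)"
      using linear_onD(3)[OF linear_on_torus_part] that by (simp add: scale_right_diff_distrib)
    show ?thesis unfolding D'_def e by (rule linear_onD(3)[OF Tl P[OF that]])
  qed
  \<comment> \<open>With \<open>u\<close> and \<open>v\<close> split along \<open>I\<close> and the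
    complement, \<open>[A, B]\<close> vanishes, \<open>[p, q]\<close> is covered by the Leibniz rule
    on \<open>I\<close>, and the mixed terms by the commutation of \<open>T\<close> with the action
    of \<open>A\<close> and \<open>B\<close>.\<close>
  moreover have "D' (lbracket L u v) = lbracket L (D' u) v + lbracket L u (D' v)"
    if uv: "u \<in> lcarrier L" "v \<in> lcarrier L" for u v
  proof -
    define A p B q where "A = torus_part u" "p = u - A" "B = torus_part v" "q = v - B"
    note defs = A_p_B_q_def
    have AB: "A \<in> lcarrier L" "B \<in> lcarrier L" "lbracket L A B = 0"
      by (simp_all add: defs torus_part_commute)
    have pq: "p \<in> I" "q \<in> I" "p \<in> lcarrier L" "q \<in> lcarrier L"
      using P uv by (auto simp: defs ideal_in_carrier)
    have uveq: "u = p + A" "v = q + B" by (simp_all add: defs)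
    have brI: "lbracket L p q \<in> I" "lbracket L A q \<in> I" "lbracket L B p \<in> I"
      using AB pq bracket_carrier by auto
    have "lbracket L u v = lbracket L p q + lbracket L A q - lbracket L B p"
      unfolding uveq using AB pq bracket_anticomm[of p B] by (simp add: bracket_add_left bracket_add_right)
    moreover have "D' (lbracket L u v) = T (lbracket L u v)"
      using torus_part_ideal bracket_carrier uv by (simp add: D'_def)
    ultimately have "D' (lbracket L u v) = T (lbracket L p q + lbracket L A q - lbracket L B p)" by simp
    also have "\<dots> = T (lbracket L p q) + T (lbracket L A q) - T (lbracket L B p)"
    proof -
      have "T (a - b) = T a - T b" if "a \<in> I" "b \<in> I" for a b
        using linear_onD(2)[OF Tl ideal_closed(3)[OF that] that(2)] by (simp add: algebra_simps)
      then show ?thesis using brI linear_onD(2)[OF Tl] ideal_closed by simp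
    qed
    also have "\<dots> = lbracket L (T p) q + lbracket L p (T q) + lbracket L A (T q) - lbracket L B (T p)"
      using Tder degree_zero_commute[OF D] pq by (simp add: T_def defs)
    also have "\<dots> = lbracket L (T p) v + lbracket L u (T q)"
      unfolding uveq using AB pq TI bracket_anticomm[of B "T p"] by (simp add: bracket_add_left bracket_add_right)
    finally show ?thesis by (simp add: D'_def defs)
  qed
  ultimately have "lie_derivation L D'"
    unfolding lie_derivation_def using TI by (simp add: D'_def)
  then obtain a where a: "a \<in> lcarrier L" "\<forall>v\<in>lcarrier L. D' v = lbracket L a v"
    using complete unfolding inner_derivation_def by blast
  have "T v = lbracket L a v" if "v \<in> I" for v
  proof -
    have "D' v = T v" using torus_part_ideal[OF that] by (simp add: D'_def)
    then show ?thesis using a(2) ideal_in_carrier[OF that] by simp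
  qed
  then show ?thesis using a(1) by blast
qed

theorem derivation_mod_inner:
  "lie_derivation idl (weight_map x) \<and> (\<forall>D. lie_derivation idl D \<longrightarrow>
     (\<exists>E. \<exists>a\<in>lcarrier L. lie_derivation idl E \<and>
       (\<forall>v\<in>I. D v = lbracket L a v + (weight_map x (E v) - E (weight_map x v)))))"
proof (intro conjI allI impI)
  show "lie_derivation idl (weight_map x)"
    using derivation_weight_map[OF x_carrier] weight_map_ideal ideal_in_carrier
    by (simp add: lie_derivation_def)
  fix D assume D: "lie_derivation idl D"
  obtain a where a: "a \<in> lcarrier L" "\<forall>v\<in>I. twist (\<lambda>c. if c = 0 then 1 else 0) D v = lbracket L a v"
    using degree_zero_inner[OF D] by blast
  then have "\<forall>v\<in>I. D v = lbracket L a v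
      + (weight_map x (twist inverse D v) - twist inverse D (weight_map x v))"
    using derivation_decomposition[OF D] by simp
  then show "\<exists>E. \<exists>a\<in>lcarrier L. lie_derivation idl E \<and>
      (\<forall>v\<in>I. D v = lbracket L a v + (weight_map x (E v) - E (weight_map x v)))"
    using derivation_twist[OF D] a(1) by blast
qed

end

section \<open>Transport to another extension of the nilradical\<close>

text \<open>The Vandermonde argument. A polynomial of degree below \<open>n\<close> that vanishes at
  all values of \<open>a\<close> other than \<open>a i0\<close> turns the sums into a nonzero
  multiple of \<open>c i0\<close>. Equal values of \<open>a\<close> cannot be told apart by power
  sums, hence the condition that \<open>c\<close> agrees on them.\<close>

lemma power_sums_zero:
  fixes a c :: "nat \<Rightarrow> complex"
  assumes sums: "\<And>k. k < n \<Longrightarrow> (\<Sum>i<n. a i ^ k * c i) = 0"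
    and c: "\<And>i j. i < n \<Longrightarrow> j < n \<Longrightarrow> a i = a j \<Longrightarrow> c i = c j"
    and i0: "i0 < n"
  shows "c i0 = 0"
proof -
  define S where "S = a ` {..<n} - {a i0}"
  define p where "p = (\<Prod>\<nu>\<in>S. [:- \<nu>, 1:])"
  have "finite S" by (simp add: S_def)
  have "S \<subset> a ` {..<n}" using i0 by (auto simp: S_def)
  then have "card S < card (a ` {..<n})" by (intro psubset_card_mono) auto
  also have "\<dots> \<le> n" using card_image_le[of "{..<n}" a] by simp
  finally have "card S < n" .
  moreover have "degree p = card S" unfolding p_def by (subst degree_prod_sum_eq) auto
  ultimately have deg: "degree p < n" by simp
  have poly_p: "poly p z = (\<Sum>k<n. coeff p k * z ^ k)" for z
  proof -
    have "poly p z = (\<Sum>k\<le>degree p. coeff p k * z ^ k)" by (rule poly_altdef)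
    also have "\<dots> = (\<Sum>k<n. coeff p k * z ^ k)"
      using deg by (intro sum.mono_neutral_left) (auto simp: coeff_eq_0)
    finally show ?thesis .
  qed
  have "(\<Sum>i<n. poly p (a i) * c i) = (\<Sum>i<n. \<Sum>k<n. coeff p k * (a i ^ k * c i))"
    unfolding poly_p by (simp add: sum_distrib_right mult.assoc)
  also have "\<dots> = (\<Sum>k<n. coeff p k * (\<Sum>i<n. a i ^ k * c i))"
    by (subst sum.swap) (simp add: sum_distrib_left)
  also have "\<dots> = 0" using sums by simp
  finally have "(\<Sum>i<n. poly p (a i) * c i) = 0" .
  moreover have "poly p (a i) * c i = (if a i = a i0 then poly p (a i0) * c i0 else 0)" if "i < n" for i
  proof (cases "a i = a i0")
    case False
    then have "a i \<in> S" using that by (simp add: S_def)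
    then have "poly p (a i) = 0" using \<open>finite S\<close> by (auto simp: p_def poly_prod)
    then show ?thesis using False by simp
  qed (use c[OF that i0] in simp)
  ultimately have "(\<Sum>i<n. if a i = a i0 then poly p (a i0) * c i0 else 0) = 0" by simp
  \<comment> \<open>Repeated values contribute with their multiplicity, which is at least one and so
    nonzero in characteristic zero.\<close>
  then have "of_nat (card {i \<in> {..<n}. a i = a i0}) * (poly p (a i0) * c i0) = 0"
    by (simp add: sum.If_cases Int_def)
  moreover have "card {i \<in> {..<n}. a i = a i0} \<noteq> 0" using i0 by auto
  moreover have "poly p (a i0) \<noteq> 0" using \<open>finite S\<close> by (auto simp: p_def poly_prod S_def)
  ultimately show "c i0 = 0" by auto
qed

lemma transport_family:
  fixes f :: "'b::ab_group_add \<Rightarrow> 'c::ab_group_add"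
  assumes s: "complex_space s1" "complex_space s2"
    and u: "complex_space.indep_family s1 u n" "complex_space.family_span s1 u n = V"
    and f: "inj_on f V" "\<And>x y. x \<in> V \<Longrightarrow> y \<in> V \<Longrightarrow> f (x + y) = f x + f y"
      "\<And>c x. x \<in> V \<Longrightarrow> f (s1 c x) = s2 c (f x)"
  shows "complex_space.indep_family s2 (\<lambda>i. f (u i)) n"
    "i \<le> n \<Longrightarrow> complex_space.family_span s2 (\<lambda>i. f (u i)) i = f ` complex_space.family_span s1 u i"
proof -
  interpret A: complex_space s1 by fact
  interpret B: complex_space s2 by fact
  have VV: "0 \<in> V" "\<And>x y. x \<in> V \<Longrightarrow> y \<in> V \<Longrightarrow> x + y \<in> V" "\<And>c x. x \<in> V \<Longrightarrow> s1 c x \<in> V"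
    using u(2) A.subspace_family_span[of u n] by (auto simp: A.subspace_def)
  have f0: "f 0 = 0" using f(3)[OF VV(1), of 0] by simp
  have sub: "A.family_span u i \<subseteq> V" if "i \<le> n" for i
    using A.family_span_mono[OF that, of u] u(2) by simp
  have span: "B.family_span (\<lambda>i. f (u i)) i = f ` A.family_span u i" if i: "i \<le> n" for i
  proof
    have "B.subspace (f ` A.family_span u i)"
      unfolding B.subspace_def
    proof (intro conjI ballI allI)
      show "0 \<in> f ` A.family_span u i"
        using f0 A.subspace_0[OF A.subspace_family_span, of u i] by (metis imageI)
      show "x + y \<in> f ` A.family_span u i" if xy: "x \<in> f ` A.family_span u i" "y \<in> f ` A.family_span u i" for x y
      proof -
        obtain x' y' where *: "x' \<in> A.family_span u i" "y' \<in> A.family_span u i" "x = f x'" "y = f y'"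
          using xy by blast
        then have "x' \<in> V" "y' \<in> V" using sub[OF i] by auto
        then have "x + y = f (x' + y')" using f(2) *(3,4) by simp
        then show ?thesis using A.subspace_add[OF A.subspace_family_span *(1,2)] by simp
      qed
      show "s2 c x \<in> f ` A.family_span u i" if x: "x \<in> f ` A.family_span u i" for c x
      proof -
        obtain x' where *: "x' \<in> A.family_span u i" "x = f x'" using x by blast
        then have "x' \<in> V" using sub[OF i] by auto
        then have "s2 c x = f (s1 c x')" using f(3) *(2) by simp
        then show ?thesis using A.subspace_scale[OF A.subspace_family_span *(1)] by simp
      qed
    qed
    then show "B.family_span (\<lambda>i. f (u i)) i \<subseteq> f ` A.family_span u i"
      by (rule B.family_span_least) (rule imageI[OF A.family_span_base])
    have "A.family_span u i \<subseteq> {v \<in> V. f v \<in> B.family_span (\<lambda>i. f (u i)) i}"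
    proof (rule A.family_span_least)
      show "A.subspace {v \<in> V. f v \<in> B.family_span (\<lambda>i. f (u i)) i}"
        unfolding A.subspace_def using VV f(2,3) f0
        by (simp add: B.subspace_0 B.subspace_add B.subspace_scale)
      fix j assume j: "j < i"
      then have "u j \<in> V" using A.family_span_base[of j n u] i u(2) by simp
      then show "u j \<in> {v \<in> V. f v \<in> B.family_span (\<lambda>i. f (u i)) i}"
        using B.family_span_base[OF j, of "\<lambda>i. f (u i)"] by simp
    qed
    then show "f ` A.family_span u i \<subseteq> B.family_span (\<lambda>i. f (u i)) i" by blast
  qed
  then show "i \<le> n \<Longrightarrow> B.family_span (\<lambda>i. f (u i)) i = f ` A.family_span u i" .
  have "f (u i) \<notin> B.family_span (\<lambda>i. f (u i)) i" if i: "i < n" for i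
  proof
    assume "f (u i) \<in> B.family_span (\<lambda>i. f (u i)) i"
    then obtain v where v: "v \<in> A.family_span u i" "f (u i) = f v" using span[of i] i by auto
    have "u i \<in> V" using A.family_span_base[OF i, of u] u(2) by simp
    moreover have "v \<in> V" using v(1) sub[of i] i by auto
    ultimately have "u i = v" using v(2) f(1) by (simp add: inj_on_eq_iff)
    then show False using v(1) A.indep_familyD[OF u(1) i] by simp
  qed
  then show "B.indep_family (\<lambda>i. f (u i)) n"
    by (simp add: B.indep_family_def B.family_span_def)
qed

lemma lie_isomorphic_common_source:
  assumes N: "lie_algebra N" and iso: "lie_isomorphic N A" "lie_isomorphic N B"
  shows "lie_isomorphic A B"
proof -
  interpret N: lie_algebra N by fact
  obtain f where f: "bij_betw f (lcarrier N) (lcarrier A)"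
    "\<forall>x\<in>lcarrier N. \<forall>y\<in>lcarrier N. f (x + y) = f x + f y"
    "\<forall>c. \<forall>x\<in>lcarrier N. f (lscale N c x) = lscale A c (f x)"
    "\<forall>x\<in>lcarrier N. \<forall>y\<in>lcarrier N. f (lbracket N x y) = lbracket A (f x) (f y)"
    using iso(1) unfolding lie_isomorphic_def by blast
  obtain g where g: "bij_betw g (lcarrier N) (lcarrier B)"
    "\<forall>x\<in>lcarrier N. \<forall>y\<in>lcarrier N. g (x + y) = g x + g y"
    "\<forall>c. \<forall>x\<in>lcarrier N. g (lscale N c x) = lscale B c (g x)"
    "\<forall>x\<in>lcarrier N. \<forall>y\<in>lcarrier N. g (lbracket N x y) = lbracket B (g x) (g y)"
    using iso(2) unfolding lie_isomorphic_def by blast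
  define h where "h = inv_into (lcarrier N) f"
  have h: "bij_betw h (lcarrier A) (lcarrier N)" unfolding h_def by (rule bij_betw_inv_into[OF f(1)])
  have hN: "h y \<in> lcarrier N" if "y \<in> lcarrier A" for y using h that by (rule bij_betwE[THEN bspec])
  have fh: "f (h y) = y" if "y \<in> lcarrier A" for y
    unfolding h_def by (rule bij_betw_inv_into_right[OF f(1) that])
  have hf: "h (f y) = y" if "y \<in> lcarrier N" for y
    unfolding h_def by (rule bij_betw_inv_into_left[OF f(1) that])
  have add: "h (x + y) = h x + h y" if "x \<in> lcarrier A" "y \<in> lcarrier A" for x y
    using hf[of "h x + h y"] f(2) hN fh that by simp
  have scl: "h (lscale A c x) = lscale N c (h x)" if "x \<in> lcarrier A" for c x
    using hf[of "lscale N c (h x)"] f(3) hN fh that by simp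
  have brk: "h (lbracket A x y) = lbracket N (h x) (h y)" if "x \<in> lcarrier A" "y \<in> lcarrier A" for x y
    using hf[of "lbracket N (h x) (h y)"] f(4) hN fh that by simp
  show ?thesis
    unfolding lie_isomorphic_def
  proof (intro exI[of _ "\<lambda>v. g (h v)"] conjI)
    show "bij_betw (\<lambda>v. g (h v)) (lcarrier A) (lcarrier B)"
      using bij_betw_trans[OF h g(1)] by (simp add: o_def)
  qed (use g hN add scl brk in auto)
qed

context weight_basis
begin

text \<open>Meant for the second extension: its action on its own nilradical is conjugated to an
  isomorphic copy \<open>P\<close>, where it can be compared with derivations coming from the first
  extension. The weights are unchanged because the flag is carried along.\<close>

lemma transported_adjoint_action:
  fixes P :: "'p::ab_group_add lie"
  assumes P: "complex_space (lscale P)" and iso: "lie_isomorphic P (L\<lparr>lcarrier := I\<rparr>)"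
    and closed: "\<And>x y. x \<in> lcarrier P \<Longrightarrow> y \<in> lcarrier P \<Longrightarrow> x + y \<in> lcarrier P"
      "\<And>c x. x \<in> lcarrier P \<Longrightarrow> lscale P c x \<in> lcarrier P"
      "\<And>x y. x \<in> lcarrier P \<Longrightarrow> y \<in> lcarrier P \<Longrightarrow> lbracket P x y \<in> lcarrier P"
  shows "\<exists>\<rho> e. complex_space.indep_family (lscale P) e n \<and> complex_space.family_span (lscale P) e n = lcarrier P \<and>
    (\<forall>z\<in>lcarrier L. lie_derivation P (\<rho> z) \<and> complex_space.triangular (lscale P) e n (\<rho> z) (wt z))"
proof -
  interpret P: complex_space "lscale P" by fact
  obtain h where h: "bij_betw h (lcarrier P) I"
    "\<forall>x\<in>lcarrier P. \<forall>y\<in>lcarrier P. h (x + y) = h x + h y"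
    "\<forall>c. \<forall>x\<in>lcarrier P. h (lscale P c x) = lscale L c (h x)"
    "\<forall>x\<in>lcarrier P. \<forall>y\<in>lcarrier P. h (lbracket P x y) = lbracket L (h x) (h y)"
    using iso unfolding lie_isomorphic_def by auto
  define k where "k = inv_into (lcarrier P) h"
  have k: "bij_betw k I (lcarrier P)" unfolding k_def by (rule bij_betw_inv_into[OF h(1)])
  have kP: "k y \<in> lcarrier P" if "y \<in> I" for y using k that by (rule bij_betwE[THEN bspec])
  have hI: "h y \<in> I" if "y \<in> lcarrier P" for y using h(1) that by (rule bij_betwE[THEN bspec])
  have hC: "h y \<in> lcarrier L" if "y \<in> lcarrier P" for y using hI[OF that] ideal_subset by blast
  have hk: "h (k y) = y" if "y \<in> I" for y
    unfolding k_def by (rule bij_betw_inv_into_right[OF h(1) that])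
  have kh: "k (h y) = y" if "y \<in> lcarrier P" for y
    unfolding k_def by (rule bij_betw_inv_into_left[OF h(1) that])
  have k_add: "k (x + y) = k x + k y" if "x \<in> I" "y \<in> I" for x y
    using kh[of "k x + k y"] h(2) kP hk closed(1) that by simp
  have k_scale: "k (lscale L c x) = lscale P c (k x)" if "x \<in> I" for c x
    using kh[of "lscale P c (k x)"] h(3) kP hk closed(2) that by simp
  have k_bracket: "k (lbracket L x y) = lbracket P (k x) (k y)" if "x \<in> I" "y \<in> I" for x y
  proof -
    have "h (lbracket P (k x) (k y)) = lbracket L x y"
      using h(4)[rule_format, OF kP[OF that(1)] kP[OF that(2)]] hk that by simp
    then show ?thesis using kh[OF closed(3)[OF kP[OF that(1)] kP[OF that(2)]]] by simp
  qed
  define e where "e i = k (f i)" for i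
  note tr = transport_family[where f = k and u = f and ?s1.0 = "lscale L" and ?s2.0 = "lscale P" and n = n and V = I,
      OF complex_space_axioms P indep_ideal ideal bij_betw_imp_inj_on[OF k]]
  have e: "P.indep_family e n" unfolding e_def by (rule tr(1)) (fact k_add k_scale)+
  have sp: "P.family_span e i = k ` family_span f i" if "i \<le> n" for i
    unfolding e_def by (rule tr(2)) (fact k_add k_scale that)+
  have eP: "P.family_span e n = lcarrier P" using sp[of n] ideal bij_betw_imp_surj_on[OF k] by simp
  define \<rho> where "\<rho> z v = k (lbracket L z (h v))" for z v
  have "lie_derivation P (\<rho> z) \<and> P.triangular e n (\<rho> z) (wt z)" if z: "z \<in> lcarrier L" for z
  proof
    have brI: "lbracket L z (h v) \<in> I" if "v \<in> lcarrier P" for v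
      using bracket_carrier[OF z hC[OF that]] .
    have "\<rho> z (lbracket P u v) = lbracket P (\<rho> z u) v + lbracket P u (\<rho> z v)"
      if uv: "u \<in> lcarrier P" "v \<in> lcarrier P" for u v
    proof -
      note C = hC[OF uv(1)] hC[OF uv(2)]
      have I: "lbracket L (lbracket L z (h u)) (h v) \<in> I" "lbracket L (h u) (lbracket L z (h v)) \<in> I"
        using bracket_carrier C z by auto
      have "\<rho> z (lbracket P u v)
          = k (lbracket L (lbracket L z (h u)) (h v) + lbracket L (h u) (lbracket L z (h v)))"
        using h(4) uv bracket_derivation[OF z C] by (simp add: \<rho>_def)
      also have "\<dots> = k (lbracket L (lbracket L z (h u)) (h v)) + k (lbracket L (h u) (lbracket L z (h v)))"
        using k_add[OF I] .
      also have "\<dots> = lbracket P (\<rho> z u) v + lbracket P u (\<rho> z v)"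
        using k_bracket[OF brI[OF uv(1)] hI[OF uv(2)]] k_bracket[OF hI[OF uv(1)] brI[OF uv(2)]] kh uv
        by (simp add: \<rho>_def)
      finally show ?thesis .
    qed
    moreover have "\<rho> z (u + v) = \<rho> z u + \<rho> z v" if "u \<in> lcarrier P" "v \<in> lcarrier P" for u v
      using that h(2) hC z k_add brI by (simp add: \<rho>_def bracket_add_right)
    moreover have "\<rho> z (lscale P c u) = lscale P c (\<rho> z u)" if "u \<in> lcarrier P" for c u
      using that h(3) hC z k_scale brI by (simp add: \<rho>_def bracket_scale_right)
    ultimately show "lie_derivation P (\<rho> z)"
      unfolding lie_derivation_def using kP brI by (simp add: \<rho>_def)
    show "P.triangular e n (\<rho> z) (wt z)"
      unfolding P.triangular_def
    proof (intro allI impI)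
      fix i assume i: "i < n"
      have fI: "f i \<in> I" using family_span_base[OF i, of f] ideal by simp
      let ?r = "lbracket L z (f i) - lscale L (wt z i) (f i)"
      have r: "?r \<in> family_span f i"
        using triangular_bracket[OF z] i le by (simp add: triangular_def)
      then have rI: "?r \<in> I" using family_span_mono[of i n f] i ideal by auto
      have sI: "lscale L (wt z i) (f i) \<in> I" by (rule subspace_scale[OF subspace_ideal fI])
      have "\<rho> z (e i) = k (?r + lscale L (wt z i) (f i))" by (simp add: \<rho>_def e_def hk[OF fI])
      also have "\<dots> = k ?r + lscale P (wt z i) (e i)"
        using k_add[OF rI sI] k_scale[OF fI] by (simp add: e_def)
      finally show "\<rho> z (e i) - lscale P (wt z i) (e i) \<in> P.family_span e i"
        using sp[of i] i r by simp
    qed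
  qed
  then show ?thesis using e eP by blast
qed

end

section \<open>Derivations of the nilradical and traces\<close>

context adapted_weight_basis
begin

lemma derivation_idealI:
  assumes "linear_on I D" "\<And>u v. u \<in> I \<Longrightarrow> v \<in> I \<Longrightarrow> D (lbracket L u v) = lbracket L (D u) v + lbracket L u (D v)"
  shows "lie_derivation idl D"
  using assms by (simp add: lie_derivation_def linear_on_def)

lemma derivation_idealD:
  assumes "lie_derivation idl D" "u \<in> I" "v \<in> I"
  shows "D (lbracket L u v) = lbracket L (D u) v + lbracket L u (D v)"
  using assms by (simp add: lie_derivation_def)

lemma derivation_cong:
  assumes "\<And>v. v \<in> I \<Longrightarrow> D v = D' v"
  shows "lie_derivation idl D \<longleftrightarrow> lie_derivation idl D'"
  unfolding lie_derivation_def using assms ideal_closed bracket_carrier ideal_in_carrier by simp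

lemma derivation_add:
  assumes "lie_derivation idl A" "lie_derivation idl B"
  shows "lie_derivation idl (\<lambda>v. A v + B v)"
proof (rule derivation_idealI)
  note l = assms[THEN linear_on_ideal_of_derivation]
  show "linear_on I (\<lambda>v. A v + B v)"
    using l by (simp add: linear_on_def ideal_closed scale_right_distrib algebra_simps)
  fix u v assume uv: "u \<in> I" "v \<in> I"
  then have "A u \<in> lcarrier L" "A v \<in> lcarrier L" "B u \<in> lcarrier L" "B v \<in> lcarrier L" "u \<in> lcarrier L" "v \<in> lcarrier L"
    using l ideal_in_carrier by (auto dest: linear_onD(1))
  then show "A (lbracket L u v) + B (lbracket L u v) = lbracket L (A u + B u) v + lbracket L u (A v + B v)"
    unfolding derivation_idealD[OF assms(1) uv] derivation_idealD[OF assms(2) uv]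
    by (simp add: bracket_add_left bracket_add_right)
qed

lemma derivation_scale:
  assumes "lie_derivation idl A"
  shows "lie_derivation idl (\<lambda>v. lscale L c (A v))"
proof (rule derivation_idealI)
  note l = assms[THEN linear_on_ideal_of_derivation]
  show "linear_on I (\<lambda>v. lscale L c (A v))"
    using l by (simp add: linear_on_def ideal_closed scale_right_distrib mult.commute)
  fix u v assume uv: "u \<in> I" "v \<in> I"
  then have "A u \<in> lcarrier L" "A v \<in> lcarrier L" "u \<in> lcarrier L" "v \<in> lcarrier L"
    using l ideal_in_carrier by (auto dest: linear_onD(1))
  then show "lscale L c (A (lbracket L u v)) = lbracket L (lscale L c (A u)) v + lbracket L u (lscale L c (A v))"
    unfolding derivation_idealD[OF assms uv]
    by (simp add: bracket_scale_left bracket_scale_right scale_right_distrib)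
qed

lemma derivation_lincomb:
  assumes "\<And>j. j \<in> J \<Longrightarrow> lie_derivation idl (D j)"
  shows "lie_derivation idl (\<lambda>v. \<Sum>j\<in>J. lscale L (c j) (D j v))"
  using assms
proof (induction J rule: infinite_finite_induct)
  case (insert j J)
  then show ?case by (simp add: derivation_add derivation_scale)
qed (simp_all add: lie_derivation_def ideal_closed ideal_in_carrier)

lemma derivation_commutator:
  assumes "lie_derivation idl A" "lie_derivation idl B"
  shows "lie_derivation idl (\<lambda>v. A (B v) - B (A v))"
proof (rule derivation_idealI)
  note l = assms[THEN linear_on_ideal_of_derivation]
  show "linear_on I (\<lambda>v. A (B v) - B (A v))"
    by (rule linear_on_diff[OF linear_on_comp[OF l] linear_on_comp[OF l(2,1)] subspace_ideal])
  fix u v assume uv: "u \<in> I" "v \<in> I"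
  note AB = linear_onD(1)[OF l(1)] linear_onD(1)[OF l(2)]
  have I: "A u \<in> I" "A v \<in> I" "B u \<in> I" "B v \<in> I" "A (B u) \<in> I" "A (B v) \<in> I" "B (A u) \<in> I" "B (A v) \<in> I"
    using AB uv by auto
  note C = I[THEN ideal_in_carrier] uv[THEN ideal_in_carrier]
  have brI: "lbracket L (B u) v \<in> I" "lbracket L u (B v) \<in> I" "lbracket L (A u) v \<in> I" "lbracket L u (A v) \<in> I"
    using C bracket_carrier by auto
  have "A (B (lbracket L u v)) = lbracket L (A (B u)) v + lbracket L (B u) (A v) + (lbracket L (A u) (B v) + lbracket L u (A (B v)))"
    unfolding derivation_idealD[OF assms(2) uv] linear_onD(2)[OF l(1) brI(1,2)]
      derivation_idealD[OF assms(1) I(3) uv(2)] derivation_idealD[OF assms(1) uv(1) I(4)] ..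
  moreover have "B (A (lbracket L u v)) = lbracket L (B (A u)) v + lbracket L (A u) (B v) + (lbracket L (B u) (A v) + lbracket L u (B (A v)))"
    unfolding derivation_idealD[OF assms(1) uv] linear_onD(2)[OF l(2) brI(3,4)]
      derivation_idealD[OF assms(2) I(1) uv(2)] derivation_idealD[OF assms(2) uv(1) I(2)] ..
  ultimately show "A (B (lbracket L u v)) - B (A (lbracket L u v))
      = lbracket L (A (B u) - B (A u)) v + lbracket L u (A (B v) - B (A v))"
    using C by (simp add: bracket_diff_left bracket_diff_right)
qed

text \<open>Derivations matter only on \<open>I\<close>, so they are normalised to vanish elsewhere;
  equality on \<open>I\<close> then becomes equality of functions. The normalised ones lie in the
  span of the matrix units \<open>U i j\<close>, which gives finite dimension.\<close>

lemma ex_derivation_basis: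
  "\<exists>d Ds. (\<forall>i<(d::nat). lie_derivation idl (Ds i)) \<and>
    (\<forall>D. lie_derivation idl D \<longrightarrow> (\<exists>c. \<forall>v\<in>I. D v = (\<Sum>i<d. lscale L (c i) (Ds i v))))"
proof -
  interpret F: complex_space "\<lambda>c (D :: 'a \<Rightarrow> 'a) v. lscale L c (D v)"
    by unfold_locales (auto simp: fun_eq_iff scale_left_distrib scale_right_distrib)
  define G where "G = {D. lie_derivation idl D \<and> (\<forall>v. v \<notin> I \<longrightarrow> D v = 0)}"
  define U where "U i j v = (if v \<in> I then lscale L (coord f n v i) (f j) else 0)" for i j v
  define B where "B = (\<lambda>(i, j). U i j) ` ({..<n} \<times> {..<n})"
  have sum_fun: "(\<Sum>i\<in>S. g i) v = (\<Sum>i\<in>S. g i v)" for S :: "'b set" and g :: "'b \<Rightarrow> 'a \<Rightarrow> 'a" and v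
    by (induction S rule: infinite_finite_induct) auto
  have "lie_derivation idl (\<lambda>v. 0)"
    by (simp add: lie_derivation_def ideal_closed ideal_in_carrier)
  then have subG: "F.subspace G"
    unfolding F.subspace_def G_def
    by (auto simp: derivation_scale plus_fun_def zero_fun_def intro: derivation_add)
  have GB: "D \<in> F.span B" if "D \<in> G" for D
  proof -
    have D: "lie_derivation idl D" "\<And>v. v \<notin> I \<Longrightarrow> D v = 0" using that by (auto simp: G_def)
    have Dl: "linear_on I D" by (rule linear_on_ideal_of_derivation[OF D(1)])
    have "D = (\<Sum>i<n. \<Sum>j<n. (\<lambda>v. lscale L (coord f n (D (f i)) j) (U i j v)))"
    proof
      fix v
      show "D v = (\<Sum>i<n. \<Sum>j<n. (\<lambda>v. lscale L (coord f n (D (f i)) j) (U i j v))) v"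
      proof (cases "v \<in> I")
        case True
        have DfI: "D (f i) \<in> I" if "i < n" for i using linear_onD(1)[OF Dl basis_in_ideal[OF that]] .
        have "D v = D (\<Sum>i<n. lscale L (coord f n v i) (f i))"
          using sum_coord[OF indep_ideal] True ideal by simp
        also have "\<dots> = (\<Sum>i<n. lscale L (coord f n v i) (D (f i)))"
          using basis_in_ideal by (intro linear_on_sum[OF Dl subspace_ideal]) auto
        also have "\<dots> = (\<Sum>i<n. lscale L (coord f n v i) (\<Sum>j<n. lscale L (coord f n (D (f i)) j) (f j)))"
          using sum_coord[OF indep_ideal] DfI ideal by (intro sum.cong) auto
        also have "\<dots> = (\<Sum>i<n. \<Sum>j<n. lscale L (coord f n (D (f i)) j) (U i j v))"
          using True by (simp add: U_def scale_sum_right mult.commute)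
        finally show ?thesis by (simp add: sum_fun)
      qed (simp add: D(2) sum_fun U_def)
    qed
    also have "\<dots> \<in> F.span B"
      by (intro F.span_sum F.span_scale F.span_base) (auto simp: B_def)
    finally show ?thesis .
  qed
  have "finite B" by (simp add: B_def)
  moreover have "G \<subseteq> F.span B" using GB by blast
  ultimately obtain Ds d where Ds: "F.indep_family Ds d" "F.family_span Ds d = G"
    using F.ex_basis_family[OF subG] by blast
  have "lie_derivation idl (Ds i)" if "i < d" for i
    using F.family_span_base[OF that, of Ds] Ds(2) by (simp add: G_def)
  moreover have "\<exists>c. \<forall>v\<in>I. D v = (\<Sum>i<d. lscale L (c i) (Ds i v))" if D: "lie_derivation idl D" for D
  proof -
    define D' where "D' v = (if v \<in> I then D v else 0)" for v
    have "lie_derivation idl D'" using D derivation_cong[of D D'] by (simp add: D'_def)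
    then have "D' \<in> F.family_span Ds d" using Ds(2) by (simp add: G_def D'_def)
    then obtain c where "D' = (\<Sum>i<d. (\<lambda>v. lscale L (c i) (Ds i v)))"
      using F.in_family_span_iff[OF Ds(1)] by blast
    then have "D' v = (\<Sum>i<d. lscale L (c i) (Ds i v))" for v by (simp add: sum_fun)
    then show ?thesis by (metis D'_def)
  qed
  ultimately show ?thesis by blast
qed

lemma subspace_lower_central: "subspace (lower_central idl k)"
  by (cases k) (simp_all add: subspace_ideal bracket_span_def)

lemma lower_central_Suc:
  "lower_central idl (Suc k) = span {lbracket L u v |u v. u \<in> I \<and> v \<in> lower_central idl k}"
  by (simp add: bracket_span_def)

lemma lower_central_decreasing: "lower_central idl (Suc k) \<subseteq> lower_central idl k"
proof (induction k)
  case 0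
  have "{lbracket L u v |u v. u \<in> I \<and> v \<in> I} \<subseteq> I" using bracket_carrier ideal_in_carrier by blast
  then show ?case using subspace_ideal by (simp add: bracket_span_def span_minimal)
next
  case (Suc k)
  then have "{lbracket L u v |u v. u \<in> I \<and> v \<in> lower_central idl (Suc k)}
      \<subseteq> {lbracket L u v |u v. u \<in> I \<and> v \<in> lower_central idl k}" by blast
  from span_mono[OF this] show ?case unfolding lower_central_Suc[symmetric] .
qed

lemma lower_central_subset: "lower_central idl k \<subseteq> I"
proof (induction k)
  case (Suc k)
  then show ?case using lower_central_decreasing[of k] by (rule order_trans[rotated])
qed simp

lemma derivation_lower_central:
  assumes D: "lie_derivation idl D"
  shows "v \<in> lower_central idl k \<Longrightarrow> D v \<in> lower_central idl k"
proof -
  note Dl = linear_on_ideal_of_derivation[OF D]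
  have "\<forall>v\<in>lower_central idl k. D v \<in> lower_central idl k"
  proof (induction k)
    case 0
    then show ?case using linear_onD(1)[OF Dl] by simp
  next
    case (Suc k)
    let ?S = "lower_central idl (Suc k)"
    note S = lower_central_Suc[of k] and sS = subspace_lower_central[of "Suc k"]
    have "{lbracket L x y |x y. x \<in> I \<and> y \<in> lower_central idl k} \<subseteq> {v \<in> I. D v \<in> ?S}"
    proof clarify
      fix x y assume xy: "x \<in> I" "y \<in> lower_central idl k"
      have y: "y \<in> I" using lower_central_subset xy(2) by blast
      have 1: "lbracket L (D x) y \<in> ?S" unfolding S using linear_onD(1)[OF Dl xy(1)] xy(2) by (intro span_base) blast
      have 2: "lbracket L x (D y) \<in> ?S" unfolding S using xy Suc by (intro span_base) blast
      show "lbracket L x y \<in> I \<and> D (lbracket L x y) \<in> ?S"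
        unfolding derivation_idealD[OF D xy(1) y]
        using subspace_add[OF sS 1 2] bracket_carrier xy(1) y ideal_in_carrier by blast
    qed
    moreover have "subspace {v \<in> I. D v \<in> ?S}"
      unfolding subspace_def using linear_onD(2,3)[OF Dl] linear_on_0[OF Dl subspace_ideal] ideal_closed
        subspace_0[OF sS] subspace_add[OF sS] subspace_scale[OF sS] by simp
    ultimately have "?S \<subseteq> {v \<in> I. D v \<in> ?S}" unfolding S by (rule span_minimal)
    then show ?case by blast
  qed
  then show "v \<in> lower_central idl k \<Longrightarrow> D v \<in> lower_central idl k" by blast
qed

text \<open>\<open>ad a\<close> moves each term of the lower central series into the next one, and
  the derivation \<open>X\<close> preserves all terms, so the composite satisfies
  \<open>trace_nilpotent_chain\<close>.\<close>

lemma trace_funpow_inner_zero: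
  assumes nil: "lie_nilpotent idl" and X: "lie_derivation idl X" and a: "a \<in> I"
  shows "trace_on f n (\<lambda>v. (X ^^ k) (lbracket L a v)) = 0"
proof -
  obtain P where P: "lower_central idl P = {0}" using nil by (auto simp: lie_nilpotent_def)
  note Xl = linear_on_ideal_of_derivation[OF X]
  note ad = linear_on_ideal_bracket(1)[OF ideal_in_carrier[OF a]]
  have ad_in: "lbracket L a v \<in> lower_central idl (Suc p)" if "v \<in> lower_central idl p" for v p
    unfolding lower_central_Suc using that a by (intro span_base) blast
  have Xk: "(X ^^ k) v \<in> lower_central idl p" if "v \<in> lower_central idl p" for v p
    by (induction k) (use that derivation_lower_central[OF X] in simp_all)
  show ?thesis
  proof (rule trace_nilpotent_chain[OF indep_ideal, of "lower_central idl" _ P])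
    show "subspace (lower_central idl p)" "lower_central idl (Suc p) \<subseteq> lower_central idl p" for p
      by (rule subspace_lower_central, rule lower_central_decreasing)
    show "linear_on (lower_central idl 0) (\<lambda>v. (X ^^ k) (lbracket L a v))"
      using linear_on_comp[OF linear_on_funpow[OF Xl] ad] by simp
    show "family_span f n = lower_central idl 0" using ideal by simp
    show "(X ^^ k) (lbracket L a v) \<in> lower_central idl (Suc p)" if "v \<in> lower_central idl p" for v p
      by (rule Xk[OF ad_in[OF that]])
  qed (rule P)
qed

text \<open>\<open>X\<close> commutes with its own powers, so the two summands differ only by a
  cyclic permutation of the factors.\<close>

lemma trace_funpow_commutator_zero:
  assumes X: "linear_on I X" and E: "linear_on I E"
  shows "trace_on f n (\<lambda>v. (X ^^ k) (X (E v) - E (X v))) = 0"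
proof -
  have Xk: "linear_on I (X ^^ k)" by (rule linear_on_funpow[OF X])
  note l = linear_onD(1)[OF X] linear_onD(1)[OF E] linear_onD(1)[OF Xk]
  have diff: "(X ^^ k) (u - v) = (X ^^ k) u - (X ^^ k) v" if "u \<in> I" "v \<in> I" for u v
    using linear_onD(2)[OF Xk ideal_closed(3)[OF that] that(2)] by (simp add: algebra_simps)
  have fI: "f i \<in> I" if "i < n" for i using basis_in_ideal[OF that] .
  have "trace_on f n (\<lambda>v. (X ^^ k) (X (E v) - E (X v)))
      = trace_on f n (\<lambda>v. (X ^^ k) (X (E v))) - trace_on f n (\<lambda>v. (X ^^ k) (E (X v)))"
    unfolding trace_on_def sum_subtractf[symmetric]
    using fI l by (intro sum.cong) (simp_all add: diff coord_linear_ideal)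
  also have "trace_on f n (\<lambda>v. (X ^^ k) (E (X v))) = trace_on f n (\<lambda>v. X ((X ^^ k) (E v)))"
    using trace_comm[OF indep_ideal, unfolded ideal, OF linear_on_comp[OF Xk E] X] .
  also have "(\<lambda>v. X ((X ^^ k) (E v))) = (\<lambda>v. (X ^^ k) (X (E v)))"
    by (simp add: fun_eq_iff funpow_swap1)
  finally show ?thesis by simp
qed

end

section \<open>Comparing two extensions on a line of derivations\<close>

context complete_weight_basis
begin

text \<open>The line through \<open>weight_map x\<close>, reached at parameter 0, and
  \<open>s\<close>, reached at parameter 1.\<close>

abbreviation "line s \<epsilon> v \<equiv> weight_map x v + lscale L \<epsilon> (s v - weight_map x v)"

lemma derivation_line:
  assumes s: "lie_derivation idl s"
  shows "lie_derivation idl (line s \<epsilon>)"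
proof -
  have "lie_derivation idl (\<lambda>v. lscale L (-1) (weight_map x v))"
    using derivation_mod_inner by (intro derivation_scale) blast
  from derivation_add[OF s this] have "lie_derivation idl (\<lambda>v. s v - weight_map x v)" by simp
  from derivation_add[OF conjunct1[OF derivation_mod_inner] derivation_scale[OF this]]
  show ?thesis .
qed

text \<open>That every derivation is a commutator with the given one up to the action of \<open>L\<close> is an open
  condition, and it holds at \<open>\<epsilon> = 0\<close>.\<close>

lemma derivation_mod_inner_cofinite:
  assumes s: "lie_derivation idl s"
  shows "finite {\<epsilon>. \<not> (\<forall>D. lie_derivation idl D \<longrightarrow> (\<exists>E. \<exists>a\<in>lcarrier L. lie_derivation idl E \<and>
    (\<forall>v\<in>I. D v = lbracket L a v + (line s \<epsilon> (E v) - E (line s \<epsilon> v)))))}"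
proof -
  let ?t = "weight_map x"
  have t: "lie_derivation idl ?t" using derivation_mod_inner by blast
  have "lie_derivation idl (\<lambda>v. s v + lscale L (-1) (?t v))"
    by (rule derivation_add[OF s derivation_scale[OF t]])
  then have st: "lie_derivation idl (\<lambda>v. s v - ?t v)" by simp
  obtain d Ds where Ds: "\<forall>i<(d::nat). lie_derivation idl (Ds i)"
    "\<forall>D. lie_derivation idl D \<longrightarrow> (\<exists>c. \<forall>v\<in>I. D v = (\<Sum>i<d. lscale L (c i) (Ds i v)))"
    using ex_derivation_basis by blast
  have "\<forall>i<d. \<exists>E. \<exists>a\<in>lcarrier L. lie_derivation idl E \<and>
      (\<forall>v\<in>I. Ds i v = lbracket L a v + (?t (E v) - E (?t v)))"
    using Ds(1) derivation_mod_inner by blast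
  then obtain E where "\<forall>i<d. \<exists>a\<in>lcarrier L. lie_derivation idl (E i) \<and>
      (\<forall>v\<in>I. Ds i v = lbracket L a v + (?t (E i v) - E i (?t v)))" by metis
  then obtain a where Ea: "\<forall>i<d. a i \<in> lcarrier L \<and> lie_derivation idl (E i) \<and>
      (\<forall>v\<in>I. Ds i v = lbracket L (a i) v + (?t (E i v) - E i (?t v)))" by metis
  \<comment> \<open>Moving away from parameter 0 changes the commutator with \<open>E i\<close> by a
    multiple of the commutator of \<open>s - weight_map x\<close> with \<open>E i\<close>. That is
    again a derivation, so it is a combination of the \<open>Ds j\<close>.\<close>
  have "\<forall>i<d. \<exists>c. \<forall>v\<in>I. (s (E i v) - ?t (E i v)) - E i (s v - ?t v) = (\<Sum>j<d. lscale L (c j) (Ds j v))"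
    using Ds(2) derivation_commutator[OF st] Ea by blast
  then obtain \<gamma> where \<gamma>: "\<forall>i<d. \<forall>v\<in>I. (s (E i v) - ?t (E i v)) - E i (s v - ?t v)
      = (\<Sum>j<d. lscale L (\<gamma> i j) (Ds j v))" by metis
  \<comment> \<open>Column \<open>i\<close> of \<open>A\<close> expresses
    \<open>ad (a i) + [line s \<epsilon>, E i]\<close> through the \<open>Ds j\<close>. At parameter
    0 this is \<open>Ds i\<close> itself and \<open>A\<close> is the identity matrix.\<close>
  define A where "A j i = [:if i = j then 1 else 0, \<gamma> i j:]" for j i
  have "nonsingular d (\<lambda>j i. poly (A j i) 0)"
  proof -
    have "(\<Sum>i<d. poly (A j i) 0 * b i) = b j" if "j < d" for b j
    proof -
      have "(\<Sum>i<d. poly (A j i) 0 * b i) = (\<Sum>i<d. if i = j then b i else 0)"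
        by (intro sum.cong) (auto simp: A_def)
      then show ?thesis using that by simp
    qed
    then show ?thesis by (simp add: nonsingular_def)
  qed
  then have fin: "finite {\<epsilon>. \<not> nonsingular d (\<lambda>j i. poly (A j i) \<epsilon>)}"
    by (rule nonsingular_poly_cofinite)
  have "\<exists>E'. \<exists>a'\<in>lcarrier L. lie_derivation idl E' \<and>
      (\<forall>v\<in>I. D v = lbracket L a' v + (line s \<epsilon> (E' v) - E' (line s \<epsilon> v)))"
    if ns: "nonsingular d (\<lambda>j i. poly (A j i) \<epsilon>)" and D: "lie_derivation idl D" for D \<epsilon>
  proof -
    obtain b where b: "\<forall>v\<in>I. D v = (\<Sum>j<d. lscale L (b j) (Ds j v))" using Ds(2) D by blast
    obtain c where c: "\<forall>j<d. (\<Sum>i<d. poly (A j i) \<epsilon> * c i) = b j"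
      using nonsingular_solve[OF ns, of b] by blast
    define E' where "E' v = (\<Sum>i<d. lscale L (c i) (E i v))" for v
    define a' where "a' = (\<Sum>i<d. lscale L (c i) (a i))"
    have E': "lie_derivation idl E'"
      unfolding E'_def using Ea by (intro derivation_lincomb) auto
    have a': "a' \<in> lcarrier L"
      unfolding a'_def using Ea by (intro subspace_sum[OF carrier_subspace]) auto
    have X: "linear_on I (line s \<epsilon>)"
      by (rule linear_on_ideal_of_derivation[OF derivation_line[OF s]])
    have "D v = lbracket L a' v + (line s \<epsilon> (E' v) - E' (line s \<epsilon> v))" if v: "v \<in> I" for v
    proof -
      have EI: "E i w \<in> I" if "i < d" "w \<in> I" for i w
        using Ea that linear_onD(1)[OF linear_on_ideal_of_derivation] by blast
      have sI: "s v \<in> I" "?t v \<in> I" "s v - ?t v \<in> I" "lscale L \<epsilon> (s v - ?t v) \<in> I"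
        using linear_onD(1)[OF linear_on_ideal_of_derivation[OF s] v] weight_map_ideal[OF v] ideal_closed by auto
      have U: "lbracket L (a i) v + (line s \<epsilon> (E i v) - E i (line s \<epsilon> v))
          = (\<Sum>j<d. lscale L (poly (A j i) \<epsilon>) (Ds j v))" if i: "i < d" for i
      proof -
        note El = linear_on_ideal_of_derivation[of "E i"]
        have "E i (line s \<epsilon> v) = E i (?t v) + lscale L \<epsilon> (E i (s v - ?t v))"
          using linear_onD(2)[OF El sI(2,4)] linear_onD(3)[OF El sI(3)] Ea i by simp
        then have "lbracket L (a i) v + (line s \<epsilon> (E i v) - E i (line s \<epsilon> v))
            = Ds i v + lscale L \<epsilon> ((s (E i v) - ?t (E i v)) - E i (s v - ?t v))"
          using Ea i v by (simp add: scale_right_diff_distrib)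
        also have "\<dots> = Ds i v + lscale L \<epsilon> (\<Sum>j<d. lscale L (\<gamma> i j) (Ds j v))" using \<gamma> i v by simp
        also have "Ds i v = (\<Sum>j<d. lscale L (if i = j then 1 else 0) (Ds j v))"
        proof -
          have "(\<Sum>j<d. lscale L (if i = j then 1 else 0) (Ds j v)) = (\<Sum>j<d. if i = j then Ds j v else 0)"
            by (intro sum.cong) auto
          then show ?thesis using i by simp
        qed
        also have "\<dots> + lscale L \<epsilon> (\<Sum>j<d. lscale L (\<gamma> i j) (Ds j v))
            = (\<Sum>j<d. lscale L (poly (A j i) \<epsilon>) (Ds j v))"
          by (simp add: A_def scale_sum_right scale_left_distrib sum.distrib)
        finally show ?thesis .
      qed
      have 1: "lbracket L a' v = (\<Sum>i<d. lscale L (c i) (lbracket L (a i) v))"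
        unfolding a'_def using Ea v ideal_in_carrier by (intro bracket_sum_left) auto
      have 2: "line s \<epsilon> (E' v) = (\<Sum>i<d. lscale L (c i) (line s \<epsilon> (E i v)))"
        unfolding E'_def using EI v by (intro linear_on_sum[OF X subspace_ideal]) auto
      have "lbracket L a' v + (line s \<epsilon> (E' v) - E' (line s \<epsilon> v))
          = (\<Sum>i<d. lscale L (c i) (lbracket L (a i) v + (line s \<epsilon> (E i v) - E i (line s \<epsilon> v))))"
        unfolding 1 2 E'_def[of "line s \<epsilon> v"]
        by (simp only: scale_right_distrib scale_right_diff_distrib sum.distrib sum_subtractf)
      also have "\<dots> = (\<Sum>i<d. \<Sum>j<d. lscale L (poly (A j i) \<epsilon> * c i) (Ds j v))"
        using U by (simp add: scale_sum_right mult.commute)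
      also have "\<dots> = (\<Sum>j<d. lscale L (\<Sum>i<d. poly (A j i) \<epsilon> * c i) (Ds j v))"
        by (subst sum.swap) (simp add: scale_sum_left)
      also have "\<dots> = D v" using c b v by simp
      finally show ?thesis by simp
    qed
    then show ?thesis using E' a' by blast
  qed
  then show ?thesis by (intro finite_subset[OF _ fin] subsetI) blast
qed

text \<open>Each further factor \<open>line s \<epsilon>\<close> multiplies by a matrix whose
  entries are affine in \<epsilon>, so coordinates of iterates are polynomials in
  \<epsilon>.\<close>

lemma trace_line_poly:
  assumes s: "lie_derivation idl s" and w: "\<And>i. i < n \<Longrightarrow> w i \<in> I"
  shows "\<exists>p. \<forall>\<epsilon>. (\<Sum>i<n. coord f n ((line s \<epsilon> ^^ k) (w i)) i) = poly p \<epsilon>"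
proof -
  have "\<exists>p. \<forall>i<n. \<forall>\<epsilon>. coord f n ((line s \<epsilon> ^^ k) v) i = poly (p i) \<epsilon>" if v: "v \<in> I" for v
  proof (induction k)
    case 0
    show ?case by (rule exI[of _ "\<lambda>i. [:coord f n v i:]"]) simp
  next
    case (Suc k)
    then obtain p where p: "\<forall>i<n. \<forall>\<epsilon>. coord f n ((line s \<epsilon> ^^ k) v) i = poly (p i) \<epsilon>" by blast
    define q where "q i = (\<Sum>j<n. p j * [:coord f n (weight_map x (f j)) i, coord f n (s (f j) - weight_map x (f j)) i:])" for i
    have "coord f n ((line s \<epsilon> ^^ Suc k) v) i = poly (q i) \<epsilon>" for i \<epsilon>
    proof -
      have X: "linear_on I (line s \<epsilon>)"
        by (rule linear_on_ideal_of_derivation[OF derivation_line[OF s]])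
      have Xv: "(line s \<epsilon> ^^ k) v \<in> I" using linear_onD(1)[OF linear_on_funpow[OF X] v] .
      have "coord f n (line s \<epsilon> ((line s \<epsilon> ^^ k) v)) i
          = (\<Sum>j<n. coord f n ((line s \<epsilon> ^^ k) v) j * coord f n (line s \<epsilon> (f j)) i)"
        by (rule coord_linear_sum[OF X Xv])
      also have "\<dots> = (\<Sum>j<n. poly (p j) \<epsilon> *
          (coord f n (weight_map x (f j)) i + \<epsilon> * coord f n (s (f j) - weight_map x (f j)) i))"
      proof (rule sum.cong[OF refl])
        fix j assume "j \<in> {..<n}"
        then have j: "j < n" by simp
        have I: "weight_map x (f j) \<in> I" "s (f j) - weight_map x (f j) \<in> I"
          using linear_onD(1)[OF linear_on_ideal_of_derivation[OF s]] weight_map_ideal basis_in_ideal[OF j] ideal_closed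
          by auto
        show "coord f n ((line s \<epsilon> ^^ k) v) j * coord f n (line s \<epsilon> (f j)) i = poly (p j) \<epsilon> *
          (coord f n (weight_map x (f j)) i + \<epsilon> * coord f n (s (f j) - weight_map x (f j)) i)"
          using p j coord_linear_ideal(1)[OF I(1) ideal_closed(4)[OF I(2)]] coord_linear_ideal(3)[OF I(2)] by simp
      qed
      also have "\<dots> = poly (q i) \<epsilon>" by (simp add: q_def poly_sum algebra_simps)
      finally show ?thesis by simp
    qed
    then show ?case by (intro exI[of _ q] allI impI)
  qed
  then have "\<forall>i<n. \<exists>p. \<forall>j<n. \<forall>\<epsilon>. coord f n ((line s \<epsilon> ^^ k) (w i)) j = poly (p j) \<epsilon>" using w by simp
  then obtain p where "\<forall>i<n. \<forall>j<n. \<forall>\<epsilon>. coord f n ((line s \<epsilon> ^^ k) (w i)) j = poly (p i j) \<epsilon>" by metis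
  then have "\<forall>\<epsilon>. (\<Sum>i<n. coord f n ((line s \<epsilon> ^^ k) (w i)) i) = poly (\<Sum>i<n. p i i) \<epsilon>"
    by (simp add: poly_sum)
  then show ?thesis by blast
qed

text \<open>For almost all \<open>\<epsilon>\<close> the derivations of the ideal modulo commutators with \<open>line s \<epsilon>\<close> and inner
  derivations form a space of dimension at most \<open>m - n\<close>, and the functionals
  \<open>tr ((line s \<epsilon>)\<^sup>k -)\<close> are defined on it. At \<open>\<epsilon> = 1\<close>, hence for almost all \<open>\<epsilon>\<close>, they separate the
  combinations of the \<open>w j\<close>.\<close>

lemma separated_derivations_le:
  assumes nil: "lie_nilpotent idl"
    and s: "lie_derivation idl s" and w: "\<And>j. j < q \<Longrightarrow> lie_derivation idl (w j)"
    and sep: "\<And>b. (\<And>k. k < K \<Longrightarrow> (\<Sum>j<q. trace_on f n (\<lambda>v. (s ^^ k) (w j v)) * b j) = 0) \<Longrightarrow> \<forall>j<q. b j = 0"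
  shows "q \<le> m - n"
proof (rule ccontr)
  assume "\<not> q \<le> m - n"
  then have q: "m - n < q" by simp
  have wI: "w j v \<in> I" if "j < q" "v \<in> I" for j v
    using linear_onD(1)[OF linear_on_ideal_of_derivation[OF w[OF that(1)]] that(2)] .
  have "\<exists>p. \<forall>\<epsilon>. trace_on f n (\<lambda>v. (line s \<epsilon> ^^ k) (w j v)) = poly p \<epsilon>" if "j < q" for k j
    unfolding trace_on_def by (rule trace_line_poly[OF s wI[OF that basis_in_ideal]])
  then have "\<forall>k j. \<exists>p. j < q \<longrightarrow> (\<forall>\<epsilon>. trace_on f n (\<lambda>v. (line s \<epsilon> ^^ k) (w j v)) = poly p \<epsilon>)"
    by metis
  then obtain A where A: "\<forall>k j. j < q \<longrightarrow> (\<forall>\<epsilon>. trace_on f n (\<lambda>v. (line s \<epsilon> ^^ k) (w j v)) = poly (A k j) \<epsilon>)"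
    by metis
  have line1: "(line s 1 ^^ k) v = (s ^^ k) v" for k v by (simp add: add_diff_eq)
  have fin1: "finite {\<epsilon>. \<exists>b. (\<forall>k<K. (\<Sum>j<q. poly (A k j) \<epsilon> * b j) = 0) \<and> (\<exists>j<q. b j \<noteq> 0)}"
  proof (rule injective_poly_cofinite[where ?e0.0 = 1])
    fix b assume *: "\<And>k. k < K \<Longrightarrow> (\<Sum>j<q. poly (A k j) 1 * b j) = 0"
    have "(\<Sum>j<q. trace_on f n (\<lambda>v. (s ^^ k) (w j v)) * b j) = (\<Sum>j<q. poly (A k j) 1 * b j)" for k
      using A[rule_format, of _ k 1] line1 by (intro sum.cong) auto
    then show "\<forall>j<q. b j = 0" using sep * by simp
  qed
  \<comment> \<open>Both exceptional sets are finite, one controlled from parameter 1 and the other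
    from parameter 0, so one parameter avoids both.\<close>
  obtain \<epsilon> where \<epsilon>: "\<epsilon> \<notin> {\<epsilon>. \<exists>b. (\<forall>k<K. (\<Sum>j<q. poly (A k j) \<epsilon> * b j) = 0) \<and> (\<exists>j<q. b j \<noteq> 0)}"
    "\<epsilon> \<notin> {\<epsilon>. \<not> (\<forall>D. lie_derivation idl D \<longrightarrow> (\<exists>E. \<exists>a\<in>lcarrier L. lie_derivation idl E \<and>
      (\<forall>v\<in>I. D v = lbracket L a v + (line s \<epsilon> (E v) - E (line s \<epsilon> v)))))}"
    using ex_new_if_finite[OF infinite_UNIV_char_0 finite_UnI[OF fin1 derivation_mod_inner_cofinite[OF s]]]
    by blast
  let ?X = "line s \<epsilon>"
  have X: "lie_derivation idl ?X" by (rule derivation_line[OF s])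
  have Xl: "linear_on I ?X" by (rule linear_on_ideal_of_derivation[OF X])
  have Xkl: "linear_on I (?X ^^ k)" for k by (rule linear_on_funpow[OF Xl])
  have "\<forall>j<q. \<exists>E. \<exists>a\<in>lcarrier L. lie_derivation idl E \<and>
      (\<forall>v\<in>I. w j v = lbracket L a v + (?X (E v) - E (?X v)))"
    using \<epsilon>(2) w by blast
  then obtain E where "\<forall>j<q. \<exists>a\<in>lcarrier L. lie_derivation idl (E j) \<and>
      (\<forall>v\<in>I. w j v = lbracket L a v + (?X (E j v) - E j (?X v)))" by metis
  then obtain a where Ea: "\<forall>j<q. a j \<in> lcarrier L \<and> lie_derivation idl (E j) \<and>
      (\<forall>v\<in>I. w j v = lbracket L (a j) v + (?X (E j v) - E j (?X v)))" by metis
  \<comment> \<open>There are more derivations \<open>w j\<close> than basis vectors beyond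
    \<open>I\<close>, so some nontrivial combination \<open>a'\<close> of the elements
    \<open>a j\<close> has no coordinate beyond \<open>I\<close>.\<close>
  obtain b where b: "\<exists>j<q. b j \<noteq> 0" "\<forall>i<m - n. (\<Sum>j<q. coord f m (a j) (n + i) * b j) = 0"
    using underdetermined_system[OF q, of "\<lambda>i j. coord f m (a j) (n + i)"] by blast
  define a' where "a' = (\<Sum>j<q. lscale L (b j) (a j))"
  have aC: "a j \<in> lcarrier L" if "j < q" for j using Ea that by blast
  have a'C: "a' \<in> lcarrier L"
    unfolding a'_def using aC by (intro subspace_sum[OF carrier_subspace]) auto
  have a': "a' \<in> I"
  proof -
    have "coord f m a' i = 0" if i: "i < m" "n \<le> i" for i
    proof -
      have "coord f m a' i = (\<Sum>j<q. b j * coord f m (a j) i)"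
        unfolding a'_def using aC carrier by (intro coord_lincomb[OF indep]) auto
      also have "\<dots> = (\<Sum>j<q. coord f m (a j) (n + (i - n)) * b j)" using i by (simp add: mult.commute)
      also have "\<dots> = 0" using b(2) i by (metis diff_less_mono)
      finally show ?thesis .
    qed
    then have "a' \<in> span (f ` {..<n})"
      using in_span_image_iff_coord[OF indep, of "{..<n}" a'] a'C carrier le by auto
    then show ?thesis using ideal by (simp add: family_span_def)
  qed
  \<comment> \<open>Commutators do not contribute to the trace, so the combination of the
    \<open>w j\<close> has the same traces as \<open>ad a'\<close>. These vanish since
    \<open>a'\<close> lies in \<open>I\<close>, against the separation at this parameter.\<close>
  have "(\<Sum>j<q. poly (A k j) \<epsilon> * b j) = 0" for k
  proof -
    have tr: "poly (A k j) \<epsilon> = trace_on f n (\<lambda>v. (?X ^^ k) (lbracket L (a j) v))" if j: "j < q" for j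
    proof -
      have Ej: "linear_on I (E j)" using Ea j linear_on_ideal_of_derivation by blast
      have "poly (A k j) \<epsilon> = trace_on f n (\<lambda>v. (?X ^^ k) (w j v))" using A j by simp
      also have "\<dots> = trace_on f n (\<lambda>v. (?X ^^ k) (lbracket L (a j) v)) + trace_on f n (\<lambda>v. (?X ^^ k) (?X (E j v) - E j (?X v)))"
        unfolding trace_on_def sum.distrib[symmetric]
      proof (rule sum.cong[OF refl])
        fix i assume "i \<in> {..<n}"
        then have fI: "f i \<in> I" using basis_in_ideal by simp
        have I: "lbracket L (a j) (f i) \<in> I" "?X (E j (f i)) - E j (?X (f i)) \<in> I"
          using aC[OF j] fI ideal_in_carrier bracket_carrier linear_onD(1)[OF Ej] linear_onD(1)[OF Xl] ideal_closed(3)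
          by auto
        have "w j (f i) = lbracket L (a j) (f i) + (?X (E j (f i)) - E j (?X (f i)))" using Ea j fI by blast
        then have "(?X ^^ k) (w j (f i)) = (?X ^^ k) (lbracket L (a j) (f i)) + (?X ^^ k) (?X (E j (f i)) - E j (?X (f i)))"
          using linear_onD(2)[OF Xkl I] by simp
        then show "coord f n ((?X ^^ k) (w j (f i))) i = coord f n ((?X ^^ k) (lbracket L (a j) (f i))) i
            + coord f n ((?X ^^ k) (?X (E j (f i)) - E j (?X (f i)))) i"
          using coord_linear_ideal(1)[OF linear_onD(1)[OF Xkl I(1)] linear_onD(1)[OF Xkl I(2)]] by simp
      qed
      also have "\<dots> = trace_on f n (\<lambda>v. (?X ^^ k) (lbracket L (a j) v))"
        using trace_funpow_commutator_zero[OF Xl Ej] by simp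
      finally show ?thesis .
    qed
    have "(\<Sum>j<q. poly (A k j) \<epsilon> * b j) = (\<Sum>i<n. \<Sum>j<q. b j * coord f n ((?X ^^ k) (lbracket L (a j) (f i))) i)"
      unfolding trace_on_def[symmetric]
      by (subst sum.swap) (simp add: tr trace_on_def sum_distrib_left sum_distrib_right mult.commute)
    also have "\<dots> = trace_on f n (\<lambda>v. (?X ^^ k) (lbracket L a' v))"
      unfolding trace_on_def
    proof (rule sum.cong[OF refl])
      fix i assume "i \<in> {..<n}"
      then have fI: "f i \<in> I" using basis_in_ideal by simp
      have I: "lbracket L (a j) (f i) \<in> I" if "j < q" for j
        using aC[OF that] fI ideal_in_carrier bracket_carrier by blast
      have "lbracket L a' (f i) = (\<Sum>j<q. lscale L (b j) (lbracket L (a j) (f i)))"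
        unfolding a'_def using aC fI ideal_in_carrier by (intro bracket_sum_left) auto
      then have "(?X ^^ k) (lbracket L a' (f i)) = (\<Sum>j<q. lscale L (b j) ((?X ^^ k) (lbracket L (a j) (f i))))"
        using linear_on_sum[OF Xkl subspace_ideal, of "{..<q}" "\<lambda>j. lbracket L (a j) (f i)"] I by simp
      then show "(\<Sum>j<q. b j * coord f n ((?X ^^ k) (lbracket L (a j) (f i))) i)
          = coord f n ((?X ^^ k) (lbracket L a' (f i))) i"
        using coord_lincomb[OF indep_ideal, of "{..<q}" "\<lambda>j. (?X ^^ k) (lbracket L (a j) (f i))"]
          I linear_onD(1)[OF Xkl] ideal by simp
    qed
    also have "\<dots> = 0" by (rule trace_funpow_inner_zero[OF nil X a'])
    finally show ?thesis .
  qed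
  then show False using \<epsilon>(1) b(1) by blast
qed

end

text \<open>The derivations to be separated are the actions, transported to \<open>I\<close>, of the
  basis vectors of \<open>M\<close> beyond its nilradical; \<open>s\<close> is the action of a
  generic element of \<open>M\<close>. Since both nilradicals have dimension \<open>n\<close>,
  bounding the number of these vectors by \<open>m - n\<close> bounds the dimension of
  \<open>M\<close>.\<close>

lemma complete_solvable_dim_ge:
  fixes R :: "'r::ab_group_add lie" and M :: "'m::ab_group_add lie"
  assumes R: "lie_algebra R" "lie_solvable R" "is_nilradical R I"
    and complete: "\<And>D. lie_derivation R D \<Longrightarrow> inner_derivation R D"
    and M: "lie_algebra M" "lie_solvable M" "is_nilradical M J"
    and iso: "lie_isomorphic (R\<lparr>lcarrier := I\<rparr>) (M\<lparr>lcarrier := J\<rparr>)"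
  shows "lie_dim M \<le> lie_dim R"
proof -
  obtain f0 n m wt where "weight_basis R I f0 n m wt"
    using lie_algebra.ex_weight_basis[OF R] by blast
  then obtain f x where "adapted_weight_basis R I f n m wt x"
    using weight_basis.ex_adapted by blast
  then interpret R: complete_weight_basis R I f n m wt x
    using complete by (simp add: complete_weight_basis_def complete_weight_basis_axioms_def)
  obtain g n' m' wt' where "weight_basis M J g n' m' wt'"
    using lie_algebra.ex_weight_basis[OF M] by blast
  then interpret M: weight_basis M J g n' m' wt' .
  have P: "complex_space (lscale (R\<lparr>lcarrier := I\<rparr>))"
    using R.complex_space_axioms by simp
  obtain \<rho> e where e: "R.indep_family e n'" "R.family_span e n' = I"
    and \<rho>: "\<forall>z\<in>lcarrier M. lie_derivation R.idl (\<rho> z) \<and> R.triangular e n' (\<rho> z) (wt' z)"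
    using M.transported_adjoint_action[OF P iso] R.ideal_closed R.bracket_carrier R.ideal_in_carrier by auto
  have n: "n' = n"
    using R.dim_family_span[OF e(1)] R.dim_family_span[OF R.indep_ideal] e(2) R.ideal by simp
  obtain z where z: "z \<in> lcarrier M" "\<forall>i<m'. \<forall>j<m'. wt' z i = wt' z j \<longrightarrow> (\<forall>y\<in>lcarrier M. wt' y i = wt' y j)"
    using M.ex_generic by blast
  define q where "q = m' - n"
  have gC: "g (n + j) \<in> lcarrier M" if "j < q" for j
    using that by (intro M.basis_in_carrier) (simp add: q_def)
  \<comment> \<open>All transported actions are triangular in the one basis \<open>e\<close>, so the
    trace is read off the weights; the change to the basis \<open>f\<close> does not affect
    it.\<close>
  have tr: "R.trace_on f n (\<lambda>v. (\<rho> z ^^ k) (\<rho> y v)) = (\<Sum>i<n. wt' z i ^ k * wt' y i)"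
    if y: "y \<in> lcarrier M" for y k
  proof -
    have l: "R.linear_on I (\<rho> z)" "R.linear_on I (\<rho> y)"
      using \<rho> z(1) y R.linear_on_ideal_of_derivation by auto
    have lk: "R.linear_on I (\<rho> z ^^ k)" by (rule R.linear_on_funpow[OF l(1)])
    have sub: "R.family_span e n' \<subseteq> I" using e(2) by simp
    have "R.triangular e n' (\<lambda>v. (\<rho> z ^^ k) (\<rho> y v)) (\<lambda>i. wt' z i ^ k * wt' y i)"
      by (rule R.triangular_comp[OF R.triangular_funpow[OF _ l(1) R.subspace_ideal sub] _ lk R.subspace_ideal sub l(2)])
         (use \<rho> z(1) y in blast)+
    from R.trace_triangular[OF e(1) this]
    have "R.trace_on e n' (\<lambda>v. (\<rho> z ^^ k) (\<rho> y v)) = (\<Sum>i<n. wt' z i ^ k * wt' y i)" by (simp add: n)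
    moreover have "R.trace_on f n (\<lambda>v. (\<rho> z ^^ k) (\<rho> y v)) = R.trace_on e n' (\<lambda>v. (\<rho> z ^^ k) (\<rho> y v))"
      using R.linear_on_comp[OF lk l(2)] e R.ideal
      by (intro R.trace_on_basis_indep[OF R.indep_ideal e(1)]) simp_all
    ultimately show ?thesis by simp
  qed
  \<comment> \<open>The powers below \<open>n\<close> suffice, as there are at most \<open>n\<close>
    distinct weights of \<open>z\<close> on the nilradical.\<close>
  have "q \<le> m - n"
  proof (rule R.separated_derivations_le)
    show "lie_nilpotent R.idl" using R(3) by (simp add: is_nilradical_def)
    show "lie_derivation R.idl (\<rho> z)" using \<rho> z(1) by blast
    show "lie_derivation R.idl (\<rho> (g (n + j)))" if "j < q" for j using \<rho> gC[OF that] by blast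
    fix b assume b: "\<And>k. k < n \<Longrightarrow>
      (\<Sum>j<q. R.trace_on f n (\<lambda>v. (\<rho> z ^^ k) (\<rho> (g (n + j)) v)) * b j) = 0"
    define u where "u = (\<Sum>j<q. lscale M (b j) (g (n + j)))"
    have u: "u \<in> lcarrier M"
      unfolding u_def using gC by (intro M.subspace_sum[OF M.carrier_subspace]) auto
    have wt_u: "wt' u i = (\<Sum>j<q. b j * wt' (g (n + j)) i)" if "i < n" for i
      unfolding u_def using gC that n M.le by (intro M.wt_lincomb) auto
    have "(\<Sum>i<n. wt' z i ^ k * wt' u i) = 0" if k: "k < n" for k
    proof -
      have "(\<Sum>i<n. wt' z i ^ k * wt' u i) = (\<Sum>i<n. \<Sum>j<q. wt' z i ^ k * wt' (g (n + j)) i * b j)"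
        by (simp add: wt_u sum_distrib_left mult_ac)
      also have "\<dots> = (\<Sum>j<q. R.trace_on f n (\<lambda>v. (\<rho> z ^^ k) (\<rho> (g (n + j)) v)) * b j)"
        by (subst sum.swap) (simp add: tr gC sum_distrib_right)
      finally show ?thesis using b[OF k] by simp
    qed
    \<comment> \<open>Genericity of \<open>z\<close> is what \<open>power_sums_zero\<close>
      requires: where the weights of \<open>z\<close> coincide, so do those of
      \<open>u\<close>.\<close>
    moreover have "wt' u i = wt' u j" if "i < n" "j < n" "wt' z i = wt' z j" for i j
      using z(2) u that n M.le by (metis less_le_trans)
    ultimately have "wt' u i = 0" if "i < n" for i
      using power_sums_zero[of n "wt' z" "wt' u" i] that by blast
    \<comment> \<open>The combination \<open>u\<close> involves only basis vectors beyond
      \<open>J\<close>, so lying in \<open>J\<close> makes all its coefficients vanish.\<close>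
    then have "u \<in> J" using M.in_ideal_iff_wt u n by blast
    show "\<forall>j<q. b j = 0"
    proof (intro allI impI)
      fix j assume j: "j < q"
      have "M.coord g m' u (n + j) = (\<Sum>l<q. b l * M.coord g m' (g (n + l)) (n + j))"
        unfolding u_def using gC M.carrier by (intro M.coord_lincomb[OF M.indep]) auto
      also have "\<dots> = (\<Sum>l<q. if l = j then b l else 0)"
        using j by (intro sum.cong) (auto simp: M.coord_base[OF M.indep] q_def)
      also have "\<dots> = b j" using j by simp
      finally show "b j = 0"
        using M.coord_lower[OF M.indep M.le, of u "n + j"] \<open>u \<in> J\<close> M.ideal n j by (simp add: q_def)
    qed
  qed
  then show ?thesis using M.dim_carrier R.dim_carrier R.le M.le n by (simp add: q_def)
qed

theorem proposition4p3:
  fixes N :: "'n::ab_group_add lie" and R :: "'r::ab_group_add lie"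
  assumes "lie_algebra N"
    and "pure_non_characteristically_nilpotent N"
    and "non_maximal_solvable_extension N R"
  shows "\<exists>D. outer_derivation R D"
proof (rule ccontr)
  assume "\<nexists>D. outer_derivation R D"
  then have complete: "inner_derivation R D" if "lie_derivation R D" for D
    using that by (auto simp: outer_derivation_def)
  have ext: "solvable_extension N R" and "\<not> maximal_solvable_extension N R"
    using assms(3) by (auto simp: non_maximal_solvable_extension_def)
  \<comment> \<open>Failure of maximality supplies an extension of strictly larger dimension, which
    \<open>complete_solvable_dim_ge\<close> rules out once both nilradicals are identified through
    \<open>N\<close>.\<close>
  then obtain M :: "(nat \<Rightarrow> complex) lie" where
    M: "solvable_extension N M" "\<not> lie_dim M \<le> lie_dim R"
    by (auto simp: maximal_solvable_extension_def)
  obtain I where I: "is_nilradical R I" "lie_isomorphic N (R\<lparr>lcarrier := I\<rparr>)"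
    using ext by (auto simp: solvable_extension_def)
  obtain J where J: "is_nilradical M J" "lie_isomorphic N (M\<lparr>lcarrier := J\<rparr>)"
    using M(1) by (auto simp: solvable_extension_def)
  have "lie_dim M \<le> lie_dim R"
    by (rule complete_solvable_dim_ge[OF _ _ I(1) _ _ _ J(1)])
       (use ext M(1) complete lie_isomorphic_common_source[OF assms(1) I(2) J(2)]
        in \<open>simp_all add: solvable_extension_def\<close>)
  then show False using M(2) by simp
qed

end
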